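(* Assume that $L/K$ is Galois with group $G=\mathrm{Gal}(L/K)$. The following hold. (i) The map $$(\widetilde F_{\mathfrak p})_{\mathfrak p}\colon\mathcal F(\mathfrak O)\longrightarrow\bigoplus_{\mathfrak p\in\mathrm{mSpec}\,\mathfrak o}\mathcal S^u_{0,b}(G/D_{\mathfrak p};\widetilde V_{\mathfrak p}),\qquad \widetilde F_{\mathfrak p}(I)(\sigma D_{\mathfrak p})=\tilde f_I(\sigma(\mathfrak p_L)),$$ is a $G$-equivariant isomorphism of monoids. (ii) The image of $\mathrm{Reg}\,\mathcal F(\mathfrak O)$ under $(\widetilde F_{\mathfrak p})_{\mathfrak p}$ is $\bigoplus_{\mathfrak p\in\mathrm{mSpec}\,\mathfrak o}\mathcal S^u_{0,\mathrm{ref}}(G/D_{\mathfrak p};\widetilde V_{\mathfrak p})$. (iii) The image of $\mathcal I(\mathfrak O)$ under $(\widetilde F_{\mathfrak p})_{\mathfrak p}$ is $\bigoplus_{\mathfrak p\in\mathrm{mSpec}\,\mathfrak o}\mathcal S^u_{0,\mathrm{ref}}(G/D_{\mathfrak p};\mathrm{val}_{\mathfrak p})$.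
   Context: Setting: $\mathfrak o$ is a Dedekind domain which is not a field, $K$ its fraction field, $L/K$ an algebraic extension of fields (possibly of infinite degree), and $\mathfrak O$ the integral closure of $\mathfrak o$ in $L$. $\mathrm{mSpec}$ denotes the set of maximal ideals. Ideals: a fractional ideal of $\mathfrak O$ is a non-zero $\mathfrak O$-submodule $I\subseteq L$ with $dI\subseteq\mathfrak O$ for some $d\in L^\times$; it is invertible if $IJ=\mathfrak O$ for some fractional ideal $J$. $\mathcal F(\mathfrak O)$ is the commutative monoid of fractional ideals under multiplication, $\mathcal I(\mathfrak O)$ the group of invertible ones. $G$ acts on $\mathcal F(\mathfrak O)$ by $I\mapsto\sigma(I)$. For a monoid $A$, $\mathrm{Reg}\,A$ is the set of $a\in A$ such that $a=aba$ for some $b\in A$. The monoid $\widetilde{\mathbb R}$: $\widetilde{\mathbb R}=\mathbb R\times\{0,1\}$ with the lexicographic total order and addition $(\alpha,s)+(\beta,t)=(\alpha+\beta,\max\{s,t\})$; put $\iota(\alpha,s)=(-\alpha,s)$. Functions: let $X$ be a topological space and $M$ a submonoid of $\widetilde{\mathbb R}$. A function $\tilde f\colon X\to M$ is upper $\widetilde{\mathbb R}$-semicontinuous if $\{x\in X:\tilde f(x)<a\}$ is open for every $a\in\widetilde{\mathbb R}$; compactly supported if there is a compact $Y\subseteq X$ with $\tilde f=(0,0)$ on $X\setminus Y$; bounded if there are $a,b\in\widetilde{\mathbb R}$ with $a\le\tilde f(x)\le b$ for all $x$. $\mathcal S^u_{0,b}(X;M)$ is the commutative monoid (under pointwise addition)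 of bounded, compactly supported, upper $\widetilde{\mathbb R}$-semicontinuous functions $X\to M$; if $\iota(M)=M$, $\mathcal S^u_{0,\mathrm{ref}}(X;M)$ is the submonoid of those $\tilde f$ with $\iota\circ\tilde f\in\mathcal S^u_{0,b}(X;M)$. Valuations: for $\mathfrak P\in\mathrm{mSpec}\,\mathfrak O$, $v_{\mathfrak P}\colon L^\times\to\mathbb Q$ is the unique additive valuation corresponding to $\mathfrak P$ normalized by $v_{\mathfrak P}(K^\times)=\mathbb Z$; put $v_{\mathfrak P}(0)=+\infty$. $V_{\mathfrak P}$ is the closure of $v_{\mathfrak P}(L^\times)$ in $\mathbb R$. Put $\mathrm{val}_{\mathfrak P}=\{(\alpha,0):\alpha\in v_{\mathfrak P}(L^\times)\}$, and $\widetilde V_{\mathfrak P}=\mathrm{val}_{\mathfrak P}\sqcup\{(\beta,1):\beta\in\mathbb R\}$ if $V_{\mathfrak P}=\mathbb R$, $\widetilde V_{\mathfrak P}=\mathrm{val}_{\mathfrak P}$ if $V_{\mathfrak P}=v_{\mathfrak P}(L^\times)$ (exactly one of these cases occurs); these are $\iota$-stable submonoids of $\widetilde{\mathbb R}$. For $I\in\mathcal F(\mathfrak O)$ put $f_I(\mathfrak P)=\inf\{v_{\mathfrak P}(x):x\in I\}$, let $\mathrm{Max}(I)$ be the set of $\mathfrak P$ for which this infimum is attained by some $x\in I$, and put $\tilde f_I(\mathfrak P)=(f_I(\mathfrak P),0)$ if $\mathfrak P\in\mathrm{Max}(I)$ and $\tilde f_I(\mathfrak P)=(f_I(\mathfrak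 P),1)$ otherwise. Galois notation: for each $\mathfrak p\in\mathrm{mSpec}\,\mathfrak o$ fix a maximal ideal $\mathfrak p_L$ of $\mathfrak O$ above $\mathfrak p$; $D_{\mathfrak p}\subseteq G$ is its decomposition group (the stabilizer of $\mathfrak p_L$), and $G/D_{\mathfrak p}$ has the quotient topology of the Krull topology. Put $\mathrm{val}_{\mathfrak p}=\mathrm{val}_{\mathfrak p_L}$, $\widetilde V_{\mathfrak p}=\widetilde V_{\mathfrak p_L}$. $G$ acts on functions $\tilde g$ on $G/D_{\mathfrak p}$ by $(\sigma\tilde g)(\tau D_{\mathfrak p})=\tilde g(\sigma^{-1}\tau D_{\mathfrak p})$, and componentwise on direct sums. A direct sum of commutative monoids consists of the families with all but finitely many components equal to the identity. *)

theory Defs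
  imports
    "HOL-Analysis.Analysis"
    "HOL-Computational_Algebra.Computational_Algebra"
    "HOL-Algebra.Algebra"
    "HOL-Algebra.Algebraic_Closure_Type"
begin

text \<open>
  The top field \<open>L\<close> is a type \<open>'l\<close> of class \<open>field\<close>; the rings and fields \<open>\<oo>\<close>, \<open>K\<close>, \<open>\<OO>\<close>
  of the setting are subsets of \<open>'l\<close>, so that \<open>\<oo> \<subseteq> K \<subseteq> L\<close> and \<open>\<oo> \<subseteq> \<OO> \<subseteq> L\<close> are inclusions.
  Ring-theoretic notions are those of HOL-Algebra, applied to the ring record of the type
  \<open>'l\<close> and to its restrictions to subsets.
\<close>

abbreviation LL :: "'l::field ring"
  where "LL \<equiv> ring_of_type_algebra"

abbreviation ring_on :: "'l::field set \<Rightarrow> 'l ring"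
  where "ring_on R \<equiv> ring_of_type_algebra\<lparr>carrier := R\<rparr>"

definition fraction_field :: "'l::field set \<Rightarrow> 'l set"
  where "fraction_field R = {a / b | a b. a \<in> R \<and> b \<in> R \<and> b \<noteq> 0}"

definition polys_over :: "'l::field set \<Rightarrow> 'l Polynomial.poly set"
  where "polys_over R = {p. \<forall>i. Polynomial.coeff p i \<in> R}"

definition integral_over :: "'l::field set \<Rightarrow> 'l \<Rightarrow> bool"
  where "integral_over R x \<longleftrightarrow>
    (\<exists>p \<in> polys_over R. Polynomial.lead_coeff p = 1 \<and> Polynomial.poly p x = 0)"

definition integral_closure :: "'l::field set \<Rightarrow> 'l set"
  where "integral_closure R = {x. integral_over R x}"

definition mSpec :: "'l::field set \<Rightarrow> 'l set set"
  where "mSpec R = {P. maximalideal P (ring_on R)}"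

definition dedekind_domain :: "'l::field set \<Rightarrow> bool"
  where "dedekind_domain R \<longleftrightarrow>
    subring R LL \<and> noetherian_domain (ring_on R) \<and>
    (\<forall>x \<in> fraction_field R. integral_over R x \<longrightarrow> x \<in> R) \<and>
    (\<forall>P. primeideal P (ring_on R) \<and> P \<noteq> {0} \<longrightarrow> maximalideal P (ring_on R))"

definition irreducible_over :: "'l::field set \<Rightarrow> 'l Polynomial.poly \<Rightarrow> bool"
  where "irreducible_over K p \<longleftrightarrow>
    p \<in> polys_over K \<and> Polynomial.degree p > 0 \<and>
    (\<forall>q \<in> polys_over K. \<forall>r \<in> polys_over K. p = q * r \<longrightarrow>
       Polynomial.degree q = 0 \<or> Polynomial.degree r = 0)"

definition algebraic_extension :: "'l::field set \<Rightarrow> bool"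
  where "algebraic_extension K \<longleftrightarrow>
    (\<forall>x. \<exists>p \<in> polys_over K. p \<noteq> 0 \<and> Polynomial.poly p x = 0)"

definition normal_extension :: "'l::field set \<Rightarrow> bool"
  where "normal_extension K \<longleftrightarrow>
    (\<forall>p. irreducible_over K p \<and> (\<exists>x. Polynomial.poly p x = 0) \<longrightarrow>
       (\<exists>c xs. p = Polynomial.smult c (\<Prod>x\<leftarrow>xs. [:- x, 1:])))"

definition separable_extension :: "'l::field set \<Rightarrow> bool"
  where "separable_extension K \<longleftrightarrow>
    (\<forall>p. irreducible_over K p \<and> (\<exists>x. Polynomial.poly p x = 0) \<longrightarrow>
       coprime p (Polynomial.pderiv p))"

definition galois_extension :: "'l::field set \<Rightarrow> bool"
  where "galois_extension K \<longleftrightarrow>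
    algebraic_extension K \<and> normal_extension K \<and> separable_extension K"

definition Gal :: "'l::field set \<Rightarrow> ('l \<Rightarrow> 'l) monoid"
  where "Gal K = \<lparr>carrier = {\<sigma> \<in> ring_iso LL LL. \<forall>x \<in> K. \<sigma> x = x},
                  monoid.mult = (\<circ>), one = id\<rparr>"

text \<open>The sets \<open>\<sigma> Gal(L/E)\<close>, for \<open>E\<close> finite over \<open>K\<close>, even form a basis.\<close>

definition krull_topology :: "'l::field set \<Rightarrow> ('l \<Rightarrow> 'l) topology"
  where "krull_topology K = topology_generated_by
    {l_coset (Gal K) \<sigma> (carrier (Gal E)) | \<sigma> E.
       \<sigma> \<in> carrier (Gal K) \<and> subfield E LL \<and> K \<subseteq> E \<and> ring.finite_dimension LL K E}"

definition quotient_topology :: "'a topology \<Rightarrow> ('a \<Rightarrow> 'b) \<Rightarrow> 'b topology"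
  where "quotient_topology T q = topology (\<lambda>U. U \<subseteq> q ` topspace T \<and>
    openin T {x \<in> topspace T. q x \<in> U})"

lemma openin_quotient_topology:
  "openin (quotient_topology T q) U \<longleftrightarrow>
     U \<subseteq> q ` topspace T \<and> openin T {x \<in> topspace T. q x \<in> U}"
proof -
  have "istopology (\<lambda>U. U \<subseteq> q ` topspace T \<and> openin T {x \<in> topspace T. q x \<in> U})"
    unfolding istopology_def
  proof (intro conjI allI impI)
    fix U V
    assume "U \<subseteq> q ` topspace T \<and> openin T {x \<in> topspace T. q x \<in> U}"
      and "V \<subseteq> q ` topspace T \<and> openin T {x \<in> topspace T. q x \<in> V}"
    moreover have "{x \<in> topspace T. q x \<in> U \<inter> V} =
        {x \<in> topspace T. q x \<in> U} \<inter> {x \<in> topspace T. q x \<in> V}" by auto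
    ultimately show "U \<inter> V \<subseteq> q ` topspace T"
      and "openin T {x \<in> topspace T. q x \<in> U \<inter> V}" by auto
  next
    fix \<K> assume *: "\<forall>U\<in>\<K>. U \<subseteq> q ` topspace T \<and> openin T {x \<in> topspace T. q x \<in> U}"
    then show "\<Union>\<K> \<subseteq> q ` topspace T" by auto
    have "{x \<in> topspace T. q x \<in> \<Union>\<K>} = (\<Union>U\<in>\<K>. {x \<in> topspace T. q x \<in> U})" by auto
    with * show "openin T {x \<in> topspace T. q x \<in> \<Union>\<K>}" by auto
  qed
  then show ?thesis by (simp add: quotient_topology_def)
qed

lemma topspace_quotient_topology: "topspace (quotient_topology T q) = q ` topspace T"
proof -
  have "{x \<in> topspace T. q x \<in> q ` topspace T} = topspace T" by auto
  then have "openin (quotient_topology T q) (q ` topspace T)"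
    by (simp add: openin_quotient_topology)
  then show ?thesis
    using openin_subset openin_topspace openin_quotient_topology by (metis subset_antisym)
qed

definition decomposition_group :: "'l::field set \<Rightarrow> 'l set \<Rightarrow> ('l \<Rightarrow> 'l) set"
  where "decomposition_group K P = stabilizer (Gal K) image P"

definition coset_space :: "'l::field set \<Rightarrow> 'l set \<Rightarrow> ('l \<Rightarrow> 'l) set topology"
  where "coset_space K P = quotient_topology (krull_topology K)
    (\<lambda>\<sigma>. l_coset (Gal K) \<sigma> (decomposition_group K P))"

lemma topspace_krull_topology:
  assumes "subfield K (LL :: 'l::field ring)"
  shows "topspace (krull_topology K) = carrier (Gal K)"
proof -
  interpret ring "LL :: 'l ring" by (rule ring_from_type_algebra)
  have fin: "finite_dimension K K"
    using assms dimension_one finite_dimension_def by blast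
  have sub: "l_coset (Gal K) \<sigma> (carrier (Gal E)) \<subseteq> carrier (Gal K)"
    if "\<sigma> \<in> carrier (Gal K)" "K \<subseteq> E" for \<sigma> E
  proof
    fix \<tau> assume "\<tau> \<in> l_coset (Gal K) \<sigma> (carrier (Gal E))"
    then obtain \<rho> where \<rho>: "\<rho> \<in> carrier (Gal E)" "\<tau> = \<sigma> \<circ> \<rho>"
      by (auto simp: l_coset_def Gal_def)
    have "\<tau> \<in> ring_iso LL LL"
      using that(1) \<rho> by (auto simp: Gal_def intro: ring_iso_set_trans)
    then show "\<tau> \<in> carrier (Gal K)" using that \<rho> by (auto simp: Gal_def)
  qed
  have "\<sigma> \<in> l_coset (Gal K) \<sigma> (carrier (Gal K))" for \<sigma>
  proof -
    have "id \<in> carrier (Gal K)"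
      by (auto simp: Gal_def ring_iso_def ring_hom_def ring_of_type_algebra_def)
    then show ?thesis by (force simp: l_coset_def Gal_def)
  qed
  then show ?thesis
    unfolding krull_topology_def topology_generated_by_topspace
    using sub fin assms by blast
qed

lemma topspace_coset_space:
  assumes "subfield K (LL :: 'l::field ring)"
  shows "topspace (coset_space K P) = lcosets\<^bsub>Gal K\<^esub> (decomposition_group K P)"
  by (auto simp: coset_space_def topspace_quotient_topology topspace_krull_topology[OF assms]
      LCOSETS_def)

definition fractional_ideal :: "'l::field set \<Rightarrow> 'l set \<Rightarrow> bool"
  where "fractional_ideal R I \<longleftrightarrow>
    additive_subgroup I LL \<and> (\<forall>r \<in> R. \<forall>x \<in> I. r * x \<in> I) \<and> I \<noteq> {0} \<and>
    (\<exists>d. d \<noteq> 0 \<and> (\<forall>x \<in> I. d * x \<in> R))"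

definition fractional_ideals :: "'l::field set \<Rightarrow> 'l set monoid"
  where "fractional_ideals R =
    \<lparr>carrier = {I. fractional_ideal R I}, monoid.mult = ideal_prod LL, one = R\<rparr>"

definition invertible_ideals :: "'l::field set \<Rightarrow> 'l set set"
  where "invertible_ideals R = {I \<in> carrier (fractional_ideals R).
    \<exists>J \<in> carrier (fractional_ideals R). I \<otimes>\<^bsub>fractional_ideals R\<^esub> J = R}"

definition Reg :: "('a, 'm) monoid_scheme \<Rightarrow> 'a set"
  where "Reg A = {a \<in> carrier A. \<exists>b \<in> carrier A. a = a \<otimes>\<^bsub>A\<^esub> b \<otimes>\<^bsub>A\<^esub> a}"

text \<open>The component in \<open>{0, 1}\<close> is a Boolean, with \<open>False\<close> for \<open>0\<close> and \<open>True\<close> for \<open>1\<close>.\<close>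

datatype rtilde = RT real bool

instantiation rtilde :: linorder
begin

fun less_rtilde :: "rtilde \<Rightarrow> rtilde \<Rightarrow> bool"
  where "RT a s < RT b t \<longleftrightarrow> a < b \<or> a = b \<and> s < t"

definition less_eq_rtilde :: "rtilde \<Rightarrow> rtilde \<Rightarrow> bool"
  where "x \<le> y \<longleftrightarrow> x < y \<or> x = (y :: rtilde)"

instance
proof
  fix x y z :: rtilde
  show "x < y \<longleftrightarrow> x \<le> y \<and> \<not> y \<le> x" "x \<le> y \<or> y \<le> x"
    by (cases x; cases y; auto simp: less_eq_rtilde_def)+
  show "x \<le> x" by (simp add: less_eq_rtilde_def)
  show "x \<le> y \<Longrightarrow> y \<le> z \<Longrightarrow> x \<le> z"
    by (cases x; cases y; cases z; auto simp: less_eq_rtilde_def)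
  show "x \<le> y \<Longrightarrow> y \<le> x \<Longrightarrow> x = y"
    by (cases x; cases y; auto simp: less_eq_rtilde_def)
qed

end

instantiation rtilde :: comm_monoid_add
begin

definition zero_rtilde :: rtilde where "0 = RT 0 False"

fun plus_rtilde :: "rtilde \<Rightarrow> rtilde \<Rightarrow> rtilde"
  where "RT a s + RT b t = RT (a + b) (max s t)"

instance
proof
  fix x y z :: rtilde
  show "x + y + z = x + (y + z)" by (cases x; cases y; cases z; simp add: max.assoc)
  show "x + y = y + x" by (cases x; cases y; simp add: max.commute)
  show "0 + x = x" by (cases x; simp add: zero_rtilde_def max_def)
qed

end

fun iota :: "rtilde \<Rightarrow> rtilde"
  where "iota (RT a s) = RT (- a) s"

definition upper_semicont :: "'x topology \<Rightarrow> ('x \<Rightarrow> rtilde) \<Rightarrow> bool"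
  where "upper_semicont T f \<longleftrightarrow> (\<forall>a. openin T {x \<in> topspace T. f x < a})"

definition compactly_supported :: "'x topology \<Rightarrow> ('x \<Rightarrow> rtilde) \<Rightarrow> bool"
  where "compactly_supported T f \<longleftrightarrow>
    (\<exists>Y. compactin T Y \<and> (\<forall>x \<in> topspace T - Y. f x = 0))"

definition bounded_fun :: "'x topology \<Rightarrow> ('x \<Rightarrow> rtilde) \<Rightarrow> bool"
  where "bounded_fun T f \<longleftrightarrow> (\<exists>a b. \<forall>x \<in> topspace T. a \<le> f x \<and> f x \<le> b)"

definition S_0b :: "'x topology \<Rightarrow> rtilde set \<Rightarrow> ('x \<Rightarrow> rtilde) monoid"
  where "S_0b T M =
    \<lparr>carrier = {f \<in> topspace T \<rightarrow>\<^sub>E M. bounded_fun T f \<and> compactly_supported T f \<and> upper_semicont T f},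
     monoid.mult = (\<lambda>f g. \<lambda>x\<in>topspace T. f x + g x), one = (\<lambda>x\<in>topspace T. 0)\<rparr>"

definition S_0ref :: "'x topology \<Rightarrow> rtilde set \<Rightarrow> ('x \<Rightarrow> rtilde) monoid"
  where "S_0ref T M = (S_0b T M)\<lparr>carrier :=
    {f \<in> carrier (S_0b T M). (\<lambda>x\<in>topspace T. iota (f x)) \<in> carrier (S_0b T M)}\<rparr>"

definition monoid_direct_sum ::
    "'i set \<Rightarrow> ('i \<Rightarrow> ('a, 'm) monoid_scheme) \<Rightarrow> ('i \<Rightarrow> 'a) monoid"
  where "monoid_direct_sum I A = (product_group I A)\<lparr>carrier :=
    {x \<in> carrier (product_group I A). finite {i \<in> I. x i \<noteq> \<one>\<^bsub>A i\<^esub>}}\<rparr>"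

definition rational_valuation :: "('l::field \<Rightarrow> ereal) \<Rightarrow> bool"
  where "rational_valuation v \<longleftrightarrow>
    v 0 = \<infinity> \<and> (\<forall>x. x \<noteq> 0 \<longrightarrow> (\<exists>q::rat. v x = ereal (of_rat q))) \<and>
    (\<forall>x y. v (x * y) = v x + v y) \<and> (\<forall>x y. min (v x) (v y) \<le> v (x + y))"

text \<open>A valuation corresponds to \<open>P\<close> if its valuation ring is the localization of \<open>R\<close> at \<open>P\<close>.\<close>

definition valuation_at :: "'l::field set \<Rightarrow> 'l set \<Rightarrow> 'l set \<Rightarrow> 'l \<Rightarrow> ereal"
  where "valuation_at K R P = (THE v. rational_valuation v \<and>
    {x. 0 \<le> v x} = {a / s | a s. a \<in> R \<and> s \<in> R - P} \<and>
    v ` (K - {0}) = range (\<lambda>n::int. ereal (of_int n)))"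

definition value_group :: "'l::field set \<Rightarrow> 'l set \<Rightarrow> 'l set \<Rightarrow> real set"
  where "value_group K R P = {\<alpha>. \<exists>x. x \<noteq> 0 \<and> valuation_at K R P x = ereal \<alpha>}"

definition val_set :: "'l::field set \<Rightarrow> 'l set \<Rightarrow> 'l set \<Rightarrow> rtilde set"
  where "val_set K R P = {RT \<alpha> False | \<alpha>. \<alpha> \<in> value_group K R P}"

text \<open>
  The value group is a non-zero subgroup of the rationals, hence either dense in the reals or
  discrete; the second case below is the one where it equals its closure.
\<close>

definition V_tilde :: "'l::field set \<Rightarrow> 'l set \<Rightarrow> 'l set \<Rightarrow> rtilde set"
  where "V_tilde K R P =
    (if closure (value_group K R P) = UNIV then val_set K R P \<union> {RT \<beta> True | \<beta>. True}
     else val_set K R P)"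

definition inf_val :: "'l::field set \<Rightarrow> 'l set \<Rightarrow> 'l set \<Rightarrow> 'l set \<Rightarrow> ereal"
  where "inf_val K R I P = (INF x\<in>I. valuation_at K R P x)"

definition Max_set :: "'l::field set \<Rightarrow> 'l set \<Rightarrow> 'l set \<Rightarrow> 'l set set"
  where "Max_set K R I = {P \<in> mSpec R. \<exists>x \<in> I. valuation_at K R P x = inf_val K R I P}"

definition f_tilde :: "'l::field set \<Rightarrow> 'l set \<Rightarrow> 'l set \<Rightarrow> 'l set \<Rightarrow> rtilde"
  where "f_tilde K R I P = RT (real_of_ereal (inf_val K R I P)) (P \<notin> Max_set K R I)"

text \<open>
  Below, \<open>R\<close> is the base ring, \<open>S\<close> its integral closure and \<open>pL\<close> the choice of primes of \<open>S\<close> above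
  the primes of \<open>R\<close>. The value of \<open>F_tilde\<close> at a coset \<open>c = \<sigma> D\<close> is the common value of
  \<open>f_tilde K S I (\<sigma> (pL \<pp>))\<close> over all representatives \<open>\<sigma>\<close> of \<open>c\<close>.
\<close>

definition F_tilde :: "'l::field set \<Rightarrow> 'l set \<Rightarrow> 'l set \<Rightarrow> ('l set \<Rightarrow> 'l set) \<Rightarrow>
    'l set \<Rightarrow> 'l set \<Rightarrow> ('l \<Rightarrow> 'l) set \<Rightarrow> rtilde"
  where "F_tilde R K S pL I =
    (\<lambda>\<pp>\<in>mSpec R. \<lambda>c\<in>topspace (coset_space K (pL \<pp>)).
       the_elem ((\<lambda>\<sigma>. f_tilde K S I (\<sigma> ` pL \<pp>)) ` c))"

definition galois_action :: "'l::field set \<Rightarrow> 'l set \<Rightarrow> ('l set \<Rightarrow> 'l set) \<Rightarrow> ('l \<Rightarrow> 'l) \<Rightarrow>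
    ('l set \<Rightarrow> ('l \<Rightarrow> 'l) set \<Rightarrow> rtilde) \<Rightarrow> 'l set \<Rightarrow> ('l \<Rightarrow> 'l) set \<Rightarrow> rtilde"
  where "galois_action R K pL \<sigma> g =
    (\<lambda>\<pp>\<in>mSpec R. \<lambda>c\<in>topspace (coset_space K (pL \<pp>)).
       g \<pp> (l_coset (Gal K) (inv\<^bsub>Gal K\<^esub> \<sigma>) c))"

end

theory Submission
  imports Defs "Jordan_Normal_Form.Char_Poly"
begin

text \<open>
  Write \<open>S\<close> for the integral closure and \<open>w P\<close> for the valuation at a maximal ideal \<open>P\<close> of \<open>S\<close>.
  The whole proof turns on one equivalence: \<open>f_tilde I P \<le> (\<beta>, 0)\<close> holds if and only if \<open>I\<close> contains
  a non-zero \<open>y\<close> with \<open>w P y \<le> \<beta>\<close> (\<open>f_tilde_le_iff\<close>). The second component of \<open>f_tilde\<close>, which records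
  whether the infimum is attained, is exactly what makes this true, and since a value in \<open>rtilde\<close> is
  determined by the real numbers above it (\<open>rtilde_eqI\<close>), the equivalence characterizes \<open>f_tilde\<close>.

  \<^item> Multiplicativity: the value of a sum of products is at least that of one of the products.

  \<^item> Injectivity: a fractional ideal is the intersection of its localizations, and these are modules
    over valuation rings, hence given by their values (\<open>fi_mem_iff\<close>).

  \<^item> The image lies in the direct sum: \<open>I\<close> contains a non-zero element and has a denominator, and both
    have values bounded by those of some \<open>c\<close> in the base ring; so the function of \<open>I\<close> is bounded and
    vanishes above the primes of the base ring that do not contain \<open>c\<close>, all but finitely many. Semicontinuity
    holds because \<open>f_tilde I (\<sigma> P) < a\<close> means that some \<open>y \<in> I\<close> satisfies a condition on \<open>w P (\<sigma>\<^sup>-\<^sup>1 y)\<close>,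
    and fixing \<open>\<sigma>\<^sup>-\<^sup>1 y\<close> is an open condition on \<open>\<sigma>\<close>. A value group that is not dense is discrete, so that
    infima are attained there.

  \<^item> Surjectivity: for a function \<open>h\<close> in the target, the set of all \<open>x\<close> with \<open>h P \<le> w P x\<close> for all \<open>P\<close>
    is a fractional ideal, and the point is to see that it is large enough. Given \<open>P\<^sub>0\<close> and an \<open>y\<close>
    with \<open>h P\<^sub>0 \<le> w P\<^sub>0 y\<close>, semicontinuity of \<open>h\<close> gives the inequality \<open>h P \<le> w P y\<close> on a neighbourhood
    of \<open>P\<^sub>0\<close>. Compactness of the Galois group provides an element \<open>z\<close> outside \<open>P\<^sub>0\<close> that lies in all the
    primes outside of that neighbourhood above the same prime of the base ring, and a further factor
    from the base ring puts it into the primes above the finitely many other ones where \<open>h\<close> or the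
    value of \<open>y\<close> may be non-zero. The inequality then holds for \<open>y * z ^ M\<close> everywhere when \<open>M\<close> is large, and the value at \<open>P\<^sub>0\<close> has not changed (\<open>exists_element\<close>).

  Passing from functions on maximal ideals to functions on the coset spaces uses that the Galois
  group acts transitively on the primes above a given one (\<open>Gal_transitive\<close>) and transports the
  valuations (\<open>Gal_val\<close>). The descriptions of the regular and of the invertible ideals are then
  computations in \<open>rtilde\<close>: from \<open>u = u + v + u\<close> one gets \<open>v + u + v = \<iota> u\<close>, and \<open>u + v = 0\<close> forces both
  second components to vanish and \<open>v = \<iota> u\<close>.

  The foundations are developed on the way: the local rings of \<open>S\<close> are valuation rings with
  rational value groups (\<open>loc_S_total\<close>, \<open>loc_S_torsion\<close>), which rests on uniformizers of the Dedekind
  base ring (\<open>exists_uniformizer\<close>); homomorphisms of intermediate rings extend to automorphisms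
  (\<open>extend_to_automorphism\<close>), and the Galois group is compact (\<open>compact_krull\<close>).
\<close>

section \<open>Subrings of a field and their maximal ideals\<close>

lemma LL_ops [simp]:
  "carrier (LL :: 'l::field ring) = UNIV" "x \<otimes>\<^bsub>LL\<^esub> y = x * (y :: 'l)" "\<one>\<^bsub>LL\<^esub> = (1 :: 'l)"
  "\<zero>\<^bsub>LL\<^esub> = (0 :: 'l)" "x \<oplus>\<^bsub>LL\<^esub> y = x + (y :: 'l)"
  by (simp_all add: ring_of_type_algebra_def)

lemma LL_uminus [simp]: "\<ominus>\<^bsub>LL\<^esub> x = - (x :: 'l::field)"
proof -
  interpret ring "LL :: 'l ring" by (rule ring_from_type_algebra)
  show ?thesis by (rule minus_equality) auto
qed

locale subring_of_field =
  fixes R :: "'l::field set"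
  assumes one_mem [simp]: "1 \<in> R"
    and diff_mem: "x \<in> R \<Longrightarrow> y \<in> R \<Longrightarrow> x - y \<in> R"
    and mult_mem: "x \<in> R \<Longrightarrow> y \<in> R \<Longrightarrow> x * y \<in> R"
begin

lemma zero_mem [simp]: "0 \<in> R"
  using diff_mem[OF one_mem one_mem] by simp

lemma uminus_mem: "x \<in> R \<Longrightarrow> - x \<in> R"
  using diff_mem[OF zero_mem] by fastforce

lemma add_mem: "x \<in> R \<Longrightarrow> y \<in> R \<Longrightarrow> x + y \<in> R"
  using diff_mem[of x "- y"] uminus_mem by simp

lemma power_mem: "x \<in> R \<Longrightarrow> x ^ n \<in> R"
  by (induction n) (auto intro: mult_mem)

lemma sum_mem: "(\<And>i. i \<in> A \<Longrightarrow> f i \<in> R) \<Longrightarrow> sum f A \<in> R"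
  by (induction A rule: infinite_finite_induct) (auto intro: add_mem)

lemma prod_mem: "(\<And>i. i \<in> A \<Longrightarrow> f i \<in> R) \<Longrightarrow> prod f A \<in> R"
  by (induction A rule: infinite_finite_induct) (auto intro: mult_mem)

lemmas closed = diff_mem mult_mem uminus_mem add_mem power_mem sum_mem prod_mem

lemma subring: "subring R LL"
proof -
  interpret ring "LL :: 'l ring" by (rule ring_from_type_algebra)
  show ?thesis by (rule subringI) (auto intro: closed)
qed

end

lemma subring_of_fieldI: "subring R LL \<Longrightarrow> subring_of_field R"
  using subringE[of R LL]
  by unfold_locales (auto, metis LL_ops(5) LL_uminus add_uminus_conv_diff)

text \<open>
  The ideals of the ring on \<open>R\<close>, with all conditions in terms of the operations of the ambient
  field.
\<close>
definition ideal_of :: "'l::field set \<Rightarrow> 'l set \<Rightarrow> bool"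
  where "ideal_of R J \<longleftrightarrow> J \<subseteq> R \<and> 0 \<in> J \<and> (\<forall>x\<in>J. \<forall>y\<in>J. x + y \<in> J) \<and> (\<forall>r\<in>R. \<forall>x\<in>J. r * x \<in> J)"

lemma ideal_ofD:
  assumes "ideal_of R J"
  shows "J \<subseteq> R" "0 \<in> J" "x \<in> J \<Longrightarrow> y \<in> J \<Longrightarrow> x + y \<in> J" "r \<in> R \<Longrightarrow> x \<in> J \<Longrightarrow> r * x \<in> J"
    "r \<in> R \<Longrightarrow> x \<in> J \<Longrightarrow> x * r \<in> J" "x \<in> J \<Longrightarrow> x \<in> R"
  using assms by (auto simp: ideal_of_def mult.commute)

context subring_of_field
begin

lemma ring_on_ring: "ring (ring_on R)"
proof -
  interpret ring "LL :: 'l ring" by (rule ring_from_type_algebra)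
  show ?thesis by (rule subring_is_ring[OF subring])
qed

lemma ring_on_cring: "cring (ring_on R)"
proof -
  interpret cring "LL :: 'l ring" by (rule cring_from_type_algebra)
  show ?thesis using subring subcring_iff subcringI' by fastforce
qed

lemma ring_on_uminus: "x \<in> R \<Longrightarrow> \<ominus>\<^bsub>ring_on R\<^esub> x = - x"
proof -
  interpret ring "ring_on R" by (rule ring_on_ring)
  show "x \<in> R \<Longrightarrow> \<ominus>\<^bsub>ring_on R\<^esub> x = - x" by (rule minus_equality) (auto intro: closed)
qed

lemma ideal_iff: "ideal J (ring_on R) \<longleftrightarrow> ideal_of R J"
proof
  assume "ideal J (ring_on R)"
  then interpret ideal J "ring_on R" .
  show "ideal_of R J"
    using a_subset additive_subgroup.zero_closed[OF is_additive_subgroup]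
      additive_subgroup.a_closed[OF is_additive_subgroup] I_l_closed
    by (auto simp: ideal_of_def)
next
  assume J: "ideal_of R J"
  interpret ring "ring_on R" by (rule ring_on_ring)
  have neg: "- x \<in> J" if "x \<in> J" for x
    using J that uminus_mem[OF one_mem] by (force simp: ideal_of_def)
  have "subgroup J (add_monoid (ring_on R))"
  proof (rule add.subgroupI)
    show "\<ominus>\<^bsub>ring_on R\<^esub> a \<in> J" if "a \<in> J" for a
      using that J neg ring_on_uminus by (auto simp: ideal_of_def subset_iff)
  qed (use J in \<open>auto simp: ideal_of_def\<close>)
  then show "ideal J (ring_on R)"
    by (rule idealI[OF ring_on_ring]) (use ideal_ofD[OF J] in auto)
qed

lemma mSpec_iff:
  "P \<in> mSpec R \<longleftrightarrow> ideal_of R P \<and> P \<noteq> R \<and> (\<forall>J. ideal_of R J \<longrightarrow> P \<subseteq> J \<longrightarrow> J = P \<or> J = R)"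
proof
  assume "P \<in> mSpec R"
  then interpret maximalideal P "ring_on R" by (simp add: mSpec_def)
  show "ideal_of R P \<and> P \<noteq> R \<and> (\<forall>J. ideal_of R J \<longrightarrow> P \<subseteq> J \<longrightarrow> J = P \<or> J = R)"
    using is_ideal I_notcarr I_maximal by (auto simp: ideal_iff ideal_of_def)
next
  assume *: "ideal_of R P \<and> P \<noteq> R \<and> (\<forall>J. ideal_of R J \<longrightarrow> P \<subseteq> J \<longrightarrow> J = P \<or> J = R)"
  have "maximalideal P (ring_on R)"
    by (rule maximalidealI) (use * in \<open>auto simp: ideal_iff\<close>)
  then show "P \<in> mSpec R" by (simp add: mSpec_def)
qed

lemma primeidealI':
  assumes "ideal_of R P" "1 \<notin> P" "\<And>x y. x \<in> R \<Longrightarrow> y \<in> R \<Longrightarrow> x * y \<in> P \<Longrightarrow> x \<in> P \<or> y \<in> P"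
  shows "primeideal P (ring_on R)"
  by (rule primeidealI) (use assms one_mem ring_on_cring in \<open>auto simp: ideal_iff\<close>)

end

lemma ideal_of_sum: "ideal_of R J \<Longrightarrow> (\<And>i. i \<in> A \<Longrightarrow> f i \<in> J) \<Longrightarrow> sum f A \<in> J"
  by (induction A rule: infinite_finite_induct) (auto simp: ideal_of_def)

context subring_of_field
begin

lemma ideal_of_uminus: "ideal_of R J \<Longrightarrow> x \<in> J \<Longrightarrow> - x \<in> J"
  using ideal_ofD(4)[of R J "- 1" x] uminus_mem[OF one_mem] by auto

lemma ideal_of_diff: "ideal_of R J \<Longrightarrow> x \<in> J \<Longrightarrow> y \<in> J \<Longrightarrow> x - y \<in> J"
  using ideal_ofD(3)[of R J x "- y"] ideal_of_uminus by auto

lemma ideal_of_eq_whole: "ideal_of R J \<Longrightarrow> 1 \<in> J \<Longrightarrow> J = R"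
  using ideal_ofD(1) ideal_ofD(5)[of R J _ 1] by fastforce

text \<open>
  Adding one element to an ideal is how the maximality of an ideal, among all ideals or in a
  family, is used.
\<close>
lemma ideal_of_insert:
  assumes "ideal_of R J" "a \<in> R"
  shows "ideal_of R {x + r * a | x r. x \<in> J \<and> r \<in> R}" (is "ideal_of R ?J")
    and "J \<subseteq> {x + r * a | x r. x \<in> J \<and> r \<in> R}" and "a \<in> {x + r * a | x r. x \<in> J \<and> r \<in> R}"
proof -
  show "J \<subseteq> ?J" by (force intro: exI[of _ 0])
  show "a \<in> ?J" using assms ideal_ofD(2) by (force intro: exI[of _ 1])
  show "ideal_of R ?J"
    unfolding ideal_of_def
  proof (intro conjI ballI)
    show "?J \<subseteq> R" using assms by (auto dest: ideal_ofD(6) intro: closed)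
    show "0 \<in> ?J" using assms ideal_ofD(2) \<open>J \<subseteq> ?J\<close> by blast
  next
    fix u v assume "u \<in> ?J" "v \<in> ?J"
    then obtain x r y s where "u = x + r * a" "v = y + s * a" "x \<in> J" "y \<in> J" "r \<in> R" "s \<in> R"
      by blast
    then have "u + v = (x + y) + (r + s) * a \<and> x + y \<in> J \<and> r + s \<in> R"
      using assms by (auto simp: algebra_simps ideal_of_def intro: closed)
    then show "u + v \<in> ?J" by blast
  next
    fix u v assume "u \<in> R" "v \<in> ?J"
    then obtain y s where "v = y + s * a" "y \<in> J" "s \<in> R" by blast
    then have "u * v = u * y + (u * s) * a \<and> u * y \<in> J \<and> u * s \<in> R"
      using assms \<open>u \<in> R\<close> by (auto simp: algebra_simps ideal_of_def intro: closed)
    then show "u * v \<in> ?J" by blast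
  qed
qed

lemma mSpecD:
  assumes "P \<in> mSpec R"
  shows "ideal_of R P" "1 \<notin> P" "P \<subseteq> R" "0 \<in> P"
  using assms ideal_of_eq_whole by (auto simp: mSpec_iff ideal_of_def)

lemma mSpec_inverse_mod:
  assumes P: "P \<in> mSpec R" and a: "a \<in> R" "a \<notin> P"
  obtains x r where "x \<in> P" "r \<in> R" "x + r * a = 1"
proof -
  note J = ideal_of_insert[OF mSpecD(1)[OF P] a(1)]
  have "{x + r * a | x r. x \<in> P \<and> r \<in> R} = R"
    using J P a unfolding mSpec_iff by blast
  then have "1 \<in> {x + r * a | x r. x \<in> P \<and> r \<in> R}" by simp
  then show thesis using that by fastforce
qed

lemma mSpec_prime:
  assumes P: "P \<in> mSpec R" and "a \<in> R" "b \<in> R" "a * b \<in> P"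
  shows "a \<in> P \<or> b \<in> P"
proof (rule ccontr)
  assume n: "\<not> (a \<in> P \<or> b \<in> P)"
  then obtain x r where *: "x \<in> P" "r \<in> R" "x + r * a = 1"
    using mSpec_inverse_mod P assms by blast
  then have "b = b * x + r * (a * b)" by (metis distrib_left mult.assoc mult.commute mult.right_neutral)
  moreover have "\<dots> \<in> P"
    using assms * mSpecD(1)[OF P] by (auto intro: ideal_ofD(3-4))
  ultimately show False using n by simp
qed

lemma mSpec_prod_notin:
  assumes "P \<in> mSpec R" "\<And>i. i \<in> A \<Longrightarrow> f i \<in> R - P"
  shows "prod f A \<in> R - P"
  using assms(2)
proof (induction A rule: infinite_finite_induct)
  case (insert x F)
  then have "f x \<in> R - P" "prod f F \<in> R - P" by auto
  then show ?case using insert assms(1) mSpec_prime by (auto intro: closed)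
qed (use mSpecD[OF assms(1)] in auto)

lemma mSpec_eqI: "P \<in> mSpec R \<Longrightarrow> Q \<in> mSpec R \<Longrightarrow> P \<subseteq> Q \<Longrightarrow> P = Q"
  unfolding mSpec_iff by blast

text \<open>Krull's theorem, for rings that need not be Noetherian: the integral closure need not be.\<close>
lemma exists_maximal_ideal:
  assumes "ideal_of R J" "1 \<notin> J"
  obtains P where "P \<in> mSpec R" "J \<subseteq> P"
proof -
  define A where "A = {I. ideal_of R I \<and> J \<subseteq> I \<and> 1 \<notin> I}"
  have "\<exists>M\<in>A. \<forall>I\<in>A. M \<subseteq> I \<longrightarrow> I = M"
  proof (rule subset_Zorn_nonempty)
    show "A \<noteq> {}" using assms by (auto simp: A_def)
    fix C assume C: "C \<noteq> {}" "subset.chain A C"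
    have CA: "C \<subseteq> A" and lin: "\<And>I I'. I \<in> C \<Longrightarrow> I' \<in> C \<Longrightarrow> I \<subseteq> I' \<or> I' \<subseteq> I"
      using C(2) by (auto simp: subset_chain_def)
    have "ideal_of R (\<Union>C)"
      unfolding ideal_of_def
    proof (intro conjI ballI)
      show "\<Union>C \<subseteq> R" "0 \<in> \<Union>C" using CA C(1) by (auto simp: A_def ideal_of_def)
      show "x + y \<in> \<Union>C" if xy: "x \<in> \<Union>C" "y \<in> \<Union>C" for x y
      proof -
        obtain U V where XY: "U \<in> C" "V \<in> C" "x \<in> U" "y \<in> V" using xy by blast
        then have "ideal_of R (U \<union> V) \<and> U \<union> V \<in> C"
          using lin[of U V] CA by (auto simp: A_def Un_absorb1 Un_absorb2)
        then show ?thesis using XY ideal_ofD(3)[of R "U \<union> V" x y] by blast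
      qed
      show "r * x \<in> \<Union>C" if "r \<in> R" "x \<in> \<Union>C" for r x
        using that CA by (fastforce simp: A_def ideal_of_def)
    qed
    then show "\<Union>C \<in> A" using CA C(1) by (auto simp: A_def)
  qed
  then obtain M where M: "M \<in> A" "\<And>I. I \<in> A \<Longrightarrow> M \<subseteq> I \<Longrightarrow> I = M" by blast
  have "M \<in> mSpec R"
    unfolding mSpec_iff
  proof (intro conjI allI impI)
    show "ideal_of R M" "M \<noteq> R" using M(1) by (auto simp: A_def)
    fix I assume I: "ideal_of R I" "M \<subseteq> I"
    show "I = M \<or> I = R"
    proof (cases "1 \<in> I")
      case True
      then show ?thesis using ideal_of_eq_whole I by blast
    next
      case False
      then have "I \<in> A" using I M(1) by (auto simp: A_def)
      then show ?thesis using M(2) I by blast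
    qed
  qed
  then show thesis using that M(1) by (auto simp: A_def)
qed

text \<open>
  As a subset of the ambient field, so that rings and their localizations can be compared by
  inclusion.
\<close>
definition loc :: "'l set \<Rightarrow> 'l set"
  where "loc P = {a / s | a s. a \<in> R \<and> s \<in> R - P}"

lemma locI: "a \<in> R \<Longrightarrow> s \<in> R \<Longrightarrow> s \<notin> P \<Longrightarrow> a / s \<in> loc P"
  by (auto simp: loc_def)

lemma locE:
  assumes "x \<in> loc P" "P \<in> mSpec R"
  obtains a s where "a \<in> R" "s \<in> R" "s \<notin> P" "s \<noteq> 0" "x = a / s"
  using assms mSpecD(4)[OF assms(2)] unfolding loc_def by force

lemma mem_loc_iff:
  assumes P: "P \<in> mSpec R"
  shows "x \<in> loc P \<longleftrightarrow> (\<exists>s\<in>R - P. s * x \<in> R)"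
proof
  assume "x \<in> loc P"
  then obtain a s where "a \<in> R" "s \<in> R" "s \<notin> P" "s \<noteq> 0" "x = a / s" using P by (elim locE)
  then show "\<exists>s\<in>R - P. s * x \<in> R" by (intro bexI[of _ s]) auto
next
  assume "\<exists>s\<in>R - P. s * x \<in> R"
  then obtain s where s: "s \<in> R - P" "s * x \<in> R" by blast
  then have "x = (s * x) / s" using mSpecD(4)[OF P] by auto
  then show "x \<in> loc P" using s locI by (metis DiffE)
qed

lemma loc_subring:
  assumes P: "P \<in> mSpec R"
  shows "subring_of_field (loc P)" and "R \<subseteq> loc P"
proof -
  show sub: "R \<subseteq> loc P"
    using locI[OF _ one_mem mSpecD(2)[OF P]] by (metis div_by_1 subsetI)
  have *: "x - y \<in> loc P \<and> x * y \<in> loc P" if xy: "x \<in> loc P" "y \<in> loc P" for x y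
  proof -
    obtain s t where st: "s \<in> R - P" "s * x \<in> R" "t \<in> R - P" "t * y \<in> R"
      using xy(1)[unfolded mem_loc_iff[OF P]] xy(2)[unfolded mem_loc_iff[OF P]] by blast
    then have "s * t \<in> R - P" using mSpec_prime[OF P] by (auto intro: closed)
    moreover have "s * t * (x - y) = t * (s * x) - s * (t * y)"
      "s * t * (x * y) = (s * x) * (t * y)" by (simp_all add: algebra_simps)
    moreover have "t * (s * x) - s * (t * y) \<in> R" "(s * x) * (t * y) \<in> R"
      using st by (auto intro: closed)
    ultimately show ?thesis unfolding mem_loc_iff[OF P] by (metis (no_types))
  qed
  show "subring_of_field (loc P)"
  proof
    show "1 \<in> loc P" using sub one_mem by blast
  qed (use * in blast)+
qed

lemma loc_inverse:
  assumes P: "P \<in> mSpec R" and a: "a \<in> R" "a \<notin> P"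
  shows "1 / a \<in> loc P"
  using locI[OF one_mem a] .

lemma loc_nonunit:
  assumes P: "P \<in> mSpec R" and a: "a \<in> P" "a \<noteq> 0"
  shows "1 / a \<notin> loc P"
proof
  assume "1 / a \<in> loc P"
  then obtain s where "s \<in> R - P" "s / a \<in> R" unfolding mem_loc_iff[OF P] by auto
  then show False using ideal_ofD(5)[OF mSpecD(1)[OF P], of "s / a" a] a by simp
qed

text \<open>
  Non-units of the localization are recognized by the failure of \<open>1 / x \<in> loc P\<close> throughout, so
  that locality can be expressed without mentioning the maximal ideal.
\<close>
lemma loc_nonunit_iff:
  assumes P: "P \<in> mSpec R" and x: "x \<in> loc P" "x \<noteq> 0"
  shows "1 / x \<notin> loc P \<longleftrightarrow> (\<exists>a\<in>P. \<exists>s\<in>R - P. x = a / s)"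
proof -
  obtain a s where as: "a \<in> R" "s \<in> R" "s \<notin> P" "s \<noteq> 0" "x = a / s"
    using locE[OF x(1) P] .
  show ?thesis
  proof
    assume "1 / x \<notin> loc P"
    then have "a \<in> P" using as locI[of s a P] by auto
    then show "\<exists>a\<in>P. \<exists>s\<in>R - P. x = a / s" using as by blast
  next
    assume "\<exists>a\<in>P. \<exists>s\<in>R - P. x = a / s"
    then obtain b t where bt: "b \<in> P" "t \<in> R - P" "x = b / t" by blast
    show "1 / x \<notin> loc P"
    proof
      assume "1 / x \<in> loc P"
      then have "t / b \<in> loc P" using bt by simp
      moreover have "1 / t \<in> loc P" using bt loc_inverse[OF P] by auto
      ultimately have "t / b * (1 / t) \<in> loc P"
        using subring_of_field.mult_mem[OF loc_subring(1)[OF P]] by blast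
      then show False using loc_nonunit[OF P bt(1)] bt x mSpecD(4)[OF P] by auto
    qed
  qed
qed

lemma loc_local:
  assumes P: "P \<in> mSpec R" and x: "x \<in> loc P" "x = 0 \<or> 1 / x \<notin> loc P"
    and y: "y \<in> loc P" "y = 0 \<or> 1 / y \<notin> loc P"
  shows "x + y = 0 \<or> 1 / (x + y) \<notin> loc P"
proof (rule disjCI)
  assume "\<not> (1 / (x + y) \<notin> loc P)"
  then have u: "1 / (x + y) \<in> loc P" by simp
  have ex: "\<exists>a\<in>P. \<exists>s\<in>R - P. z = a / s" if "z \<in> loc P" "z = 0 \<or> 1 / z \<notin> loc P" for z
  proof (cases "z = 0")
    case True
    then show ?thesis using mSpecD[OF P] one_mem by (intro bexI[of _ 0] bexI[of _ 1]) auto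
  qed (use loc_nonunit_iff[OF P] that in auto)
  obtain a s b t where as: "a \<in> P" "s \<in> R - P" "x = a / s" and bt: "b \<in> P" "t \<in> R - P" "y = b / t"
    using ex[OF x] ex[OF y] by blast
  have nz: "s \<noteq> 0" "t \<noteq> 0" using as bt mSpecD(4)[OF P] by auto
  then have "x + y = (a * t + b * s) / (s * t)" using as bt by (simp add: field_simps)
  moreover have "a * t + b * s \<in> P"
    using as bt mSpecD(1)[OF P] by (intro ideal_ofD(3) ideal_ofD(5)) auto
  moreover have "s * t \<in> R - P" using as bt mSpec_prime[OF P] by (auto intro: closed)
  moreover have "x + y \<in> loc P"
    using x y by (intro subring_of_field.add_mem[OF loc_subring(1)[OF P]])
  ultimately show "x + y = 0" using loc_nonunit_iff[OF P, of "x + y"] u by blast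
qed

end

lemma noetherian_maximal_ideal:
  assumes R: "subring_of_field R" and N: "noetherian_ring (ring_on R)"
    and A: "A \<noteq> {}" "\<And>J. J \<in> A \<Longrightarrow> ideal_of R J"
  obtains M where "M \<in> A" "\<And>J. J \<in> A \<Longrightarrow> M \<subseteq> J \<Longrightarrow> J = M"
proof -
  interpret noetherian_ring "ring_on R" by fact
  have "\<exists>M\<in>A. \<forall>I\<in>A. M \<subseteq> I \<longrightarrow> I = M"
  proof (rule subset_Zorn_nonempty[OF A(1)])
    fix C assume C: "C \<noteq> {}" "subset.chain A C"
    then have "subset.chain {I. ideal I (ring_on R)} C"
      using A(2) subring_of_field.ideal_iff[OF R] by (auto simp: subset_chain_def)
    then have "\<Union>C \<in> C" using ideal_chain_is_trivial C(1) by blast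
    then show "\<Union>C \<in> A" using C(2) by (auto simp: subset_chain_def)
  qed
  then show thesis using that by blast
qed

section \<open>Integral closure\<close>

context subring_of_field
begin

lemma polys_over_add: "p \<in> polys_over R \<Longrightarrow> q \<in> polys_over R \<Longrightarrow> p + q \<in> polys_over R"
  by (auto simp: polys_over_def intro: closed)

lemma polys_over_uminus: "p \<in> polys_over R \<Longrightarrow> - p \<in> polys_over R"
  by (auto simp: polys_over_def intro: closed)

lemma polys_over_mult: "p \<in> polys_over R \<Longrightarrow> q \<in> polys_over R \<Longrightarrow> p * q \<in> polys_over R"
  by (auto simp: polys_over_def coeff_mult intro!: sum_mem mult_mem)

lemma polys_over_const: "c \<in> R \<Longrightarrow> [:c:] \<in> polys_over R"
  by (auto simp: polys_over_def coeff_pCons split: nat.split)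

lemma polys_over_pCons: "c \<in> R \<Longrightarrow> p \<in> polys_over R \<Longrightarrow> pCons c p \<in> polys_over R"
  by (auto simp: polys_over_def coeff_pCons split: nat.split)

lemma polys_over_monom: "c \<in> R \<Longrightarrow> Polynomial.monom c n \<in> polys_over R"
  by (auto simp: polys_over_def)

lemma polys_over_subring:
  "0 \<in> polys_over R" "1 \<in> polys_over R" "[:0, 1:] \<in> polys_over R"
  by (auto simp: polys_over_def coeff_pCons split: nat.split)

lemma polys_over_sum: "(\<And>i. i \<in> A \<Longrightarrow> f i \<in> polys_over R) \<Longrightarrow> sum f A \<in> polys_over R"
  by (induction A rule: infinite_finite_induct) (auto intro: polys_over_add polys_over_subring)

lemma polys_over_prod: "(\<And>i. i \<in> A \<Longrightarrow> f i \<in> polys_over R) \<Longrightarrow> prod f A \<in> polys_over R"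
  by (induction A rule: infinite_finite_induct) (auto intro: polys_over_mult polys_over_subring)

text \<open>
  For the determinant trick: the characteristic polynomial of a matrix over \<open>R\<close> has coefficients
  in \<open>R\<close>.
\<close>
lemma det_polys_over:
  assumes A: "A \<in> carrier_mat n n" and *: "\<And>i j. i < n \<Longrightarrow> j < n \<Longrightarrow> A $$ (i, j) \<in> polys_over R"
  shows "Determinant.det A \<in> polys_over R"
  unfolding det_def'[OF A]
proof (intro polys_over_sum polys_over_mult polys_over_prod)
  fix p assume "p \<in> {p. p permutes {0..<n}}"
  then have p: "p permutes {0..<n}" by simp
  show "signof p \<in> polys_over R"
    by (auto simp: sign_def polys_over_subring polys_over_uminus)
  show "A $$ (i, p i) \<in> polys_over R" if "i \<in> {0..<n}" for i
    using that p permutes_in_image[OF p, of i] by (intro *) auto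
qed

lemma integralI:
  assumes "n > 0" "\<And>i. i < n \<Longrightarrow> c i \<in> R" "z ^ n = (\<Sum>i<n. c i * z ^ i)"
  shows "integral_over R z"
proof -
  define q where "q = (\<Sum>i<n. Polynomial.monom (c i) i)"
  define p where "p = Polynomial.monom 1 n - q"
  have cq: "Polynomial.coeff q k = (if k < n then c k else 0)" for k
    by (simp add: q_def coeff_sum if_distrib cong: if_cong)
  have "p \<in> polys_over R"
    using assms(2) by (auto simp: polys_over_def p_def cq intro: closed)
  moreover have "Polynomial.degree p \<le> n"
    by (intro degree_le) (auto simp: p_def cq)
  moreover have "Polynomial.coeff p n = 1" by (simp add: p_def cq)
  ultimately have "Polynomial.lead_coeff p = 1"
    by (metis coeff_eq_0 le_neq_implies_less zero_neq_one)
  moreover have "Polynomial.poly p z = 0"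
    using assms(3) by (simp add: p_def q_def poly_sum poly_monom)
  ultimately show ?thesis using \<open>p \<in> polys_over R\<close> by (auto simp: integral_over_def)
qed

end

lemma poly_lead_split:
  "Polynomial.poly p z = (\<Sum>i<Polynomial.degree p. Polynomial.coeff p i * z ^ i)
     + Polynomial.lead_coeff p * z ^ Polynomial.degree p"
  for z :: "'a::comm_semiring_1"
  by (simp add: poly_altdef lessThan_Suc_atMost[symmetric])

context subring_of_field
begin

lemma integralE:
  assumes "integral_over R z"
  obtains n c where "n > 0" "\<And>i. i < n \<Longrightarrow> c i \<in> R" "z ^ n = (\<Sum>i<n. c i * z ^ i)"
proof -
  obtain p where p: "p \<in> polys_over R" "Polynomial.lead_coeff p = 1" "Polynomial.poly p z = 0"
    using assms by (auto simp: integral_over_def)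
  let ?n = "Polynomial.degree p"
  have "?n \<noteq> 0"
  proof
    assume "?n = 0"
    then have "p = 1" using p(2) by (metis degree_eq_zeroE lead_coeff_pCons(2) one_pCons)
    then show False using p(3) by simp
  qed
  moreover have eq: "z ^ ?n = (\<Sum>i<?n. - Polynomial.coeff p i * z ^ i)"
    using p(2,3) unfolding poly_lead_split by (simp add: sum_negf eq_neg_iff_add_eq_0 add.commute)
  moreover have "- Polynomial.coeff p i \<in> R" for i
    using p(1) by (auto simp: polys_over_def intro: closed)
  ultimately show thesis by (intro that[of ?n "\<lambda>i. - Polynomial.coeff p i"]) auto
qed

lemma integral_mem: "x \<in> R \<Longrightarrow> integral_over R x"
  by (rule integralI[of 1 "\<lambda>_. x"]) auto

text \<open>
  Multiplying the equation for \<open>x\<close> by the power \<open>n - 1\<close> of its leading coefficient \<open>a\<close> turns it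
  into a monic equation for \<open>a * x\<close>.
\<close>
lemma lead_coeff_times_root_integral:
  assumes p: "p \<in> polys_over R" "Polynomial.degree p > 0" "Polynomial.poly p x = 0"
  shows "integral_over R (Polynomial.lead_coeff p * x)"
proof -
  define n where "n = Polynomial.degree p"
  define a where "a = Polynomial.coeff p"
  have n: "n > 0" using p by (simp add: n_def)
  have aR: "a i \<in> R" for i using p by (simp add: a_def polys_over_def)
  have x: "a n * x ^ n = - (\<Sum>i<n. a i * x ^ i)"
    using p(3) unfolding poly_lead_split n_def a_def by (metis eq_neg_iff_add_eq_0 add.commute)
  have "integral_over R (a n * x)"
  proof (rule integralI[of n "\<lambda>i. - (a i * a n ^ (n - 1 - i))"])
    have "(a n * x) ^ n = a n ^ (n - 1) * (a n * x ^ n)"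
      using n by (cases n) (simp_all add: power_mult_distrib mult_ac)
    also have "\<dots> = (\<Sum>i<n. - (a i * a n ^ (n - 1)) * x ^ i)"
      by (simp add: x sum_distrib_left sum_negf[symmetric] mult_ac)
    also have "\<dots> = (\<Sum>i<n. - (a i * a n ^ (n - 1 - i)) * (a n * x) ^ i)"
    proof (rule sum.cong)
      fix i assume "i \<in> {..<n}"
      then have "n - 1 = (n - 1 - i) + i" by simp
      then have "a n ^ (n - 1) = a n ^ (n - 1 - i) * a n ^ i" by (metis power_add)
      then show "- (a i * a n ^ (n - 1)) * x ^ i = - (a i * a n ^ (n - 1 - i)) * (a n * x) ^ i"
        by (simp add: power_mult_distrib)
    qed simp
    finally show "(a n * x) ^ n = (\<Sum>i<n. - (a i * a n ^ (n - 1 - i)) * (a n * x) ^ i)" .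
  qed (use n aR in \<open>auto intro: closed\<close>)
  then show ?thesis by (simp add: n_def a_def)
qed

definition lin_span :: "'l set \<Rightarrow> 'l set"
  where "lin_span S = {\<Sum>s\<in>S. c s * s | c. \<forall>s\<in>S. c s \<in> R}"

lemma lin_span_add: "u \<in> lin_span S \<Longrightarrow> v \<in> lin_span S \<Longrightarrow> u + v \<in> lin_span S"
proof -
  assume "u \<in> lin_span S" "v \<in> lin_span S"
  then obtain c d where "u = (\<Sum>s\<in>S. c s * s)" "v = (\<Sum>s\<in>S. d s * s)" "\<forall>s\<in>S. c s \<in> R" "\<forall>s\<in>S. d s \<in> R"
    by (auto simp: lin_span_def)
  then show "u + v \<in> lin_span S"
    by (auto simp: lin_span_def sum.distrib[symmetric] distrib_right[symmetric]
        intro!: exI[of _ "\<lambda>s. c s + d s"] closed)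
qed

lemma lin_span_scale: "r \<in> R \<Longrightarrow> u \<in> lin_span S \<Longrightarrow> r * u \<in> lin_span S"
proof -
  assume r: "r \<in> R" and "u \<in> lin_span S"
  then obtain c where "u = (\<Sum>s\<in>S. c s * s)" "\<forall>s\<in>S. c s \<in> R"
    by (auto simp: lin_span_def)
  then show "r * u \<in> lin_span S"
    using r by (auto simp: lin_span_def sum_distrib_left mult.assoc[symmetric]
        intro!: exI[of _ "\<lambda>s. r * c s"] closed)
qed

lemma lin_span_zero: "0 \<in> lin_span S"
  by (auto simp: lin_span_def intro!: exI[of _ "\<lambda>_. 0"])

lemma lin_span_sum: "(\<And>i. i \<in> A \<Longrightarrow> f i \<in> lin_span S) \<Longrightarrow> sum f A \<in> lin_span S"
  by (induction A rule: infinite_finite_induct) (auto intro: lin_span_add lin_span_zero)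

lemma lin_span_base:
  assumes "finite S" "s \<in> S"
  shows "s \<in> lin_span S"
proof -
  have "(\<Sum>t\<in>S. (if t = s then 1 else 0) * t) = (\<Sum>t\<in>S. if t = s then s else 0)"
    by (intro sum.cong) auto
  then have "s = (\<Sum>t\<in>S. (if t = s then 1 else 0) * t)"
    using assms by simp
  then show ?thesis unfolding lin_span_def by force
qed

text \<open>
  The ring of all \<open>z\<close> that map the module spanned by \<open>S\<close> into itself. Integral elements are those
  that are multipliers of a finitely generated module containing \<open>1\<close>, and in this form it is clear
  that they form a ring.
\<close>
definition multipliers :: "'l set \<Rightarrow> 'l set"
  where "multipliers S = {z. \<forall>s\<in>S. z * s \<in> lin_span S}"

lemma multipliers_span:
  assumes "z \<in> multipliers S" "u \<in> lin_span S"
  shows "z * u \<in> lin_span S"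
proof -
  obtain c where c: "u = (\<Sum>s\<in>S. c s * s)" "\<forall>s\<in>S. c s \<in> R"
    using assms by (auto simp: lin_span_def)
  then have "z * u = (\<Sum>s\<in>S. c s * (z * s))" by (simp add: sum_distrib_left mult_ac)
  also have "\<dots> \<in> lin_span S"
    using assms c by (auto simp: multipliers_def intro!: lin_span_sum intro: lin_span_scale)
  finally show ?thesis .
qed

lemma multipliers_base: "finite S \<Longrightarrow> R \<subseteq> multipliers S"
  by (auto simp: multipliers_def intro: lin_span_scale lin_span_base)

lemma multipliers_subring: "finite S \<Longrightarrow> subring_of_field (multipliers S)"
proof
  assume fin: "finite S"
  show "1 \<in> multipliers S" using multipliers_base[OF fin] by auto
  fix x y assume xy: "x \<in> multipliers S" "y \<in> multipliers S"
  show "x * y \<in> multipliers S"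
    using xy multipliers_span[OF xy(1)] by (auto simp: multipliers_def mult.assoc)
  show "x - y \<in> multipliers S"
  proof -
    have "x * s + (- 1) * (y * s) \<in> lin_span S" if "s \<in> S" for s
      using xy that uminus_mem[OF one_mem]
      by (intro lin_span_add lin_span_scale[of "- 1"]) (auto simp: multipliers_def)
    then show ?thesis by (auto simp: multipliers_def algebra_simps)
  qed
qed

text \<open>
  The determinant trick: \<open>z\<close> is an eigenvalue of the matrix over \<open>R\<close> that describes multiplication
  by \<open>z\<close> on the generators, with the generators as eigenvector, and the characteristic polynomial
  is monic.
\<close>
lemma multiplier_integral:
  assumes S: "finite S" "1 \<in> S" and z: "z \<in> multipliers S"
  shows "integral_over R z"
proof -
  define n where "n = card S"
  obtain h where h: "bij_betw h {0..<n} S"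
    using ex_bij_betw_nat_finite[OF S(1)] by (auto simp: n_def)
  have "\<exists>c. (\<forall>t\<in>S. c t \<in> R) \<and> z * s = (\<Sum>t\<in>S. c t * t)" if "s \<in> S" for s
    using z that by (fastforce simp: multipliers_def lin_span_def)
  then obtain c where c: "\<And>s t. s \<in> S \<Longrightarrow> t \<in> S \<Longrightarrow> c s t \<in> R"
    "\<And>s. s \<in> S \<Longrightarrow> z * s = (\<Sum>t\<in>S. c s t * t)"
    by metis
  have hS: "h i \<in> S" if "i < n" for i using h that by (auto simp: bij_betw_def)
  define A where "A = Matrix.mat n n (\<lambda>(i, j). c (h i) (h j))"
  define v where "v = Matrix.vec n h"
  have A: "A \<in> carrier_mat n n" by (simp add: A_def)
  have "A *\<^sub>v v = z \<cdot>\<^sub>v v"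
  proof (rule eq_vecI)
    fix i assume "i < dim_vec (z \<cdot>\<^sub>v v)"
    then have i: "i < n" by (simp add: v_def)
    have "vec_index (A *\<^sub>v v) i = (\<Sum>j = 0..<n. c (h i) (h j) * h j)"
      using i by (simp add: A_def v_def scalar_prod_def)
    also have "\<dots> = (\<Sum>t\<in>S. c (h i) t * t)"
      using sum.reindex_bij_betw[OF h, of "\<lambda>t. c (h i) t * t"] by simp
    also have "\<dots> = z * h i" using c(2) hS[OF i] by simp
    finally show "vec_index (A *\<^sub>v v) i = vec_index (z \<cdot>\<^sub>v v) i" using i by (simp add: v_def)
  qed (simp add: A_def v_def)
  moreover have "v \<noteq> 0\<^sub>v n"
  proof
    assume "v = 0\<^sub>v n"
    then have "h i = 0" if "i < n" for i using that by (metis index_vec index_zero_vec(1) v_def)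
    moreover obtain i where "i < n" "h i = 1" using h S(2) by (force simp: bij_betw_def)
    ultimately show False by simp
  qed
  ultimately have "eigenvalue A z"
    unfolding eigenvalue_def eigenvector_def by (intro exI[of _ v]) (simp add: A_def v_def)
  then have root: "Polynomial.poly (char_poly A) z = 0"
    using eigenvalue_root_char_poly[OF A] by simp
  have "char_poly A \<in> polys_over R"
    unfolding char_poly_def
  proof (rule det_polys_over)
    show "char_poly_matrix A \<in> carrier_mat n n" using A by simp
    fix i j assume "i < n" "j < n"
    then show "char_poly_matrix A $$ (i, j) \<in> polys_over R"
      using c(1)[OF hS hS, of i j] A
      by (auto simp: char_poly_matrix_def A_def
          intro!: polys_over_add polys_over_mult polys_over_pCons polys_over_subring closed)
  qed
  moreover have "Polynomial.lead_coeff (char_poly A) = 1"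
    using degree_monic_char_poly[OF A] by simp
  ultimately show ?thesis using root by (auto simp: integral_over_def)
qed

lemma lin_span_times:
  assumes "finite S" "finite T" "u \<in> lin_span S" "t \<in> T"
  shows "u * t \<in> lin_span ((\<lambda>(s, t). s * t) ` (S \<times> T))"
proof -
  obtain c where c: "u = (\<Sum>s\<in>S. c s * s)" "\<forall>s\<in>S. c s \<in> R"
    using assms by (auto simp: lin_span_def)
  then have "u * t = (\<Sum>s\<in>S. c s * (s * t))" by (simp add: sum_distrib_right mult.assoc)
  also have "\<dots> \<in> lin_span ((\<lambda>(s, t). s * t) ` (S \<times> T))"
    using assms c by (intro lin_span_sum lin_span_scale lin_span_base) auto
  finally show ?thesis .
qed

lemma multipliers_product:
  assumes "finite S" "finite T"
  shows "multipliers S \<subseteq> multipliers ((\<lambda>(s, t). s * t) ` (S \<times> T))"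
    and "multipliers T \<subseteq> multipliers ((\<lambda>(s, t). s * t) ` (S \<times> T))"
proof -
  have *: "multipliers S \<subseteq> multipliers ((\<lambda>(s, t). s * t) ` (S \<times> T))"
    if "finite S" "finite T" for S T
    using lin_span_times[OF that] by (force simp: multipliers_def mult.assoc[symmetric])
  show "multipliers S \<subseteq> multipliers ((\<lambda>(s, t). s * t) ` (S \<times> T))" using * assms by blast
  have "(\<lambda>(s, t). s * t) ` (S \<times> T) = (\<lambda>(s, t). s * t) ` (T \<times> S)"
    by (auto simp: image_iff) (metis mult.commute)+
  then show "multipliers T \<subseteq> multipliers ((\<lambda>(s, t). s * t) ` (S \<times> T))" using *[of T S] assms by simp
qed

text \<open>
  An integral equation for \<open>z\<close> over the multipliers of \<open>S\<close> makes the products \<open>s * z ^ i\<close> with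
  \<open>i < n\<close> generators of a module that is stable under \<open>z\<close>. This covers both equations over \<open>R\<close>
  and, for the transitivity of integral closure, equations over the integral closure.
\<close>
lemma multipliers_adjoin:
  assumes S: "finite S" "1 \<in> S" and n: "n > 0" and c: "\<And>i. i < n \<Longrightarrow> c i \<in> multipliers S"
    and z: "z ^ n = (\<Sum>i<n. c i * z ^ i)"
  obtains T where "finite T" "1 \<in> T" "multipliers S \<subseteq> multipliers T" "z \<in> multipliers T"
proof -
  define Z where "Z = (\<lambda>i. z ^ i) ` {..<n}"
  define T where "T = (\<lambda>(s, t). s * t) ` (S \<times> Z)"
  have Z: "finite Z" "1 \<in> Z" using n by (auto simp: Z_def image_iff intro!: bexI[of _ 0])
  have T: "finite T" "1 \<in> T" using S Z by (auto simp: T_def image_iff intro!: bexI[of _ 1])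
  have "z * (s * z ^ i) \<in> lin_span T" if "s \<in> S" "i < n" for s i
  proof (cases "Suc i < n")
    case True
    then have "s * z ^ Suc i \<in> T" using that by (force simp: T_def Z_def)
    then show ?thesis using lin_span_base[OF T(1)] by (simp add: mult_ac)
  next
    case False
    then have "Suc i = n" using that by simp
    then have "z * (s * z ^ i) = s * z ^ n" by (auto simp: mult_ac)
    also have "\<dots> = (\<Sum>i<n. (c i * s) * z ^ i)" by (simp add: z sum_distrib_left mult_ac)
    also have "\<dots> \<in> lin_span T"
      unfolding T_def
      using c that by (intro lin_span_sum lin_span_times S Z) (auto simp: multipliers_def Z_def)
    finally show ?thesis .
  qed
  then have "z \<in> multipliers T" by (auto simp: multipliers_def T_def Z_def)
  moreover have "multipliers S \<subseteq> multipliers T"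
    unfolding T_def by (rule multipliers_product[OF S(1) Z(1)])
  ultimately show thesis using that T by blast
qed

lemma integral_multipliers:
  assumes "finite A" "\<And>a. a \<in> A \<Longrightarrow> integral_over R a"
  obtains S where "finite S" "1 \<in> S" "A \<subseteq> multipliers S"
proof -
  have "\<exists>S. finite S \<and> 1 \<in> S \<and> A \<subseteq> multipliers S"
    using assms
  proof (induction A rule: finite_induct)
    case empty
    then show ?case by (intro exI[of _ "{1}"]) auto
  next
    case (insert a A)
    then obtain S where S: "finite S" "1 \<in> S" "A \<subseteq> multipliers S" by auto
    obtain n c where nc: "n > 0" "\<And>i. i < n \<Longrightarrow> c i \<in> R" "a ^ n = (\<Sum>i<n. c i * a ^ i)"
      using integralE insert.prems by (metis insertI1)
    obtain T where "finite T" "1 \<in> T" "multipliers S \<subseteq> multipliers T" "a \<in> multipliers T"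
      using multipliers_adjoin[OF S(1,2) nc(1) _ nc(3)] nc(2) multipliers_base[OF S(1)] by blast
    then show ?case using S by (intro exI[of _ T]) auto
  qed
  then show thesis using that by blast
qed

lemma integral_closure_subring: "subring_of_field (integral_closure R)"
proof
  show "1 \<in> integral_closure R" by (simp add: integral_closure_def integral_mem)
  fix x y assume xy: "x \<in> integral_closure R" "y \<in> integral_closure R"
  obtain S where S: "finite S" "1 \<in> S" "{x, y} \<subseteq> multipliers S"
    using integral_multipliers[of "{x, y}"] xy by (auto simp: integral_closure_def)
  interpret M: subring_of_field "multipliers S" by (rule multipliers_subring[OF S(1)])
  show "x - y \<in> integral_closure R" "x * y \<in> integral_closure R"
    using multiplier_integral[OF S(1,2)] S(3) by (auto simp: integral_closure_def intro: M.closed)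
qed

lemma integral_closure_base: "R \<subseteq> integral_closure R"
  by (auto simp: integral_closure_def integral_mem)

lemma integral_closure_closed:
  assumes "integral_over (integral_closure R) z"
  shows "z \<in> integral_closure R"
proof -
  interpret C: subring_of_field "integral_closure R" by (rule integral_closure_subring)
  obtain n c where nc: "n > 0" "\<And>i. i < n \<Longrightarrow> c i \<in> integral_closure R" "z ^ n = (\<Sum>i<n. c i * z ^ i)"
    using C.integralE[OF assms] by blast
  obtain S where S: "finite S" "1 \<in> S" "c ` {..<n} \<subseteq> multipliers S"
    using integral_multipliers[of "c ` {..<n}"] nc(2) by (auto simp: integral_closure_def)
  have "c i \<in> multipliers S" if "i < n" for i using S(3) that by auto
  then obtain T where "finite T" "1 \<in> T" "z \<in> multipliers T"
    using multipliers_adjoin[OF S(1,2) nc(1) _ nc(3)] by (metis (no_types))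
  then show ?thesis using multiplier_integral by (auto simp: integral_closure_def)
qed

lemma loc_common_denominator:
  assumes P: "P \<in> mSpec R" and "finite A" "\<And>i. i \<in> A \<Longrightarrow> f i \<in> loc P"
  obtains s where "s \<in> R - P" "\<And>i. i \<in> A \<Longrightarrow> s * f i \<in> R"
proof -
  have "\<forall>i\<in>A. \<exists>s\<in>R - P. s * f i \<in> R" using assms(3) unfolding mem_loc_iff[OF P] by blast
  then obtain s where s: "\<And>i. i \<in> A \<Longrightarrow> s i \<in> R - P" "\<And>i. i \<in> A \<Longrightarrow> s i * f i \<in> R" by metis
  have "prod s A * f i \<in> R" if "i \<in> A" for i
  proof -
    have "prod s A * f i = (s i * f i) * prod s (A - {i})"
      using that assms(2) by (simp add: prod.remove mult_ac)
    also have "\<dots> \<in> R" using s that by (intro mult_mem[OF _ prod_mem]) auto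
    finally show ?thesis .
  qed
  then show thesis using that[of "prod s A"] mSpec_prod_notin[OF P, of A s] s by blast
qed

text \<open>
  Clearing denominators in an equation over the localization; hence integral closedness passes to
  localizations.
\<close>
lemma integral_over_loc:
  assumes P: "P \<in> mSpec R" and z: "integral_over (loc P) z"
  obtains s where "s \<in> R - P" "integral_over R (s * z)"
proof -
  interpret A: subring_of_field "loc P" by (rule loc_subring[OF P])
  obtain n c where nc: "n > 0" "\<And>i. i < n \<Longrightarrow> c i \<in> loc P" "z ^ n = (\<Sum>i<n. c i * z ^ i)"
    using A.integralE[OF z] by blast
  obtain s where s: "s \<in> R - P" "\<And>i. i \<in> {..<n} \<Longrightarrow> s * c i \<in> R"
    using loc_common_denominator[OF P, of "{..<n}" c] nc(2) by auto
  have "integral_over R (s * z)"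
  proof (rule integralI[OF nc(1), of "\<lambda>i. (s * c i) * s ^ (n - Suc i)"])
    show "s * c i * s ^ (n - Suc i) \<in> R" if "i < n" for i
      using s that by (auto intro: closed)
    have "(s * z) ^ n = (\<Sum>i<n. s ^ n * (c i * z ^ i))"
      by (simp add: power_mult_distrib nc(3) sum_distrib_left)
    also have "\<dots> = (\<Sum>i<n. s * c i * s ^ (n - Suc i) * (s * z) ^ i)"
    proof (rule sum.cong)
      fix i assume "i \<in> {..<n}"
      then have "n = Suc (n - Suc i + i)" by simp
      then have "s ^ n = s * (s ^ (n - Suc i) * s ^ i)" by (metis power_Suc power_add)
      then show "s ^ n * (c i * z ^ i) = s * c i * s ^ (n - Suc i) * (s * z) ^ i"
        by (simp add: power_mult_distrib)
    qed simp
    finally show "(s * z) ^ n = (\<Sum>i<n. s * c i * s ^ (n - Suc i) * (s * z) ^ i)" .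
  qed
  then show thesis using that s by blast
qed

end

section \<open>Uniformizers of a Dedekind domain\<close>

lemma (in subring_of_field) fraction_field_closed:
  shows "subring_of_field (fraction_field R)" and "R \<subseteq> fraction_field R"
    and "x \<in> fraction_field R \<Longrightarrow> y \<in> fraction_field R \<Longrightarrow> x / y \<in> fraction_field R"
proof -
  have I: "a / b \<in> fraction_field R" if "a \<in> R" "b \<in> R" for a b
  proof (cases "b = 0")
    case True
    then have "a / b = 0 / 1 \<and> (0::'l) \<in> R \<and> (1::'l) \<in> R \<and> (1::'l) \<noteq> 0" by simp
    then show ?thesis unfolding fraction_field_def by blast
  qed (use that in \<open>auto simp: fraction_field_def\<close>)
  have E: "\<exists>a\<in>R. \<exists>b\<in>R. b \<noteq> 0 \<and> x = a / b" if "x \<in> fraction_field R" for x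
    using that by (auto simp: fraction_field_def)
  show sub: "R \<subseteq> fraction_field R" using I[OF _ one_mem] by auto
  show "x / y \<in> fraction_field R" if xy: "x \<in> fraction_field R" "y \<in> fraction_field R" for x y
  proof -
    obtain a b c d where "a \<in> R" "b \<in> R" "x = a / b" "c \<in> R" "d \<in> R" "y = c / d"
      using E[OF xy(1)] E[OF xy(2)] by blast
    then show ?thesis using I[of "a * d" "b * c"] by (simp add: mult_mem)
  qed
  show "subring_of_field (fraction_field R)"
  proof
    show "1 \<in> fraction_field R" using sub by auto
    fix x y assume xy: "x \<in> fraction_field R" "y \<in> fraction_field R"
    obtain a b c d where *: "a \<in> R" "b \<in> R" "x = a / b" "c \<in> R" "d \<in> R" "y = c / d" "b \<noteq> 0" "d \<noteq> 0"
      using E[OF xy(1)] E[OF xy(2)] by blast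
    then have "x - y = (a * d - c * b) / (b * d)" "x * y = (a * c) / (b * d)"
      by (simp_all add: field_simps)
    then show "x - y \<in> fraction_field R" "x * y \<in> fraction_field R"
      using I[of "a * d - c * b" "b * d"] I[of "a * c" "b * d"] * by (auto intro: closed)
  qed
qed

locale dedekind = subring_of_field R for R :: "'l::field set" +
  assumes noetherian: "noetherian_ring (ring_on R)"
    and integrally_closed: "x \<in> fraction_field R \<Longrightarrow> integral_over R x \<Longrightarrow> x \<in> R"
    and nonzero_prime_maximal: "primeideal P (ring_on R) \<Longrightarrow> P \<noteq> {0} \<Longrightarrow> maximalideal P (ring_on R)"
    and not_field: "\<not> field (ring_on R)"

lemma dedekindI:
  assumes "dedekind_domain R" "\<not> field (ring_on R)"
  shows "dedekind R"
proof -
  interpret subring_of_field R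
    using assms(1) by (auto simp: dedekind_domain_def intro: subring_of_fieldI)
  show ?thesis
  proof (intro dedekind.intro dedekind_axioms.intro)
    show "subring_of_field R" by (rule subring_of_field_axioms)
  qed (use assms in \<open>auto simp: dedekind_domain_def noetherian_domain_def\<close>)
qed

context dedekind
begin

lemma maximal_in_family:
  assumes "A \<noteq> {}" "\<And>J. J \<in> A \<Longrightarrow> ideal_of R J"
  shows "\<exists>M\<in>A. \<forall>J\<in>A. M \<subseteq> J \<longrightarrow> J = M"
  using noetherian_maximal_ideal[OF subring_of_field_axioms noetherian assms] by metis

lemma mSpec_nonzero:
  assumes "p \<in> mSpec R"
  obtains a where "a \<in> p" "a \<noteq> 0"
proof -
  interpret cring "ring_on R" by (rule ring_on_cring)
  have "p \<noteq> {0}" using assms not_field zeromaximalideal_eq_field by (auto simp: mSpec_def)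
  then show thesis using that mSpecD(4)[OF assms] by auto
qed

lemma nonzero_prime_mSpec:
  assumes "ideal_of R P" "1 \<notin> P" "\<And>x y. x \<in> R \<Longrightarrow> y \<in> R \<Longrightarrow> x * y \<in> P \<Longrightarrow> x \<in> P \<or> y \<in> P"
    and "a \<in> P" "a \<noteq> 0"
  shows "P \<in> mSpec R"
  using nonzero_prime_maximal[OF primeidealI'[OF assms(1-3)]] assms(4,5) by (auto simp: mSpec_def)

text \<open>
  Noetherian induction. A maximal counterexample \<open>M\<close> is prime, because from \<open>x * y \<in> M\<close> each prime
  above \<open>M\<close> contains \<open>M\<close> and \<open>x\<close> or \<open>M\<close> and \<open>y\<close>, and there are only finitely many of each kind
  unless \<open>x\<close> or \<open>y\<close> is in \<open>M\<close>. But a non-zero prime is maximal and has no other prime above it.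
\<close>
lemma finite_primes_above_ideal:
  assumes "ideal_of R J" "a \<in> J" "a \<noteq> 0"
  shows "finite {p \<in> mSpec R. J \<subseteq> p}"
proof (rule ccontr)
  assume inf: "infinite {p \<in> mSpec R. J \<subseteq> p}"
  define A where "A = {J. ideal_of R J \<and> (\<exists>a\<in>J. a \<noteq> 0) \<and> infinite {p \<in> mSpec R. J \<subseteq> p}}"
  have A_ideal: "ideal_of R J" if "J \<in> A" for J using that by (simp add: A_def)
  have "A \<noteq> {}" using assms inf unfolding A_def by blast
  then obtain M where M: "M \<in> A" and max: "\<And>J. J \<in> A \<Longrightarrow> M \<subseteq> J \<Longrightarrow> J = M"
    using maximal_in_family[of A] A_ideal by blast
  obtain a where a: "a \<in> M" "a \<noteq> 0" using M by (auto simp: A_def)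
  have Mi: "ideal_of R M" and Minf: "infinite {p \<in> mSpec R. M \<subseteq> p}" using M by (auto simp: A_def)
  have "1 \<notin> M"
  proof
    assume "1 \<in> M"
    then have "{p \<in> mSpec R. M \<subseteq> p} = {}" using mSpecD(2) by auto
    then show False using Minf by (metis finite.emptyI)
  qed
  have bigger: "finite {p \<in> mSpec R. M \<subseteq> p \<and> x \<in> p}" if x: "x \<in> R" "x \<notin> M" for x
  proof -
    let ?J = "{y + r * x | y r. y \<in> M \<and> r \<in> R}"
    note J = ideal_of_insert[OF Mi x(1)]
    have "?J \<notin> A" using max[of ?J] J(2,3) x(2) by auto
    then have fin: "finite {p \<in> mSpec R. ?J \<subseteq> p}" using J a by (auto simp: A_def)
    have "{p \<in> mSpec R. M \<subseteq> p \<and> x \<in> p} \<subseteq> {p \<in> mSpec R. ?J \<subseteq> p}"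
      by (auto intro!: ideal_ofD(3)[OF mSpecD(1)] ideal_ofD(4)[OF mSpecD(1)])
    then show ?thesis using fin by (rule finite_subset)
  qed
  show False
  proof (cases "\<forall>x\<in>R. \<forall>y\<in>R. x * y \<in> M \<longrightarrow> x \<in> M \<or> y \<in> M")
    case True
    then have "M \<in> mSpec R"
      by (intro nonzero_prime_mSpec[of M a] Mi \<open>1 \<notin> M\<close> a) auto
    then have "{p \<in> mSpec R. M \<subseteq> p} \<subseteq> {M}" using mSpec_eqI by blast
    then have "finite {p \<in> mSpec R. M \<subseteq> p}" by (rule finite_subset) simp
    then show False using Minf by blast
  next
    case False
    then obtain x y where xy: "x \<in> R" "y \<in> R" "x * y \<in> M" "x \<notin> M" "y \<notin> M" by blast
    have "{p \<in> mSpec R. M \<subseteq> p} \<subseteq>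
        {p \<in> mSpec R. M \<subseteq> p \<and> x \<in> p} \<union> {p \<in> mSpec R. M \<subseteq> p \<and> y \<in> p}"
      using mSpec_prime[OF _ xy(1,2)] xy(3) by auto
    then have "finite {p \<in> mSpec R. M \<subseteq> p}"
      by (rule finite_subset) (use bigger xy in simp)
    then show False using Minf by blast
  qed
qed

lemma finite_primes_above:
  assumes "c \<in> R" "c \<noteq> 0"
  shows "finite {p \<in> mSpec R. c \<in> p}"
proof -
  let ?J = "{y + r * c | y r. y \<in> {0} \<and> r \<in> R}"
  have "ideal_of R {0}" by (simp add: ideal_of_def)
  note J = ideal_of_insert[OF this assms(1)]
  have "{p \<in> mSpec R. c \<in> p} \<subseteq> {p \<in> mSpec R. ?J \<subseteq> p}"
    by (auto intro!: ideal_ofD(4)[OF mSpecD(1)])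
  then show ?thesis using finite_primes_above_ideal[OF J(1,3) assms(2)] by (rule finite_subset)
qed

text \<open>The maximal ideal of \<open>loc p\<close>.\<close>
definition loc_max :: "'l set \<Rightarrow> 'l set"
  where "loc_max p = {b / s | b s. b \<in> p \<and> s \<in> R - p}"

lemma loc_max_iff:
  assumes p: "p \<in> mSpec R"
  shows "x \<in> loc_max p \<longleftrightarrow> x \<in> loc p \<and> (x = 0 \<or> 1 / x \<notin> loc p)"
proof (cases "x = 0")
  case True
  have "0 / 1 \<in> loc_max p \<and> 0 / 1 \<in> loc p"
    using mSpecD[OF p] locI[of 0 1 p] one_mem unfolding loc_max_def by blast
  then show ?thesis using True by simp
next
  case False
  have "x \<in> loc p" if "x \<in> loc_max p"
    using that mSpecD(3)[OF p] by (auto simp: loc_max_def loc_def)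
  moreover have "x \<in> loc_max p \<longleftrightarrow> (\<exists>a\<in>p. \<exists>s\<in>R - p. x = a / s)" by (auto simp: loc_max_def)
  ultimately show ?thesis using loc_nonunit_iff[OF p _ False] False by blast
qed

lemma loc_max_mult:
  assumes p: "p \<in> mSpec R" and "x \<in> loc_max p" "y \<in> loc p"
  shows "y * x \<in> loc_max p"
proof -
  obtain b s where bs: "x = b / s" "b \<in> p" "s \<in> R - p" using assms by (auto simp: loc_max_def)
  obtain a t where at: "a \<in> R" "t \<in> R" "t \<notin> p" "t \<noteq> 0" "y = a / t" using locE[OF assms(3) p] .
  have "y * x = (a * b) / (t * s)" "a * b \<in> p" "t * s \<in> R - p"
    using bs at mSpecD(1)[OF p] mSpec_prime[OF p] by (auto intro: ideal_ofD(4) closed)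
  then show ?thesis unfolding loc_max_def by blast
qed

text \<open>
  Among the elements outside \<open>loc p\<close> choose \<open>u\<close> whose ideal of denominators is as large as
  possible. This ideal is then prime, hence maximal, and it is contained in \<open>p\<close>, hence equal to
  it.
\<close>
lemma exists_denominator_prime:
  assumes p: "p \<in> mSpec R"
  obtains u where "u \<in> fraction_field R" "u \<notin> loc p" "\<And>r. r \<in> p \<Longrightarrow> r * u \<in> loc p"
proof -
  interpret A: subring_of_field "loc p" by (rule loc_subring[OF p])
  note sub = loc_subring(2)[OF p]
  interpret K: subring_of_field "fraction_field R" by (rule fraction_field_closed)
  define D where "D u = {r \<in> R. r * u \<in> loc p}" for u
  have ideal: "ideal_of R (D u)" for u
    using sub by (auto simp: ideal_of_def D_def distrib_right mult.assoc intro: closed A.closed)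
  define F where "F = D ` {u \<in> fraction_field R. u \<notin> loc p}"
  have F_ideal: "ideal_of R J" if "J \<in> F" for J using that ideal by (auto simp: F_def)
  obtain a where a: "a \<in> p" "a \<noteq> 0" using mSpec_nonzero[OF p] .
  have "1 / a \<in> fraction_field R"
    using a mSpecD(3)[OF p] fraction_field_closed(2) by (intro fraction_field_closed(3)) auto
  then have "F \<noteq> {}" using loc_nonunit[OF p a] by (auto simp: F_def)
  then obtain M where M: "M \<in> F" and max: "\<And>J. J \<in> F \<Longrightarrow> M \<subseteq> J \<Longrightarrow> J = M"
    using maximal_in_family[of F] F_ideal by blast
  obtain u where u: "M = D u" "u \<in> fraction_field R" "u \<notin> loc p" using M by (auto simp: F_def)
  have "D u \<in> mSpec R"
  proof -
    obtain x y where xy: "u = x / y" "x \<in> R" "y \<in> R" "y \<noteq> 0"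
      using u(2) by (auto simp: fraction_field_def)
    have "y \<in> D u" using xy sub by (auto simp: D_def)
    moreover have "1 \<notin> D u" using u by (simp add: D_def)
    moreover have "r \<in> D u \<or> s \<in> D u" if rs: "r \<in> R" "s \<in> R" "r * s \<in> D u" for r s
    proof (rule disjCI)
      assume "s \<notin> D u"
      then have "s * u \<notin> loc p" using rs by (simp add: D_def)
      moreover have "s * u \<in> fraction_field R"
        using rs u fraction_field_closed(2) by (auto intro: K.closed)
      ultimately have "D (s * u) \<in> F" by (auto simp: F_def)
      moreover have "M \<subseteq> D (s * u)"
      proof
        fix t assume "t \<in> M"
        then have "s * (t * u) \<in> loc p" "t \<in> R" using u rs sub by (auto simp: D_def intro: A.closed)
        then show "t \<in> D (s * u)" by (simp add: D_def mult_ac)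
      qed
      ultimately have "D (s * u) = D u" using max u by blast
      then show "r \<in> D u" using rs by (auto simp: D_def mult_ac)
    qed
    ultimately show ?thesis using nonzero_prime_mSpec[OF ideal] xy(4) by metis
  qed
  moreover have "D u \<subseteq> p"
  proof
    fix r assume r: "r \<in> D u"
    show "r \<in> p"
    proof (rule ccontr)
      assume "r \<notin> p"
      then have "1 / r \<in> loc p" "r \<noteq> 0" using r loc_inverse[OF p] mSpecD(4)[OF p] by (auto simp: D_def)
      moreover have "r * u \<in> loc p" using r by (simp add: D_def)
      ultimately have "1 / r * (r * u) \<in> loc p" by (intro A.mult_mem[of "1 / r" "r * u"])
      then show False using u \<open>r \<noteq> 0\<close> by simp
    qed
  qed
  ultimately have "D u = p" using mSpec_eqI p by blast
  then show thesis using that u by (auto simp: D_def)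
qed

text \<open>
  An element that maps the maximal ideal of \<open>loc p\<close> to itself is integral. This is where the base
  ring being integrally closed enters.
\<close>
lemma stabilizer_of_loc_max:
  assumes p: "p \<in> mSpec R" and u: "u \<in> fraction_field R"
    and stab: "\<And>r. r \<in> p \<Longrightarrow> r * u \<in> loc_max p"
  shows "u \<in> loc p"
proof -
  interpret A: subring_of_field "loc p" by (rule loc_subring[OF p])
  note sub = loc_subring(2)[OF p]
  interpret K: subring_of_field "fraction_field R" by (rule fraction_field_closed)
  obtain a where a: "a \<in> p" "a \<noteq> 0" using mSpec_nonzero[OF p] .
  have step: "x * u \<in> loc_max p" if "x \<in> loc_max p" for x
  proof -
    obtain b s where bs: "x = b / s" "b \<in> p" "s \<in> R - p" using \<open>x \<in> loc_max p\<close> by (auto simp: loc_max_def)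
    then have "(1 / s) * (b * u) \<in> loc_max p"
      using loc_max_mult[OF p stab] loc_inverse[OF p] by blast
    then show ?thesis using bs by simp
  qed
  have au: "a * u ^ n \<in> loc_max p" for n
  proof (induction n)
    case 0
    have "a / 1 \<in> loc_max p" using a mSpecD[OF p] one_mem unfolding loc_max_def by blast
    then show ?case by simp
  next
    case (Suc n)
    then show ?case using step[of "a * u ^ n"] by (simp add: mult_ac)
  qed
  \<comment> \<open>The modules spanned by \<open>a, a * u, \<dots>, a * u ^ (n - 1)\<close> over \<open>loc p\<close> form an ascending chain
    of ideals of \<open>loc p\<close>; it is cut down to \<open>R\<close> because Noetherianity is available there. Where
    it becomes stationary, \<open>a * u ^ n\<close> is a combination of lower terms.\<close>
  define N where "N n = {r \<in> R. \<exists>c. (\<forall>i<n. c i \<in> loc p) \<and> r = (\<Sum>i<n. c i * (a * u ^ i))}" for n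
  have ideal: "ideal_of R (N n)" for n
    unfolding ideal_of_def
  proof (intro conjI ballI)
    show "0 \<in> N n" by (auto simp: N_def intro!: exI[of _ "\<lambda>_. 0"])
    fix x y assume "x \<in> N n" "y \<in> N n"
    then obtain c d where "\<forall>i<n. c i \<in> loc p" "x = (\<Sum>i<n. c i * (a * u ^ i))" "x \<in> R" "y \<in> R"
      "\<forall>i<n. d i \<in> loc p" "y = (\<Sum>i<n. d i * (a * u ^ i))"
      by (auto simp: N_def)
    then have "x + y \<in> R" "\<forall>i<n. c i + d i \<in> loc p" "x + y = (\<Sum>i<n. (c i + d i) * (a * u ^ i))"
      by (auto simp: sum.distrib distrib_right intro: closed A.closed)
    then show "x + y \<in> N n"
      unfolding N_def by (intro CollectI conjI exI[of _ "\<lambda>i. c i + d i"])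
  next
    fix r x assume "r \<in> R" "x \<in> N n"
    then obtain c where "\<forall>i<n. c i \<in> loc p" "x = (\<Sum>i<n. c i * (a * u ^ i))" "x \<in> R"
      by (auto simp: N_def)
    moreover from this have "r * x \<in> R" using \<open>r \<in> R\<close> by (intro mult_mem)
    moreover from calculation have "r * x = (\<Sum>i<n. (r * c i) * (a * u ^ i))"
      by (simp add: sum_distrib_left mult.assoc)
    moreover from calculation have "\<forall>i<n. r * c i \<in> loc p"
      using \<open>r \<in> R\<close> sub A.mult_mem by blast
    ultimately show "r * x \<in> N n"
      unfolding N_def by (intro CollectI conjI exI[of _ "\<lambda>i. r * c i"])
  qed (auto simp: N_def)
  have "N ` {0<..} \<noteq> {}" "\<And>J. J \<in> N ` {0<..} \<Longrightarrow> ideal_of R J" using ideal by auto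
  from maximal_in_family[OF this]
  obtain M where M: "M \<in> N ` {0<..}" and max: "\<And>J. J \<in> N ` {0<..} \<Longrightarrow> M \<subseteq> J \<Longrightarrow> J = M"
    by (metis (no_types, lifting))
  obtain n where n: "n > 0" "M = N n" using M by auto
  have "N n \<subseteq> N (Suc n)"
  proof
    fix r assume "r \<in> N n"
    then obtain c where c: "r \<in> R" "\<forall>i<n. c i \<in> loc p" "r = (\<Sum>i<n. c i * (a * u ^ i))"
      by (auto simp: N_def)
    have "(\<Sum>i<Suc n. (if i < n then c i else 0) * (a * u ^ i)) = (\<Sum>i<n. c i * (a * u ^ i))"
      by simp
    then show "r \<in> N (Suc n)"
      using c unfolding N_def by (intro CollectI conjI exI[of _ "\<lambda>i. if i < n then c i else 0"]) auto
  qed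
  then have N: "N (Suc n) = N n" using max[of "N (Suc n)"] n by auto
  have "a * u ^ n \<in> loc p" using au loc_max_iff[OF p] by blast
  then obtain s where s: "s \<in> R - p" "s * (a * u ^ n) \<in> R" unfolding mem_loc_iff[OF p] by blast
  have "s * (a * u ^ n) = (\<Sum>i<Suc n. (if i = n then s else 0) * (a * u ^ i))"
    by simp
  then have "s * (a * u ^ n) \<in> N (Suc n)"
    using s sub unfolding N_def by (intro CollectI conjI exI[of _ "\<lambda>i. if i = n then s else 0"]) auto
  then obtain c where c: "\<forall>i<n. c i \<in> loc p" "s * (a * u ^ n) = (\<Sum>i<n. c i * (a * u ^ i))"
    unfolding N by (auto simp: N_def)
  have "s \<noteq> 0" using s mSpecD(4)[OF p] by auto
  have "a * (s * u ^ n) = a * (\<Sum>i<n. c i * u ^ i)"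
    using c(2) by (simp add: sum_distrib_left mult_ac)
  then have "s * u ^ n = (\<Sum>i<n. c i * u ^ i)" using a(2) by simp
  then have "u ^ n = (1 / s) * (\<Sum>i<n. c i * u ^ i)" using \<open>s \<noteq> 0\<close> by (simp add: field_simps)
  then have "u ^ n = (\<Sum>i<n. (1 / s * c i) * u ^ i)" by (simp only: sum_distrib_left mult.assoc)
  moreover have "1 / s * c i \<in> loc p" if "i < n" for i
    using c(1) that s by (intro A.mult_mem loc_inverse[OF p]) auto
  ultimately have "integral_over (loc p) u" by (intro A.integralI[OF n(1)])
  from integral_over_loc[OF p this]
  obtain t where t: "t \<in> R - p" "integral_over R (t * u)" by metis
  have "t * u \<in> R"
    using t u fraction_field_closed(2) by (intro integrally_closed K.mult_mem) auto
  then show ?thesis using t unfolding mem_loc_iff[OF p] by blast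
qed

text \<open>
  With \<open>u\<close> as in the previous two lemmas, \<open>p * u\<close> is contained in \<open>loc p\<close> but not in its maximal
  ideal, so some \<open>r * u\<close> with \<open>r \<in> p\<close> is a unit. Then \<open>c / r\<close> is, up to this unit, \<open>c * u\<close>, and
  \<open>r\<close> generates.
\<close>
lemma exists_generator:
  assumes p: "p \<in> mSpec R"
  obtains \<pi> where "\<pi> \<in> p" "\<pi> \<noteq> 0" "\<And>c. c \<in> loc_max p \<Longrightarrow> c / \<pi> \<in> loc p"
proof -
  interpret A: subring_of_field "loc p" by (rule loc_subring[OF p])
  obtain u where u: "u \<in> fraction_field R" "u \<notin> loc p" "\<And>r. r \<in> p \<Longrightarrow> r * u \<in> loc p"
    using exists_denominator_prime[OF p] by blast
  obtain r where r: "r \<in> p" "r * u \<notin> loc_max p" using stabilizer_of_loc_max[OF p u(1)] u(2) by blast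
  then have w: "r * u \<noteq> 0" "1 / (r * u) \<in> loc p" using u(3) loc_max_iff[OF p] by auto
  have "c / r \<in> loc p" if c: "c \<in> loc_max p" for c
  proof -
    obtain b s where bs: "c = b / s" "b \<in> p" "s \<in> R - p" using c by (auto simp: loc_max_def)
    have "b * u * (1 / (r * u)) \<in> loc p" using bs u(3) w A.mult_mem by blast
    then have "b * u * (1 / (r * u)) * (1 / s) \<in> loc p"
      using bs loc_inverse[OF p] A.mult_mem by blast
    moreover have "b * u * (1 / (r * u)) * (1 / s) = c / r"
      using bs w by (simp add: mult.commute)
    ultimately show ?thesis by simp
  qed
  then show thesis using that[of r] r w by auto
qed

definition loc_unit :: "'l set \<Rightarrow> 'l \<Rightarrow> bool"
  where "loc_unit p x \<longleftrightarrow> x \<noteq> 0 \<and> x \<in> loc p \<and> 1 / x \<in> loc p"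

lemma exists_uniformizer:
  assumes p: "p \<in> mSpec R"
  obtains \<pi> where "\<pi> \<in> p" "\<pi> \<noteq> 0"
    "\<And>c. c \<in> fraction_field R \<Longrightarrow> c \<noteq> 0 \<Longrightarrow> \<exists>k. loc_unit p (c * \<pi> powi k)"
proof -
  interpret A: subring_of_field "loc p" by (rule loc_subring[OF p])
  note sub = loc_subring(2)[OF p]
  obtain \<pi> where pi: "\<pi> \<in> p" "\<pi> \<noteq> 0" "\<And>c. c \<in> loc_max p \<Longrightarrow> c / \<pi> \<in> loc p"
    using exists_generator[OF p] by blast
  have pi_R: "\<pi> \<in> R" using pi mSpecD(3)[OF p] by auto
  have ex: "\<exists>k. loc_unit p (c / \<pi> ^ k)" if c: "c \<in> loc p" "c \<noteq> 0" for c
  proof (rule ccontr)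
    assume n: "\<nexists>k. loc_unit p (c / \<pi> ^ k)"
    have in_loc: "c / \<pi> ^ k \<in> loc p" for k
    proof (induction k)
      case (Suc k)
      then have "c / \<pi> ^ k \<in> loc_max p" using n c pi(2) unfolding loc_max_iff[OF p] loc_unit_def by auto
      then have "c / \<pi> ^ k / \<pi> \<in> loc p" by (rule pi(3))
      then show ?case by (simp add: mult.commute)
    qed (use c in simp)
    \<comment> \<open>If no quotient \<open>c / \<pi> ^ k\<close> is a unit, then all of them are in \<open>loc p\<close> and generate a
      strictly ascending chain of ideals; \<open>I k\<close> is what the \<open>k\<close>-th one cuts out in \<open>R\<close>.\<close>
    define I where "I k = {r \<in> R. r * \<pi> ^ k / c \<in> loc p}" for k
    have ideal: "ideal_of R (I k)" for k
      unfolding ideal_of_def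
    proof (intro conjI ballI)
      fix x y assume "x \<in> I k" "y \<in> I k"
      then have "x * \<pi> ^ k / c + y * \<pi> ^ k / c \<in> loc p" "x + y \<in> R" by (auto simp: I_def intro: add_mem A.add_mem)
      then show "x + y \<in> I k" by (simp add: I_def add_divide_distrib distrib_right)
    next
      fix r x assume "r \<in> R" "x \<in> I k"
      then have "r * (x * \<pi> ^ k / c) \<in> loc p" "r * x \<in> R" using sub by (auto simp: I_def simp del: times_divide_eq_right intro: mult_mem A.mult_mem)
      then show "r * x \<in> I k" by (simp add: I_def mult_ac)
    qed (auto simp: I_def)
    have "range I \<noteq> {}" "\<And>J. J \<in> range I \<Longrightarrow> ideal_of R J" using ideal by auto
    from maximal_in_family[OF this]
    obtain M where M: "M \<in> range I" and max: "\<And>J. J \<in> range I \<Longrightarrow> M \<subseteq> J \<Longrightarrow> J = M"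
      by (metis (no_types, lifting))
    obtain k where k: "M = I k" using M by auto
    have "I k \<subseteq> I (Suc k)"
    proof
      fix r assume "r \<in> I k"
      then have "\<pi> * (r * \<pi> ^ k / c) \<in> loc p" "r \<in> R" using sub pi_R by (auto simp: I_def simp del: times_divide_eq_right intro: A.mult_mem)
      then show "r \<in> I (Suc k)" by (simp add: I_def mult_ac)
    qed
    then have eq: "I (Suc k) = I k" using max k by blast
    obtain s where s: "s \<in> R - p" "s * (c / \<pi> ^ Suc k) \<in> R"
      using in_loc[of "Suc k"] unfolding mem_loc_iff[OF p] by blast
    have "s * (c / \<pi> ^ Suc k) * \<pi> ^ Suc k / c = s" using c pi(2) by simp
    moreover have "s \<in> loc p" using s sub by blast
    ultimately have "s * (c / \<pi> ^ Suc k) * \<pi> ^ Suc k / c \<in> loc p" by (simp only:)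
    then have "s * (c / \<pi> ^ Suc k) \<in> I (Suc k)" using s(2) unfolding I_def by blast
    then have "s * (c / \<pi> ^ Suc k) \<in> I k" using eq by simp
    then have "s * (c / \<pi> ^ Suc k) * \<pi> ^ k / c \<in> loc p" unfolding I_def by blast
    moreover have "s * (c / \<pi> ^ Suc k) * \<pi> ^ k / c = s / \<pi>" using c pi(2) by simp
    ultimately have "1 / s * (s / \<pi>) \<in> loc p" using s loc_inverse[OF p] by (metis A.mult_mem DiffE)
    moreover have "s \<noteq> 0" using s mSpecD(4)[OF p] by auto
    ultimately show False using loc_nonunit[OF p pi(1,2)] by simp
  qed
  have "\<exists>k. loc_unit p (c * \<pi> powi k)" if c: "c \<in> fraction_field R" "c \<noteq> 0" for c
  proof -
    obtain x y where xy: "c = x / y" "x \<in> R" "y \<in> R" "y \<noteq> 0" using c by (auto simp: fraction_field_def)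
    then have "x \<noteq> 0" using c by auto
    obtain k l where kl: "loc_unit p (x / \<pi> ^ k)" "loc_unit p (y / \<pi> ^ l)"
      using ex[of x] ex[of y] xy \<open>x \<noteq> 0\<close> sub by blast
    define q where "q = (x / \<pi> ^ k) / (y / \<pi> ^ l)"
    have "q = (x / \<pi> ^ k) * (1 / (y / \<pi> ^ l))" "1 / q = (1 / (x / \<pi> ^ k)) * (y / \<pi> ^ l)"
      by (simp_all add: q_def)
    then have "q \<in> loc p" "1 / q \<in> loc p" using kl A.mult_mem unfolding loc_unit_def by metis+
    then have "loc_unit p q" using kl by (simp add: loc_unit_def q_def)
    moreover have "q = c * \<pi> powi (int l - int k)"
      using xy pi(2) by (simp add: q_def power_int_diff)
    ultimately show ?thesis by metis
  qed
  then show thesis using that pi by blast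
qed

end

section \<open>Rational valuations\<close>

text \<open>
  A valuation ring \<open>A\<close> with an element \<open>\<pi>\<close> to be given the value \<open>1\<close>. By \<open>torsion\<close>, every element has a power
  that is associated to a power of \<open>\<pi>\<close>, so that the value group embeds into the rationals; by
  \<open>unramified\<close>, no root is needed for the elements of \<open>K\<close>, which makes the valuation normalized on \<open>K\<close>.
\<close>
locale valuation_ring_over = subring_of_field A for A :: "'l::field set" +
  fixes K :: "'l set" and \<pi> :: 'l
  assumes total: "x \<noteq> 0 \<Longrightarrow> x \<in> A \<or> 1 / x \<in> A"
    and pi: "\<pi> \<noteq> 0" "\<pi> \<in> A" "1 / \<pi> \<notin> A"
    and pi_powi_K: "\<pi> powi k \<in> K"
    and torsion: "x \<noteq> 0 \<Longrightarrow> \<exists>n>0. \<exists>m. x ^ n * \<pi> powi m \<in> A \<and> 1 / (x ^ n * \<pi> powi m) \<in> A"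
    and unramified: "c \<in> K \<Longrightarrow> c \<noteq> 0 \<Longrightarrow> \<exists>m. c * \<pi> powi m \<in> A \<and> 1 / (c * \<pi> powi m) \<in> A"
begin

definition unit :: "'l \<Rightarrow> bool"
  where "unit x \<longleftrightarrow> x \<noteq> 0 \<and> x \<in> A \<and> 1 / x \<in> A"

lemma unit_mult: "unit x \<Longrightarrow> unit y \<Longrightarrow> unit (x * y)"
  using mult_mem[of x y] mult_mem[of "1 / x" "1 / y"] by (simp add: unit_def)

lemma unit_inverse: "unit x \<Longrightarrow> unit (1 / x)"
  by (simp add: unit_def)

lemma unit_divide: "unit x \<Longrightarrow> unit y \<Longrightarrow> unit (x / y)"
  using unit_mult[of x "1 / y"] unit_inverse by simp

lemma unit_power: "unit x \<Longrightarrow> unit (x ^ n)"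
proof (induction n)
  case (Suc n)
  then show ?case using unit_mult[of x "x ^ n"] by simp
qed (simp add: unit_def)

lemma unit_pi_powi:
  assumes "unit (\<pi> powi k)"
  shows "k = 0"
proof -
  have *: "\<not> unit (\<pi> ^ Suc n)" for n
  proof
    assume "unit (\<pi> ^ Suc n)"
    then have "\<pi> ^ n * (1 / \<pi> ^ Suc n) \<in> A"
      using pi by (intro mult_mem[OF power_mem]) (auto simp: unit_def)
    then show False using pi by simp
  qed
  consider "k = 0" | n where "k = int (Suc n)" | n where "k = - int (Suc n)"
    by (metis int_cases neq0_conv not_gr_zero not0_implies_Suc of_nat_0)
  then show ?thesis
  proof cases
    case (2 n)
    then show ?thesis using * assms by (simp only: power_int_of_nat)
  next
    case (3 n)
    then have "\<pi> powi k = 1 / \<pi> ^ Suc n"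
      by (simp only: power_int_minus power_int_of_nat inverse_eq_divide)
    then have "unit (\<pi> ^ Suc n)" using unit_inverse[OF assms] by simp
    then show ?thesis using * by blast
  qed
qed

text \<open>The value \<open>m / n\<close> is read off from \<open>x ^ n\<close> being associated to \<open>\<pi> powi m\<close>.\<close>
definition has_value :: "'l \<Rightarrow> rat \<Rightarrow> bool"
  where "has_value x r \<longleftrightarrow> (\<exists>n>0. \<exists>m. r = of_int m / of_nat n \<and> unit (x ^ n * \<pi> powi (- m)))"

lemma has_value_common:
  assumes "unit (x ^ n * \<pi> powi (- m))"
  shows "unit (x ^ (n * k) * \<pi> powi (- (m * int k)))"
proof -
  have "(x ^ n * \<pi> powi (- m)) ^ k = x ^ (n * k) * \<pi> powi (- (m * int k))"
    by (simp add: power_mult_distrib power_mult power_int_mult[of \<pi> "- m" "int k", simplified])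
  then show ?thesis using unit_power[OF assms] by metis
qed

lemma has_value_unique:
  assumes "has_value x r" "has_value x s"
  shows "r = s"
proof -
  obtain n m where nm: "n > 0" "r = of_int m / of_nat n" "unit (x ^ n * \<pi> powi (- m))"
    using assms(1) by (auto simp: has_value_def)
  obtain n' m' where nm': "n' > 0" "s = of_int m' / of_nat n'" "unit (x ^ n' * \<pi> powi (- m'))"
    using assms(2) by (auto simp: has_value_def)
  let ?u = "x ^ (n * n') * \<pi> powi (- (m * int n'))"
  let ?v = "x ^ (n' * n) * \<pi> powi (- (m' * int n))"
  have u: "unit (?u / ?v)"
    using has_value_common[OF nm(3), of n'] has_value_common[OF nm'(3), of n] by (rule unit_divide)
  have "x ^ (n * n') \<noteq> 0" using has_value_common[OF nm(3), of n'] by (auto simp: unit_def)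
  then have "?u / ?v = \<pi> powi (- (m * int n') - - (m' * int n))"
    unfolding power_int_diff[OF disjI1[OF pi(1)]] mult.commute[of n' n] by auto
  then have "unit (\<pi> powi (- (m * int n') - - (m' * int n)))" using u by metis
  from unit_pi_powi[OF this] have "m * int n' = m' * int n" by linarith
  then have "rat_of_int m * rat_of_nat n' = rat_of_int m' * rat_of_nat n"
    by (metis of_int_mult of_int_of_nat_eq)
  then show ?thesis unfolding nm(2) nm'(2) using nm(1) nm'(1) by (simp add: frac_eq_eq)
qed

lemma has_value_exists:
  assumes "x \<noteq> 0"
  obtains r where "has_value x r"
proof -
  obtain n m where nm: "n > 0" "x ^ n * \<pi> powi m \<in> A" "1 / (x ^ n * \<pi> powi m) \<in> A"
    using torsion[OF assms] by blast
  then have "unit (x ^ n * \<pi> powi (- (- m)))" using assms pi(1) by (simp add: unit_def)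
  then have "has_value x (of_int (- m) / of_nat n)" using nm(1) unfolding has_value_def by blast
  then show thesis by (rule that)
qed

lemma has_value_mult:
  assumes "has_value x r" "has_value y s"
  shows "has_value (x * y) (r + s)"
proof -
  obtain n m where nm: "n > 0" "r = of_int m / of_nat n" "unit (x ^ n * \<pi> powi (- m))"
    using assms(1) by (auto simp: has_value_def)
  obtain n' m' where nm': "n' > 0" "s = of_int m' / of_nat n'" "unit (y ^ n' * \<pi> powi (- m'))"
    using assms(2) by (auto simp: has_value_def)
  have u: "unit ((x ^ (n * n') * \<pi> powi (- (m * int n'))) * (y ^ (n' * n) * \<pi> powi (- (m' * int n))))"
    using has_value_common[OF nm(3), of n'] has_value_common[OF nm'(3), of n] by (rule unit_mult)
  have "(x ^ (n * n') * \<pi> powi (- (m * int n'))) * (y ^ (n' * n) * \<pi> powi (- (m' * int n)))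
      = (x * y) ^ (n * n') * (\<pi> powi (- (m * int n')) * \<pi> powi (- (m' * int n)))"
    by (simp add: power_mult_distrib mult_ac)
  also have "\<pi> powi (- (m * int n')) * \<pi> powi (- (m' * int n)) = \<pi> powi (- (m * int n' + m' * int n))"
    using pi(1) by (simp flip: power_int_add)
  finally have "unit ((x * y) ^ (n * n') * \<pi> powi (- (m * int n' + m' * int n)))" using u by metis
  moreover have "r + s = of_int (m * int n' + m' * int n) / of_nat (n * n')"
    using nm nm' by (simp add: field_simps)
  ultimately show ?thesis
    using nm(1) nm'(1) unfolding has_value_def by (metis nat_0_less_mult_iff)
qed

text \<open>
  Valuation rings are closed under roots: if \<open>x ^ n \<in> A\<close> and \<open>1 / x \<in> A\<close>, then
  \<open>x = x ^ n * (1 / x) ^ (n - 1)\<close> is in \<open>A\<close>.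
\<close>
lemma has_value_nonneg_iff:
  assumes "has_value x r"
  shows "0 \<le> r \<longleftrightarrow> x \<in> A"
proof -
  obtain n m where nm: "n > 0" "r = of_int m / of_nat n" "unit (x ^ n * \<pi> powi (- m))"
    using assms(1) by (auto simp: has_value_def)
  have x0: "x \<noteq> 0" using nm by (auto simp: unit_def zero_power)
  have r: "0 \<le> r \<longleftrightarrow> 0 \<le> m" using nm by (simp add: zero_le_divide_iff)
  show ?thesis
  proof
    assume "0 \<le> r"
    then obtain k where k: "m = int k" using r by (metis nonneg_int_cases)
    have "x ^ n * \<pi> powi (- m) * \<pi> ^ k \<in> A"
      using nm(3) pi by (intro mult_mem[OF _ power_mem]) (auto simp: unit_def)
    then have xn: "x ^ n \<in> A" using k pi(1) by (simp add: power_int_minus field_simps)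
    show "x \<in> A"
    proof (rule ccontr)
      assume n: "x \<notin> A"
      then have "x ^ n * (1 / x) ^ (n - 1) \<in> A"
        using total[OF x0] xn by (intro mult_mem[OF _ power_mem]) auto
      moreover have "x ^ n = x * x ^ (n - 1)" using nm(1) by (cases n) auto
      ultimately show False using n x0 by (simp add: power_divide)
    qed
  next
    assume x: "x \<in> A"
    show "0 \<le> r"
    proof (rule ccontr)
      assume "\<not> 0 \<le> r"
      then obtain k where k: "m = - int (Suc k)" using r by (metis neg_int_cases not_le Suc_pred)
      have "x ^ n * \<pi> ^ k * (1 / (x ^ n * \<pi> powi (- m))) \<in> A"
        using x pi nm(3) by (intro mult_mem[OF mult_mem[OF power_mem power_mem]]) (auto simp: unit_def)
      moreover have "\<pi> powi (- m) = \<pi> ^ Suc k" using k by (simp only: minus_minus power_int_of_nat)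
      ultimately show False using pi x0 by simp
    qed
  qed
qed

definition valuation :: "'l \<Rightarrow> ereal"
  where "valuation x = (if x = 0 then \<infinity> else ereal (of_rat (THE r. has_value x r)))"

lemma valuation_eq: "x \<noteq> 0 \<Longrightarrow> has_value x r \<Longrightarrow> valuation x = ereal (of_rat r)"
  using has_value_unique by (auto simp: valuation_def intro!: the_equality)

lemma valuation_ring: "{x. 0 \<le> valuation x} = A"
proof -
  have "0 \<le> valuation x \<longleftrightarrow> x \<in> A" for x
  proof (cases "x = 0")
    case False
    then obtain r where "has_value x r" by (rule has_value_exists)
    then show ?thesis using False valuation_eq has_value_nonneg_iff by fastforce
  qed (simp add: valuation_def)
  then show ?thesis by auto
qed

lemma valuation_mult: "valuation (x * y) = valuation x + valuation y"
proof (cases "x = 0 \<or> y = 0")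
  case False
  then obtain r s where rs: "has_value x r" "has_value y s" by (metis has_value_exists)
  then show ?thesis
    using has_value_mult[OF rs] False by (simp add: valuation_eq of_rat_add)
qed (auto simp: valuation_def)

lemma valuation_add: "min (valuation x) (valuation y) \<le> valuation (x + y)"
proof -
  \<comment> \<open>The summand of larger value is a multiple in \<open>A\<close> of the other one.\<close>
  have *: "valuation x \<le> valuation (x + y)"
    if nz: "x \<noteq> 0" "y \<noteq> 0" "x + y \<noteq> 0" and le: "valuation x \<le> valuation y" for x y
  proof -
    obtain r s where rs: "valuation x = ereal r" "valuation y = ereal s"
      using nz by (metis has_value_exists valuation_eq)
    have "valuation y = valuation x + valuation (y / x)"
      using nz by (simp flip: valuation_mult)
    then have "0 \<le> valuation (y / x)" using rs le by (cases "valuation (y / x)") auto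
    then have "y / x \<in> A" using valuation_ring by auto
    then have "1 + y / x \<in> A" by (rule add_mem[OF one_mem])
    then have "0 \<le> valuation (1 + y / x)" using valuation_ring by auto
    moreover have "x + y = x * (1 + y / x)" using nz by (simp add: distrib_left)
    then have "valuation (x + y) = valuation x + valuation (1 + y / x)" by (simp only: valuation_mult)
    ultimately show ?thesis using rs by (cases "valuation (1 + y / x)") auto
  qed
  show ?thesis
  proof (cases "x = 0 \<or> y = 0 \<or> x + y = 0")
    case False
    then show ?thesis using *[of x y] *[of y x] by (auto simp: min_def add.commute)
  qed (auto simp: valuation_def)
qed

lemma valuation_correct:
  "rational_valuation valuation \<and> {x. 0 \<le> valuation x} = A \<and>
    valuation ` (K - {0}) = range (\<lambda>n::int. ereal (of_int n))"
proof (intro conjI)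
  show "rational_valuation valuation"
    unfolding rational_valuation_def
    using valuation_mult valuation_add valuation_eq has_value_exists
    by (auto simp: valuation_def)
  show "{x. 0 \<le> valuation x} = A" by (rule valuation_ring)
  show "valuation ` (K - {0}) = range (\<lambda>n::int. ereal (of_int n))"
  proof
    show "valuation ` (K - {0}) \<subseteq> range (\<lambda>n::int. ereal (of_int n))"
    proof
      fix v assume "v \<in> valuation ` (K - {0})"
      then obtain c where c: "c \<in> K" "c \<noteq> 0" "v = valuation c" by blast
      then obtain m where "c * \<pi> powi m \<in> A" "1 / (c * \<pi> powi m) \<in> A" using unramified by blast
      then have "unit (c ^ 1 * \<pi> powi (- (- m)))" using c pi(1) by (simp add: unit_def)
      then have "has_value c (of_int (- m) / of_nat 1)" unfolding has_value_def by blast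
      then have "v = ereal (of_int (- m))" using valuation_eq c by (simp add: of_rat_minus)
      then show "v \<in> range (\<lambda>n::int. ereal (of_int n))" by blast
    qed
    show "range (\<lambda>n::int. ereal (of_int n)) \<subseteq> valuation ` (K - {0})"
    proof
      fix v assume "v \<in> range (\<lambda>n::int. ereal (of_int n))"
      then obtain n where n: "v = ereal (of_int n)" by blast
      have "(\<pi> powi n) ^ 1 * \<pi> powi (- n) = 1" using pi(1) by (simp flip: power_int_add)
      then have "has_value (\<pi> powi n) (of_int n / of_nat 1)"
        unfolding has_value_def by (intro exI[of _ 1] conjI exI[of _ n]) (auto simp: unit_def)
      then have "valuation (\<pi> powi n) = v" using valuation_eq pi(1) n by simp
      then show "v \<in> valuation ` (K - {0})" using pi_powi_K pi(1) by force
    qed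
  qed
qed

end

text \<open>
  The valuations of the theory take values in the extended reals; for calculations it is easier to use
  their real values at the non-zero elements.
\<close>
context
  fixes v :: "'l::field \<Rightarrow> ereal" and w :: "'l \<Rightarrow> real"
  assumes v: "rational_valuation v"
  defines "w \<equiv> \<lambda>x. real_of_ereal (v x)"
begin

lemma rv_ereal: "x \<noteq> 0 \<Longrightarrow> v x = ereal (w x)"
  using v unfolding rational_valuation_def w_def by (metis real_of_ereal.simps(1))

lemma rv_mult: "x \<noteq> 0 \<Longrightarrow> y \<noteq> 0 \<Longrightarrow> w (x * y) = w x + w y"
  using v rv_ereal[of x] rv_ereal[of y] unfolding rational_valuation_def w_def
  by (metis plus_ereal.simps(1) real_of_ereal.simps(1))

lemma rv_one: "w 1 = 0"
  using rv_mult[of 1 1] by simp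

lemma rv_inverse: "x \<noteq> 0 \<Longrightarrow> w (1 / x) = - w x"
  using rv_mult[of x "1 / x"] rv_one by simp

lemma rv_divide: "x \<noteq> 0 \<Longrightarrow> y \<noteq> 0 \<Longrightarrow> w (x / y) = w x - w y"
  using rv_mult[of x "1 / y"] rv_inverse[of y] by simp

lemma rv_power: "x \<noteq> 0 \<Longrightarrow> w (x ^ n) = of_nat n * w x"
  by (induction n) (simp_all add: rv_one rv_mult algebra_simps)

lemma rv_powi: "x \<noteq> 0 \<Longrightarrow> w (x powi k) = of_int k * w x"
  by (cases k rule: int_cases2)
    (simp_all add: rv_power power_int_minus inverse_eq_divide rv_inverse)

lemma rv_add: "x \<noteq> 0 \<Longrightarrow> y \<noteq> 0 \<Longrightarrow> x + y \<noteq> 0 \<Longrightarrow> min (w x) (w y) \<le> w (x + y)"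
  using v rv_ereal unfolding rational_valuation_def by (metis ereal_less_eq(3) ereal_min)

lemma rv_rational: "x \<noteq> 0 \<Longrightarrow> w x \<in> \<rat>"
  using v unfolding rational_valuation_def w_def by (metis Rats_of_rat real_of_ereal.simps(1))

end

text \<open>
  The valuation ring determines which values are non-negative, and so, with the normalization on
  \<open>K\<close>, an element \<open>c\<close> of value \<open>1\<close>. The rational number \<open>m / n\<close> is the value of \<open>x\<close> if and only if
  \<open>x ^ n / c ^ m\<close> has value \<open>0\<close>, which again depends only on the valuation ring.
\<close>
lemma rational_valuation_unique:
  assumes v: "rational_valuation v" "{x. 0 \<le> v x} = A" "v ` (K - {0}) = range (\<lambda>n::int. ereal (of_int n))"
    and w: "rational_valuation w" "{x. 0 \<le> w x} = A" "w ` (K - {0}) = range (\<lambda>n::int. ereal (of_int n))"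
    and K: "\<And>x y. x \<in> K \<Longrightarrow> y \<in> K \<Longrightarrow> x / y \<in> K"
  shows "v = w"
proof
  define rv where "rv x = real_of_ereal (v x)" for x
  define rw where "rw x = real_of_ereal (w x)" for x
  note V = rv_ereal[OF v(1), folded rv_def] rv_divide[OF v(1), folded rv_def]
    rv_power[OF v(1), folded rv_def] rv_inverse[OF v(1), folded rv_def] rv_powi[OF v(1), folded rv_def]
  note W = rv_ereal[OF w(1), folded rw_def] rv_divide[OF w(1), folded rw_def]
    rv_power[OF w(1), folded rw_def] rv_inverse[OF w(1), folded rw_def] rv_powi[OF w(1), folded rw_def]
  have nonneg: "0 \<le> rv x \<longleftrightarrow> 0 \<le> rw x" if "x \<noteq> 0" for x
    using that V(1)[of x] W(1)[of x] v(2) w(2) by (auto simp: set_eq_iff) (metis ereal_less_eq(5))+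
  have zero: "rv x = 0 \<longleftrightarrow> rw x = 0" if "x \<noteq> 0" for x
    using nonneg[of x] nonneg[of "1 / x"] V(4)[of x] W(4)[of x] that by auto
  have int: "\<exists>n::int. rv x = of_int n \<and> (\<exists>n::int. rw x = of_int n)" if "x \<in> K" "x \<noteq> 0" for x
  proof -
    have "v x \<in> range (\<lambda>n::int. ereal (of_int n))" "w x \<in> range (\<lambda>n::int. ereal (of_int n))"
      using v(3) w(3) that by blast+
    then show ?thesis unfolding rv_def rw_def by auto
  qed
  have ex: "\<exists>c\<in>K. c \<noteq> 0 \<and> u c = ereal 1"
    if "u ` (K - {0}) = range (\<lambda>n::int. ereal (of_int n))" for u :: "'a \<Rightarrow> ereal"
  proof -
    have "ereal (of_int 1) \<in> u ` (K - {0})" unfolding that by (rule rangeI)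
    then show ?thesis by auto
  qed
  obtain c where c: "c \<in> K" "c \<noteq> 0" "rv c = 1" using ex[OF v(3)] by (auto simp: rv_def)
  obtain d where d: "d \<in> K" "d \<noteq> 0" "rw d = 1" using ex[OF w(3)] by (auto simp: rw_def)
  have "rv d > 0" using nonneg[of "1 / d"] nonneg[of d] zero[of d] V(4)[of d] W(4)[of d] d by auto
  then have "rv d \<ge> 1" using int[OF d(1,2)] by auto
  then have "0 \<le> rv (d / c)" using V(2) c d by simp
  then have "0 \<le> rw (d / c)" using nonneg[of "d / c"] c d by simp
  then have "rw c \<le> 1" using W(2) c d by simp
  moreover have "rw c > 0" using nonneg[of "1 / c"] nonneg[of c] zero[of c] V(4)[of c] W(4)[of c] c by auto
  ultimately have wc: "rw c = 1" using int[OF c(1,2)] by auto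
  fix x
  show "v x = w x"
  proof (cases "x = 0")
    case True
    then show ?thesis using v(1) w(1) by (simp add: rational_valuation_def)
  next
    case False
    have "rv x \<in> \<rat>" unfolding rv_def by (rule rv_rational[OF v(1) False])
    then obtain q :: rat where q: "rv x = of_rat q" by (auto simp: Rats_def)
    obtain m n where mn: "quotient_of q = (m, n)" by force
    have n: "n > 0" using quotient_of_denom_pos[OF mn] .
    have "rv x = of_int m / of_int n" using q quotient_of_div[OF mn] by (simp add: of_rat_divide)
    then have eq: "of_int n * rv x = of_int m" using n by simp
    have "rv (x powi n / c powi m) = 0" using V(2,5) False c eq by simp
    then have "rw (x powi n / c powi m) = 0" using zero False c by simp
    then have "of_int n * rw x = of_int m" using W(2,5) False c wc by simp
    then have "rv x = rw x" using eq n by (metis mult_left_cancel of_int_0_eq_iff order_less_irrefl)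
    then show ?thesis using V(1) W(1) False by simp
  qed
qed

text \<open>
  The criterion that makes the local rings of the integral closure valuation rings: in an
  integrally closed local ring, \<open>x\<close> or \<open>1 / x\<close> is a member as soon as \<open>x\<close> is a root of a
  polynomial with a unit among its coefficients. For the leading coefficient \<open>b\<close> the product
  \<open>b * x\<close> is integral, and it can be absorbed into the next coefficient. If this destroys the only
  unit, then \<open>b * x\<close> is itself a unit by locality, and \<open>1 / x = b / (b * x)\<close>.
\<close>
lemma unit_coefficient_lemma:
  assumes A: "subring_of_field A" and local: "\<And>x y. x \<in> A \<Longrightarrow> x = 0 \<or> 1 / x \<notin> A \<Longrightarrow>
      y \<in> A \<Longrightarrow> y = 0 \<or> 1 / y \<notin> A \<Longrightarrow> x + y = 0 \<or> 1 / (x + y) \<notin> A"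
    and int_closed: "\<And>z. integral_over A z \<Longrightarrow> z \<in> A"
  shows "(\<And>i. i \<le> n \<Longrightarrow> a i \<in> A) \<Longrightarrow> (\<Sum>i\<le>n. a i * x ^ i) = 0 \<Longrightarrow>
    k \<le> n \<Longrightarrow> a k \<noteq> 0 \<Longrightarrow> 1 / a k \<in> A \<Longrightarrow> x \<in> A \<or> 1 / x \<in> A"
proof (induction n arbitrary: a k)
  case 0
  then show ?case by simp
next
  case (Suc n)
  interpret subring_of_field A by (rule A)
  let ?b = "a (Suc n)"
  show ?case
  proof (cases "?b = 0")
    case True
    then have "k \<le> n" using Suc.prems by (metis le_Suc_eq)
    then show ?thesis using Suc.IH[of a k] Suc.prems True by simp
  next
    case b0: False
    define q where "q = (\<Sum>i\<le>Suc n. Polynomial.monom (a i) i)"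
    have cq: "Polynomial.coeff q i = (if i \<le> Suc n then a i else 0)" for i
      by (simp add: q_def coeff_sum if_distrib cong: if_cong del: sum.atMost_Suc)
    have deg: "Polynomial.degree q = Suc n"
      by (rule antisym) (auto intro: degree_le le_degree simp: cq b0)
    have "integral_over A (Polynomial.lead_coeff q * x)"
    proof (rule lead_coeff_times_root_integral)
      show "q \<in> polys_over A" using Suc.prems(1) by (auto simp: polys_over_def cq)
      show "Polynomial.poly q x = 0"
        unfolding q_def poly_sum poly_monom using Suc.prems(2) .
    qed (simp add: deg)
    then have bx: "?b * x \<in> A" using int_closed by (simp add: deg cq)
    show ?thesis
    proof (cases "1 / ?b \<in> A")
      case True
      then have "1 / ?b * (?b * x) \<in> A" using bx by (rule mult_mem)
      then show ?thesis using b0 by simp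
    next
      case nonunit: False
      then have kn: "k \<le> n" using Suc.prems by (metis le_Suc_eq)
      define a' where "a' = a(n := a n + ?b * x)"
      have a'A: "a' i \<in> A" if "i \<le> n" for i
        using that Suc.prems(1) bx add_mem by (auto simp: a'_def)
      have "(\<Sum>i\<le>n. a' i * x ^ i) = (\<Sum>i<n. a i * x ^ i) + (a n + ?b * x) * x ^ n"
        by (simp add: a'_def lessThan_Suc_atMost[symmetric])
      also have "\<dots> = (\<Sum>i\<le>Suc n. a i * x ^ i)"
        by (simp add: lessThan_Suc_atMost[symmetric] algebra_simps)
      finally have sum: "(\<Sum>i\<le>n. a' i * x ^ i) = 0" using Suc.prems(2) by simp
      show ?thesis
      proof (cases "\<exists>j\<le>n. a' j \<noteq> 0 \<and> 1 / a' j \<in> A")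
        case True
        then show ?thesis using Suc.IH[of a', OF a'A sum] by blast
      next
        case no: False
        then have "k = n" using kn Suc.prems(4,5) by (auto simp: a'_def split: if_splits)
        have n0: "a n + ?b * x = 0 \<or> 1 / (a n + ?b * x) \<notin> A"
          using no by (auto simp: a'_def)
        have "\<not> (?b * x = 0 \<or> 1 / (?b * x) \<notin> A)"
        proof
          assume "?b * x = 0 \<or> 1 / (?b * x) \<notin> A"
          then have *: "- (?b * x) = 0 \<or> 1 / (- (?b * x)) \<notin> A"
            using uminus_mem[of "1 / - (?b * x)"] by auto
          have "a n + ?b * x \<in> A" using a'A[of n] by (simp add: a'_def)
          from local[OF this n0 uminus_mem[OF bx] *] have "a n = 0 \<or> 1 / a n \<notin> A" by simp
          then show False using Suc.prems(4,5) \<open>k = n\<close> by blast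
        qed
        then have "1 / (?b * x) \<in> A" "x \<noteq> 0" by auto
        then have "?b * (1 / (?b * x)) \<in> A" using Suc.prems(1)[of "Suc n"] mult_mem by blast
        then show ?thesis using b0 by simp
      qed
    qed
  qed
qed

section \<open>The valuations of the integral closure\<close>

locale dedekind_extension = dedekind +
  assumes algebraic: "algebraic_extension (fraction_field R)"
begin

abbreviation K :: "'a set" where "K \<equiv> fraction_field R"
abbreviation S :: "'a set" where "S \<equiv> integral_closure R"

sublocale K: subring_of_field "fraction_field R"
  by (rule fraction_field_closed)

sublocale S: subring_of_field "integral_closure R"
  by (rule integral_closure_subring)

lemmas K_divide = fraction_field_closed(3)

lemma R_sub_S: "x \<in> R \<Longrightarrow> x \<in> S"
  using integral_closure_base by blast

lemma R_sub_K: "x \<in> R \<Longrightarrow> x \<in> K"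
  using fraction_field_closed(2) by blast

lemma S_inter_K: "x \<in> S \<Longrightarrow> x \<in> K \<Longrightarrow> x \<in> R"
  using integrally_closed by (simp add: integral_closure_def)

lemma K_powi: "x \<in> K \<Longrightarrow> x powi k \<in> K"
  using K_divide[of 1 "x ^ nat (- k)"]
  by (cases "k \<ge> 0") (auto simp: power_int_def inverse_eq_divide power_divide intro: K.power_mem)

lemma poly_over_K:
  obtains q where "q \<in> polys_over K" "q \<noteq> 0" "Polynomial.poly q x = 0" "Polynomial.degree q > 0"
proof -
  obtain q where q: "q \<in> polys_over K" "q \<noteq> 0" "Polynomial.poly q x = 0"
    using algebraic unfolding algebraic_extension_def by blast
  have "Polynomial.degree q > 0"
  proof (rule ccontr)
    assume "\<not> Polynomial.degree q > 0"
    then obtain c where "q = [:c:]" by (metis degree_eq_zeroE neq0_conv)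
    then show False using q by simp
  qed
  then show thesis by (rule that[OF q])
qed

lemma common_denominator_K:
  assumes "finite A" "\<And>i. i \<in> A \<Longrightarrow> f i \<in> K"
  shows "\<exists>d\<in>R. d \<noteq> 0 \<and> (\<forall>i\<in>A. d * f i \<in> R)"
  using assms
proof (induction A rule: finite_induct)
  case empty
  then show ?case by (intro bexI[of _ 1]) auto
next
  case (insert j A)
  then obtain d where d: "d \<in> R" "d \<noteq> 0" "\<And>i. i \<in> A \<Longrightarrow> d * f i \<in> R" by auto
  have "f j \<in> K" using insert.prems by simp
  then obtain a b where ab: "f j = a / b" "a \<in> R" "b \<in> R" "b \<noteq> 0" by (auto simp: fraction_field_def)
  have "b * d * f i \<in> R" if "i \<in> A" for i
    using mult_mem[OF ab(3) d(3)[OF that]] by (simp add: mult.assoc)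
  moreover have "b * d * f j \<in> R" using mult_mem[OF ab(2) d(1)] ab by (simp add: mult_ac)
  ultimately show ?case using d ab by (intro bexI[of _ "b * d"]) (auto intro: mult_mem)
qed

text \<open>
  Denominators can be taken in the base ring, because every element is a root of a polynomial over
  it.
\<close>
lemma denominator:
  obtains d where "d \<in> R" "d \<noteq> 0" "d * x \<in> S"
proof -
  obtain q where q: "q \<in> polys_over K" "q \<noteq> 0" "Polynomial.poly q x = 0" "Polynomial.degree q > 0"
    by (rule poly_over_K)
  have "\<exists>d\<in>R. d \<noteq> 0 \<and> (\<forall>i\<in>{..Polynomial.degree q}. d * Polynomial.coeff q i \<in> R)"
    by (rule common_denominator_K) (use q(1) in \<open>auto simp: polys_over_def\<close>)
  then obtain d where d: "d \<in> R" "d \<noteq> 0" "\<And>i. i \<le> Polynomial.degree q \<Longrightarrow> d * Polynomial.coeff q i \<in> R"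
    by (metis atMost_iff)
  define p where "p = Polynomial.smult d q"
  have "d * Polynomial.coeff q i \<in> R" for i
    using d(3)[of i] coeff_eq_0[of q i] by (cases "i \<le> Polynomial.degree q") auto
  then have "p \<in> polys_over R" by (simp add: p_def polys_over_def)
  moreover have "Polynomial.degree p > 0" "Polynomial.poly p x = 0"
    using q d(2) by (simp_all add: p_def)
  ultimately have "integral_over R (Polynomial.lead_coeff p * x)"
    by (rule lead_coeff_times_root_integral)
  moreover have "Polynomial.lead_coeff p \<in> R" using \<open>p \<in> polys_over R\<close> by (simp add: polys_over_def)
  moreover have "Polynomial.lead_coeff p \<noteq> 0" using q d(2) by (auto simp: p_def)
  ultimately show thesis
    by (intro that[of "Polynomial.lead_coeff p"]) (simp_all add: integral_closure_def)
qed

definition below :: "'a set \<Rightarrow> 'a set"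
  where "below P = P \<inter> R"

text \<open>
  If \<open>0\<close> were maximal, then \<open>S\<close> would be a field; but the inverse of a non-unit of \<open>R\<close> is in \<open>K\<close>
  and not in \<open>R\<close>, so it is not integral.
\<close>
lemma mSpec_S_nonzero:
  assumes P: "P \<in> mSpec S"
  obtains x where "x \<in> P" "x \<noteq> 0"
proof -
  have "ideal_of R {0}" by (simp add: ideal_of_def)
  then obtain p where p: "p \<in> mSpec R" using exists_maximal_ideal[of "{0}"] by auto
  obtain a where a: "a \<in> p" "a \<noteq> 0" using mSpec_nonzero[OF p] .
  then have aR: "a \<in> R" using mSpecD(3)[OF p] by blast
  show thesis
  proof (cases "a \<in> P")
    case True
    then show thesis using that a by blast
  next
    case False
    obtain x r where xr: "x \<in> P" "r \<in> S" "x + r * a = 1"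
      using S.mSpec_inverse_mod[OF P R_sub_S[OF aR] False] by blast
    have "x \<noteq> 0"
    proof
      assume "x = 0"
      then have "r = 1 / a" using xr a(2) by (simp add: field_simps)
      then have "r \<in> K" using K_divide[OF K.one_mem R_sub_K[OF aR]] by simp
      then have "r \<in> R" using S_inter_K[OF xr(2)] by blast
      from ideal_ofD(4)[OF mSpecD(1)[OF p] this a(1)] have "r * a \<in> p" .
      then show False using xr \<open>x = 0\<close> mSpecD(2)[OF p] by simp
    qed
    then show thesis using that xr by blast
  qed
qed

text \<open>
  A multiple in \<open>S\<close> of a non-zero \<open>x \<in> P\<close> lies in \<open>R\<close>, namely a denominator of \<open>1 / x\<close>; so \<open>P\<close> has
  non-zero intersection with \<open>R\<close>.
\<close>
lemma below_mSpec:
  assumes P: "P \<in> mSpec S"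
  shows "below P \<in> mSpec R"
proof -
  obtain x where x: "x \<in> P" "x \<noteq> 0" using mSpec_S_nonzero[OF P] .
  obtain d where d: "d \<in> R" "d \<noteq> 0" "d * (1 / x) \<in> S" using denominator .
  have "d * (1 / x) * x \<in> P" by (rule ideal_ofD(4)[OF S.mSpecD(1)[OF P] d(3) x(1)])
  then have "d \<in> below P" using d x by (simp add: below_def)
  moreover have "ideal_of R (below P)"
    using S.mSpecD(1)[OF P] R_sub_S by (auto simp: ideal_of_def below_def intro: closed)
  moreover have "1 \<notin> below P" using S.mSpecD(2)[OF P] by (simp add: below_def)
  moreover have "a \<in> below P \<or> b \<in> below P" if "a \<in> R" "b \<in> R" "a * b \<in> below P" for a b
    using that S.mSpec_prime[OF P R_sub_S R_sub_S] by (auto simp: below_def)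
  ultimately show ?thesis using d(2) by (intro nonzero_prime_mSpec[of "below P" d])
qed

lemma loc_below:
  assumes P: "P \<in> mSpec S" and x: "x \<in> loc (below P)"
  shows "x \<in> S.loc P"
proof -
  obtain a s where "a \<in> R" "s \<in> R" "s \<notin> below P" "s \<noteq> 0" "x = a / s"
    using locE[OF x below_mSpec[OF P]] .
  then show ?thesis using S.locI[of a s P] R_sub_S by (auto simp: below_def)
qed

lemma loc_S_integrally_closed:
  assumes P: "P \<in> mSpec S" and "integral_over (S.loc P) z"
  shows "z \<in> S.loc P"
proof -
  from S.integral_over_loc[OF assms]
  obtain s where s: "s \<in> S - P" "integral_over S (s * z)" by metis
  from this(2) have "s * z \<in> S" by (rule integral_closure_closed)
  then show ?thesis using s(1) unfolding S.mem_loc_iff[OF P] by blast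
qed

text \<open>
  A power of a uniformizer scales a polynomial over \<open>K\<close> in such a way that
  \<open>unit_coefficient_lemma\<close> applies.
\<close>
lemma loc_S_total:
  assumes P: "P \<in> mSpec S" and "x \<noteq> 0"
  shows "x \<in> S.loc P \<or> 1 / x \<in> S.loc P"
proof -
  interpret A: subring_of_field "S.loc P" by (rule S.loc_subring[OF P])
  let ?p = "below P"
  have p: "?p \<in> mSpec R" by (rule below_mSpec[OF P])
  obtain \<pi> where pi: "\<pi> \<in> ?p" "\<pi> \<noteq> 0"
    "\<And>c. c \<in> K \<Longrightarrow> c \<noteq> 0 \<Longrightarrow> \<exists>k. loc_unit ?p (c * \<pi> powi k)"
    using exists_uniformizer[OF p] by blast
  have pi_loc: "\<pi> \<in> loc ?p" using pi(1) loc_subring(2)[OF p] by (auto simp: below_def)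
  obtain q where q: "q \<in> polys_over K" "q \<noteq> 0" "Polynomial.poly q x = 0" "Polynomial.degree q > 0"
    by (rule poly_over_K)
  define n where "n = Polynomial.degree q"
  define c where "c i = Polynomial.coeff q i" for i
  define I where "I = {i. i \<le> n \<and> c i \<noteq> 0}"
  have "\<forall>i. \<exists>k. c i \<noteq> 0 \<longrightarrow> loc_unit ?p (c i * \<pi> powi k)"
    using pi(3) q(1) by (auto simp: c_def polys_over_def)
  then obtain k where k: "\<And>i. c i \<noteq> 0 \<Longrightarrow> loc_unit ?p (c i * \<pi> powi k i)" by metis
  have I: "finite I" "n \<in> I" using q(2) by (auto simp: I_def n_def c_def)
  \<comment> \<open>Scaling by this power of \<open>\<pi>\<close> makes all coefficients integral at \<open>below P\<close> and one of them a unit.\<close>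
  define m where "m = Max (k ` I)"
  have "m \<in> k ` I" unfolding m_def using I by (intro Max_in) auto
  then obtain j where j: "j \<in> I" "k j = m" by auto
  define a where "a i = c i * \<pi> powi m" for i
  have aA: "a i \<in> S.loc P" if "i \<le> n" for i
  proof (cases "c i = 0")
    case False
    then have "k i \<le> m" unfolding m_def using that I by (intro Max_ge) (auto simp: I_def)
    then have "m = k i + int (nat (m - k i))" by simp
    then have "\<pi> powi m = \<pi> powi k i * \<pi> ^ nat (m - k i)"
      using pi(2) by (metis power_int_add power_int_of_nat)
    then have "a i = c i * \<pi> powi k i * \<pi> ^ nat (m - k i)" by (simp add: a_def)
    also have "\<dots> \<in> S.loc P"
      using k[OF False] pi_loc loc_below[OF P]
      by (intro A.mult_mem[OF _ A.power_mem]) (auto simp: loc_unit_def)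
    finally show ?thesis .
  qed (simp add: a_def)
  have "loc_unit ?p (a j)" using k[of j] j by (auto simp: a_def I_def)
  then have unit: "a j \<noteq> 0" "1 / a j \<in> S.loc P" using loc_below[OF P] by (auto simp: loc_unit_def)
  have "(\<Sum>i\<le>n. a i * x ^ i) = \<pi> powi m * Polynomial.poly q x"
    by (simp add: poly_altdef a_def c_def n_def sum_distrib_left mult_ac)
  then have sum: "(\<Sum>i\<le>n. a i * x ^ i) = 0" using q(3) by simp
  show ?thesis
    by (rule unit_coefficient_lemma[OF A.subring_of_field_axioms S.loc_local[OF P]
          loc_S_integrally_closed[OF P] aA sum _ unit]) (use j in \<open>auto simp: I_def\<close>)
qed

text \<open>
  Used to pick a term of least value before a valuation is available, with divisibility in place
  of values.
\<close>
lemma total_preorder_minimum: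
  assumes "finite I" "I \<noteq> {}" "\<And>x y. x \<in> I \<Longrightarrow> y \<in> I \<Longrightarrow> Q x y \<or> Q y x"
    "\<And>x y z. x \<in> I \<Longrightarrow> y \<in> I \<Longrightarrow> z \<in> I \<Longrightarrow> Q x y \<Longrightarrow> Q y z \<Longrightarrow> Q x z"
  shows "\<exists>m\<in>I. \<forall>x\<in>I. Q m x"
  using assms
proof (induction I rule: finite_ne_induct)
  case (singleton x)
  then show ?case by blast
next
  case (insert j I)
  have "\<exists>m\<in>I. \<forall>x\<in>I. Q m x"
  proof (rule insert.IH)
    show "Q x y \<or> Q y x" if "x \<in> I" "y \<in> I" for x y
      using insert.prems(1)[of x y] that by simp
    show "Q x z" if "x \<in> I" "y \<in> I" "z \<in> I" "Q x y" "Q y z" for x y z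
      using insert.prems(2)[of x y z] that by simp
  qed
  then obtain m where m: "m \<in> I" "\<And>x. x \<in> I \<Longrightarrow> Q m x" by blast
  have refl: "Q j j" using insert.prems(1)[of j j] by blast
  have mj: "Q m j \<or> Q j m" using insert.prems(1)[of m j] m(1) by blast
  then show ?case
  proof
    assume "Q m j"
    then show ?thesis using m by (intro bexI[of _ m]) auto
  next
    assume jm: "Q j m"
    have "Q j x" if "x \<in> I" for x using insert.prems(2)[of j m x] m that jm by blast
    then show ?thesis using refl by (intro bexI[of _ j]) auto
  qed
qed

text \<open>
  In a polynomial relation for \<open>x\<close> over \<open>K\<close> the term of least value cannot be alone, so two terms
  \<open>c i * x ^ i\<close> and \<open>c j * x ^ j\<close> are associated; hence \<open>x ^ \<bar>i - j\<bar>\<close> has the value of an element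
  of \<open>K\<close>.
\<close>
lemma loc_S_torsion:
  assumes P: "P \<in> mSpec S" and x: "x \<noteq> 0"
  shows "\<exists>n>0. \<exists>c\<in>K. c \<noteq> 0 \<and> c * x ^ n \<in> S.loc P \<and> 1 / (c * x ^ n) \<in> S.loc P"
proof -
  interpret A: subring_of_field "S.loc P" by (rule S.loc_subring[OF P])
  obtain q where q: "q \<in> polys_over K" "q \<noteq> 0" "Polynomial.poly q x = 0" "Polynomial.degree q > 0"
    by (rule poly_over_K)
  define c where "c i = Polynomial.coeff q i" for i
  define I where "I = {i. i \<le> Polynomial.degree q \<and> c i \<noteq> 0}"
  define t where "t i = c i * x ^ i" for i
  have I: "finite I" "I \<noteq> {}" using q(2) by (auto simp: I_def c_def intro!: exI[of _ "Polynomial.degree q"])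
  have t0: "t i \<noteq> 0" if "i \<in> I" for i using that x by (simp add: t_def I_def)
  have "\<exists>m\<in>I. \<forall>i\<in>I. t i / t m \<in> S.loc P"
  proof (rule total_preorder_minimum[OF I])
    fix i j assume ij: "i \<in> I" "j \<in> I"
    then show "t j / t i \<in> S.loc P \<or> t i / t j \<in> S.loc P"
      using loc_S_total[OF P, of "t j / t i"] t0 by auto
    fix l assume "t j / t i \<in> S.loc P" "t l / t j \<in> S.loc P"
    then have "t j / t i * (t l / t j) \<in> S.loc P" by (rule A.mult_mem)
    then show "t l / t i \<in> S.loc P" using t0 ij by simp
  qed
  then obtain m where m: "m \<in> I" "\<And>i. i \<in> I \<Longrightarrow> t i / t m \<in> S.loc P" by blast
  have "\<exists>i\<in>I - {m}. 1 / (t i / t m) \<in> S.loc P"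
  proof (rule ccontr)
    assume no: "\<not> ?thesis"
    \<comment> \<open>A sum of non-units of the local ring is a non-unit, but the sum over \<open>I - {m}\<close> is \<open>- 1\<close>.\<close>
    have "sum (\<lambda>i. t i / t m) J \<in> S.loc P \<and>
        (sum (\<lambda>i. t i / t m) J = 0 \<or> 1 / sum (\<lambda>i. t i / t m) J \<notin> S.loc P)"
      if "J \<subseteq> I - {m}" for J
      using finite_subset[OF that] I(1) that
    proof (induction J rule: infinite_finite_induct)
      case (insert i J)
      then have IH: "sum (\<lambda>i. t i / t m) J \<in> S.loc P"
        "sum (\<lambda>i. t i / t m) J = 0 \<or> 1 / sum (\<lambda>i. t i / t m) J \<notin> S.loc P" by auto
      have i: "t i / t m \<in> S.loc P" "t i / t m = 0 \<or> 1 / (t i / t m) \<notin> S.loc P"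
        using insert.prems m(2) no by auto
      show ?case
        using S.loc_local[OF P i IH] A.add_mem[OF i(1) IH(1)] insert by simp
    qed auto
    from this[of "I - {m}"]
    have non: "sum (\<lambda>i. t i / t m) (I - {m}) = 0 \<or> 1 / sum (\<lambda>i. t i / t m) (I - {m}) \<notin> S.loc P" by simp
    have "(\<Sum>i\<in>I. t i) = Polynomial.poly q x"
      unfolding poly_altdef t_def c_def[symmetric] by (rule sum.mono_neutral_left) (auto simp: I_def)
    then have "(\<Sum>i\<in>I. t i / t m) = 0" using q(3) by (simp add: sum_divide_distrib[symmetric])
    moreover have "(\<Sum>i\<in>I. t i / t m) = t m / t m + sum (\<lambda>i. t i / t m) (I - {m})"
      by (rule sum.remove[OF I(1) m(1)])
    ultimately have "1 + sum (\<lambda>i. t i / t m) (I - {m}) = 0" using t0[OF m(1)] by simp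
    then have "sum (\<lambda>i. t i / t m) (I - {m}) = - 1" by (simp add: add_eq_0_iff)
    then show False using non A.uminus_mem[OF A.one_mem] by simp
  qed
  then obtain i where i: "i \<in> I" "i \<noteq> m" "1 / (t i / t m) \<in> S.loc P" by auto
  have cK: "c j \<in> K" for j using q(1) by (simp add: c_def polys_over_def)
  have c0: "c i \<noteq> 0" "c m \<noteq> 0" using i m by (auto simp: I_def)
  have both: "t i / t m \<in> S.loc P" "t m / t i \<in> S.loc P" using m(2)[OF i(1)] i(3) by auto
  show ?thesis
  proof (cases "m < i")
    case True
    then have "x ^ i = x ^ m * x ^ (i - m)" by (simp flip: power_add)
    then have eq: "t i / t m = (c i / c m) * x ^ (i - m)" using x c0 by (simp add: t_def)
    then have "1 / (c i / c m * x ^ (i - m)) = t m / t i" using eq by (metis divide_divide_eq_right mult_1)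
    then show ?thesis using both eq True c0 K_divide[OF cK cK]
      by (intro exI[of _ "i - m"] conjI bexI[of _ "c i / c m"]) auto
  next
    case False
    then have "x ^ m = x ^ i * x ^ (m - i)" using i by (simp flip: power_add)
    then have eq: "t m / t i = (c m / c i) * x ^ (m - i)" using x c0 by (simp add: t_def)
    then have "1 / (c m / c i * x ^ (m - i)) = t i / t m" using eq by (metis divide_divide_eq_right mult_1)
    then show ?thesis using both eq False i c0 K_divide[OF cK cK]
      by (intro exI[of _ "m - i"] conjI bexI[of _ "c m / c i"]) auto
  qed
qed

lemma valuation_at_exists:
  assumes P: "P \<in> mSpec S"
  shows "\<exists>v. rational_valuation v \<and> {x. 0 \<le> v x} = S.loc P \<and>
    v ` (K - {0}) = range (\<lambda>n::int. ereal (of_int n))"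
proof -
  interpret A: subring_of_field "S.loc P" by (rule S.loc_subring[OF P])
  let ?p = "below P"
  have p: "?p \<in> mSpec R" by (rule below_mSpec[OF P])
  obtain \<pi> where pi: "\<pi> \<in> ?p" "\<pi> \<noteq> 0"
    "\<And>c. c \<in> K \<Longrightarrow> c \<noteq> 0 \<Longrightarrow> \<exists>k. loc_unit ?p (c * \<pi> powi k)"
    using exists_uniformizer[OF p] by blast
  have pi': "\<pi> \<in> P" "\<pi> \<in> K" "\<pi> \<in> S" using pi(1) R_sub_K R_sub_S by (auto simp: below_def)
  have unram: "\<exists>k. c * \<pi> powi k \<noteq> 0 \<and> c * \<pi> powi k \<in> S.loc P \<and> 1 / (c * \<pi> powi k) \<in> S.loc P"
    if "c \<in> K" "c \<noteq> 0" for c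
    using pi(3)[OF that] loc_below[OF P] by (auto simp: loc_unit_def)
  interpret V: valuation_ring_over "S.loc P" K \<pi>
  proof (intro valuation_ring_over.intro valuation_ring_over_axioms.intro)
    show "subring_of_field (S.loc P)" by (rule A.subring_of_field_axioms)
    show "x \<in> S.loc P \<or> 1 / x \<in> S.loc P" if "x \<noteq> 0" for x by (rule loc_S_total[OF P that])
    show "\<pi> \<noteq> 0" by (rule pi(2))
    show "\<pi> \<in> S.loc P" using pi' S.loc_subring(2)[OF P] by blast
    show "1 / \<pi> \<notin> S.loc P" by (rule S.loc_nonunit[OF P pi'(1) pi(2)])
    show "\<pi> powi k \<in> K" for k by (rule K_powi[OF pi'(2)])
    show "\<exists>m. c * \<pi> powi m \<in> S.loc P \<and> 1 / (c * \<pi> powi m) \<in> S.loc P" if "c \<in> K" "c \<noteq> 0" for c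
      using unram[OF that] by blast
    show "\<exists>n>0. \<exists>m. x ^ n * \<pi> powi m \<in> S.loc P \<and> 1 / (x ^ n * \<pi> powi m) \<in> S.loc P"
      if x: "x \<noteq> 0" for x
    proof -
      obtain n c where nc: "n > 0" "c \<in> K" "c \<noteq> 0" "c * x ^ n \<in> S.loc P" "1 / (c * x ^ n) \<in> S.loc P"
        using loc_S_torsion[OF P x] by blast
      obtain k where k: "c * \<pi> powi k \<in> S.loc P" "1 / (c * \<pi> powi k) \<in> S.loc P"
        using unram[OF nc(2,3)] by blast
      have "c * x ^ n * (1 / (c * \<pi> powi k)) \<in> S.loc P" "1 / (c * x ^ n) * (c * \<pi> powi k) \<in> S.loc P"
        using nc k by (auto intro: A.mult_mem simp del: times_divide_eq_right times_divide_eq_left)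
      moreover have "c * x ^ n * (1 / (c * \<pi> powi k)) = x ^ n * \<pi> powi (- k)"
        "1 / (c * x ^ n) * (c * \<pi> powi k) = 1 / (x ^ n * \<pi> powi (- k))"
        using nc(3) pi(2) by (simp_all add: power_int_minus field_simps)
      ultimately show ?thesis using nc(1) by metis
    qed
  qed
  show ?thesis by (rule exI[of _ V.valuation]) (rule V.valuation_correct)
qed

abbreviation val_at :: "'a set \<Rightarrow> 'a \<Rightarrow> ereal"
  where "val_at P \<equiv> valuation_at K S P"

lemma val_at_unique:
  assumes P: "P \<in> mSpec S" and v: "rational_valuation v" "{x. 0 \<le> v x} = S.loc P"
    "v ` (K - {0}) = range (\<lambda>n::int. ereal (of_int n))"
  shows "val_at P = v"
  unfolding valuation_at_def S.loc_def[symmetric]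
proof (rule the_equality)
  fix u assume u: "rational_valuation u \<and> {x. 0 \<le> u x} = S.loc P \<and>
    u ` (K - {0}) = range (\<lambda>n::int. ereal (of_int n))"
  show "u = v"
    by (rule rational_valuation_unique[OF _ _ _ v K_divide]) (simp_all only: u simp_thms)
qed (simp only: v simp_thms)

lemma val_at_correct:
  assumes P: "P \<in> mSpec S"
  shows "rational_valuation (val_at P)" "{x. 0 \<le> val_at P x} = S.loc P"
    "val_at P ` (K - {0}) = range (\<lambda>n::int. ereal (of_int n))"
  using valuation_at_exists[OF P] val_at_unique[OF P] by metis+

text \<open>
  The default value of \<open>real_of_ereal\<close> at \<open>\<infinity>\<close> gives \<open>w P 0 = 0\<close>; hence the restriction to non-zero
  elements below.
\<close>
definition w :: "'a set \<Rightarrow> 'a \<Rightarrow> real"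
  where "w P x = real_of_ereal (val_at P x)"

context
  fixes P assumes P: "P \<in> mSpec S"
begin

lemmas w_rules = val_at_correct(1)[OF P]

lemma val_at_eq: "x \<noteq> 0 \<Longrightarrow> val_at P x = ereal (w P x)"
  unfolding w_def by (rule rv_ereal[OF w_rules])

lemma val_at_zero: "val_at P 0 = \<infinity>"
  using w_rules by (simp add: rational_valuation_def)

lemma w_mult: "x \<noteq> 0 \<Longrightarrow> y \<noteq> 0 \<Longrightarrow> w P (x * y) = w P x + w P y"
  unfolding w_def by (rule rv_mult[OF w_rules])

lemma w_divide: "x \<noteq> 0 \<Longrightarrow> y \<noteq> 0 \<Longrightarrow> w P (x / y) = w P x - w P y"
  unfolding w_def by (rule rv_divide[OF w_rules])

lemma w_power: "x \<noteq> 0 \<Longrightarrow> w P (x ^ n) = of_nat n * w P x"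
  unfolding w_def by (rule rv_power[OF w_rules])

lemma w_powi: "x \<noteq> 0 \<Longrightarrow> w P (x powi k) = of_int k * w P x"
  unfolding w_def by (rule rv_powi[OF w_rules])

lemma w_one: "w P 1 = 0"
  unfolding w_def by (rule rv_one[OF w_rules])

lemma w_add: "x \<noteq> 0 \<Longrightarrow> y \<noteq> 0 \<Longrightarrow> x + y \<noteq> 0 \<Longrightarrow> min (w P x) (w P y) \<le> w P (x + y)"
  unfolding w_def by (rule rv_add[OF w_rules])

lemma w_nonneg_iff: "x \<noteq> 0 \<Longrightarrow> 0 \<le> w P x \<longleftrightarrow> x \<in> S.loc P"
  unfolding val_at_correct(2)[OF P, symmetric] by (simp add: val_at_eq)

lemma w_nonneg: "x \<noteq> 0 \<Longrightarrow> x \<in> S \<Longrightarrow> 0 \<le> w P x"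
  using w_nonneg_iff S.loc_subring(2)[OF P] by blast

lemma w_pos_iff: "x \<noteq> 0 \<Longrightarrow> x \<in> S \<Longrightarrow> 0 < w P x \<longleftrightarrow> x \<in> P"
proof -
  assume x: "x \<noteq> 0" "x \<in> S"
  have "x \<notin> P \<longleftrightarrow> 1 / x \<in> S.loc P"
    using S.loc_nonunit[OF P _ x(1)] S.loc_inverse[OF P x(2)] by blast
  also have "\<dots> \<longleftrightarrow> 0 \<le> w P (1 / x)" using w_nonneg_iff x by simp
  also have "\<dots> \<longleftrightarrow> w P x \<le> 0" using w_divide[of 1 x] w_one x by simp
  finally show ?thesis by linarith
qed

lemma w_zero: "x \<in> S \<Longrightarrow> x \<notin> P \<Longrightarrow> w P x = 0"
proof -
  assume x: "x \<in> S" "x \<notin> P"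
  then have "x \<noteq> 0" using S.mSpecD(4)[OF P] by blast
  then show "w P x = 0" using w_nonneg[of x] w_pos_iff[of x] x by fastforce
qed

lemma w_K: "c \<in> K \<Longrightarrow> c \<noteq> 0 \<Longrightarrow> w P c \<in> \<int>"
proof -
  assume "c \<in> K" "c \<noteq> 0"
  then have "val_at P c \<in> range (\<lambda>n::int. ereal (of_int n))" using val_at_correct(3)[OF P] by blast
  then show "w P c \<in> \<int>" by (auto simp: w_def)
qed

lemma w_K_one: "\<exists>c\<in>K. c \<noteq> 0 \<and> w P c = 1"
proof -
  have "ereal (of_int 1) \<in> val_at P ` (K - {0})" unfolding val_at_correct(3)[OF P] by (rule rangeI)
  then obtain c where c: "ereal (of_int 1) = val_at P c" "c \<in> K - {0}" by (rule imageE)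
  then have "w P c = 1" by (simp add: w_def flip: c(1))
  then show ?thesis using c(2) by blast
qed

end

text \<open>
  A uniformizer \<open>\<pi>\<close> of \<open>p\<close> has the value \<open>1\<close> at every prime above \<open>p\<close>, since the values of \<open>K\<close> are
  the multiples of \<open>w P \<pi>\<close> on the one hand and all integers on the other.
\<close>
lemma w_K_below:
  assumes p: "p \<in> mSpec R" and c: "c \<in> K" "c \<noteq> 0"
  shows "\<exists>k. \<forall>P\<in>mSpec S. below P = p \<longrightarrow> w P c = k"
proof -
  obtain \<pi> where pi: "\<pi> \<in> p" "\<pi> \<noteq> 0"
    "\<And>c. c \<in> K \<Longrightarrow> c \<noteq> 0 \<Longrightarrow> \<exists>k. loc_unit p (c * \<pi> powi k)"
    using exists_uniformizer[OF p] by blast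
  obtain k where k: "loc_unit p (c * \<pi> powi k)" using pi(3)[OF c] by blast
  have "w P c = of_int (- k)" if P: "P \<in> mSpec S" and "below P = p" for P
  proof -
    have piP: "\<pi> \<in> P" "\<pi> \<in> S" "\<pi> \<in> K" using pi(1) that(2) R_sub_S R_sub_K by (auto simp: below_def)
    have unit: "w P d = 0" if "loc_unit p d" for d
    proof -
      have d: "d \<noteq> 0" "d \<in> S.loc P" "1 / d \<in> S.loc P"
        using that loc_below[OF P] \<open>below P = p\<close> by (auto simp: loc_unit_def)
      then have "0 \<le> w P d" "0 \<le> w P (1 / d)" using w_nonneg_iff[OF P] by auto
      then show ?thesis using w_divide[OF P, of 1 d] w_one[OF P] d(1) by simp
    qed
    have eq: "w P d = - of_int k * w P \<pi>" if "d \<noteq> 0" "loc_unit p (d * \<pi> powi k)" for d k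
      using unit[OF that(2)] w_mult[OF P, of d "\<pi> powi k"] w_powi[OF P pi(2)] that(1) pi(2) by simp
    obtain e where e: "e \<in> K" "e \<noteq> 0" "w P e = 1" using w_K_one[OF P] by blast
    obtain l where "loc_unit p (e * \<pi> powi l)" using pi(3)[OF e(1,2)] by blast
    then have l: "1 = - of_int l * w P \<pi>" using eq[OF e(2)] e(3) by simp
    have "w P \<pi> > 0" using w_pos_iff[OF P pi(2) piP(2)] piP(1) by simp
    moreover obtain m where m: "w P \<pi> = of_int m" using w_K[OF P piP(3) pi(2)] by (auto elim: Ints_cases)
    ultimately have "m > 0" by simp
    have "(1::int) = - l * m" using l unfolding m by (metis of_int_1 of_int_eq_iff of_int_minus of_int_mult)
    then have "m = 1" using \<open>m > 0\<close> by (metis mult.commute pos_zmult_eq_1_iff)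
    then show ?thesis using eq[OF c(2) k] m by simp
  qed
  then show ?thesis by blast
qed

end

section \<open>Automorphisms of a Galois extension\<close>

lemma Gal_iff:
  "\<sigma> \<in> carrier (Gal K) \<longleftrightarrow> bij \<sigma> \<and> (\<forall>x y. \<sigma> (x + y) = \<sigma> x + \<sigma> y) \<and>
    (\<forall>x y. \<sigma> (x * y) = \<sigma> x * \<sigma> y) \<and> \<sigma> 1 = 1 \<and> (\<forall>x\<in>K. \<sigma> x = x)"
  by (auto simp: Gal_def ring_iso_def Ring.ring_hom_def)

lemma GalD:
  assumes "\<sigma> \<in> carrier (Gal K)"
  shows "bij \<sigma>" "\<sigma> (x + y) = \<sigma> x + \<sigma> y" "\<sigma> (x * y) = \<sigma> x * \<sigma> y" "\<sigma> 1 = 1" "c \<in> K \<Longrightarrow> \<sigma> c = c"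
    "\<sigma> 0 = 0" "\<sigma> (- x) = - \<sigma> x" "\<sigma> (x - y) = \<sigma> x - \<sigma> y" "\<sigma> x = 0 \<longleftrightarrow> x = 0" "\<sigma> (x / y) = \<sigma> x / \<sigma> y"
    "\<sigma> (x ^ n) = \<sigma> x ^ n" "\<sigma> (sum f A) = (\<Sum>i\<in>A. \<sigma> (f i))" "\<sigma> (prod f A) = (\<Prod>i\<in>A. \<sigma> (f i))"
    "inj \<sigma>" "surj \<sigma>"
proof -
  note * = assms[unfolded Gal_iff]
  show bij: "bij \<sigma>" and add: "\<sigma> (x + y) = \<sigma> x + \<sigma> y" and mult: "\<sigma> (x * y) = \<sigma> x * \<sigma> y"
    and one: "\<sigma> 1 = 1" and "c \<in> K \<Longrightarrow> \<sigma> c = c" for x y c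
    using * by auto
  show inj: "inj \<sigma>" and "surj \<sigma>" using bij by (auto simp: bij_def)
  show zero: "\<sigma> 0 = 0" using add[of 0 0] by (metis add.right_neutral add_left_cancel)
  show neg: "\<sigma> (- x) = - \<sigma> x" for x using add[of x "- x"] zero by (simp add: eq_neg_iff_add_eq_0 add.commute)
  show "\<sigma> (x - y) = \<sigma> x - \<sigma> y" using add[of x "- y"] neg by simp
  show zero_iff: "\<sigma> x = 0 \<longleftrightarrow> x = 0" for x using inj zero by (metis injD)
  show "\<sigma> (x / y) = \<sigma> x / \<sigma> y"
    using mult[of "x / y" y] zero zero_iff[of y] by (cases "y = 0") (auto simp: field_simps)
  show "\<sigma> (x ^ n) = \<sigma> x ^ n" by (induction n) (auto simp: one mult)
  show "\<sigma> (sum f A) = (\<Sum>i\<in>A. \<sigma> (f i))" by (induction A rule: infinite_finite_induct) (auto simp: zero add)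
  show "\<sigma> (prod f A) = (\<Prod>i\<in>A. \<sigma> (f i))" by (induction A rule: infinite_finite_induct) (auto simp: one mult)
qed

lemma Gal_mult [simp]: "\<sigma> \<otimes>\<^bsub>Gal K\<^esub> \<tau> = \<sigma> \<circ> \<tau>"
  by (simp add: Gal_def)

lemma Gal_one [simp]: "\<one>\<^bsub>Gal K\<^esub> = id"
  by (simp add: Gal_def)

lemma Gal_comp: "\<sigma> \<in> carrier (Gal K) \<Longrightarrow> \<tau> \<in> carrier (Gal K) \<Longrightarrow> \<sigma> \<circ> \<tau> \<in> carrier (Gal K)"
  unfolding Gal_iff by (auto intro: bij_comp)

lemma Gal_id: "id \<in> carrier (Gal K)"
  unfolding Gal_iff by auto

lemma Gal_inverse:
  assumes "\<sigma> \<in> carrier (Gal K)"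
  shows "Hilbert_Choice.inv \<sigma> \<in> carrier (Gal K)"
proof -
  note s = GalD[OF assms]
  have f: "\<sigma> (Hilbert_Choice.inv \<sigma> x) = x" for x using s(15) by (simp add: surj_f_inv_f)
  have g: "Hilbert_Choice.inv \<sigma> (\<sigma> x) = x" for x using s(14) by (simp add: inv_f_f)
  have "Hilbert_Choice.inv \<sigma> x = y \<longleftrightarrow> x = \<sigma> y" for x y using f g by metis
  then show ?thesis
    unfolding Gal_iff using s f g bij_imp_bij_inv[OF s(1)] by auto
qed

lemma Gal_group: "group (Gal K)"
proof (rule groupI)
  fix \<sigma> assume s: "\<sigma> \<in> carrier (Gal K)"
  have "Hilbert_Choice.inv \<sigma> \<otimes>\<^bsub>Gal K\<^esub> \<sigma> = \<one>\<^bsub>Gal K\<^esub>"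
    using GalD(14)[OF s] by simp
  then show "\<exists>\<tau>\<in>carrier (Gal K). \<tau> \<otimes>\<^bsub>Gal K\<^esub> \<sigma> = \<one>\<^bsub>Gal K\<^esub>" using Gal_inverse[OF s] by blast
qed (auto intro: Gal_comp Gal_id simp: comp_assoc simp del: id_apply)

lemma Gal_inv [simp]: "\<sigma> \<in> carrier (Gal K) \<Longrightarrow> inv\<^bsub>Gal K\<^esub> \<sigma> = Hilbert_Choice.inv \<sigma>"
  by (rule group.inv_equality[OF Gal_group]) (simp_all add: Gal_inverse GalD(14))

lemma Gal_poly:
  assumes "\<sigma> \<in> carrier (Gal K)" "p \<in> polys_over K"
  shows "\<sigma> (Polynomial.poly p x) = Polynomial.poly p (\<sigma> x)"
  using assms(2) by (simp add: poly_altdef GalD[OF assms(1)] polys_over_def)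

lemma dvd_split_has_root:
  fixes m :: "'l::field Polynomial.poly"
  assumes "m dvd Polynomial.smult c (\<Prod>r\<leftarrow>rs. [:- r, 1:])" "c \<noteq> 0" "Polynomial.degree m > 0"
  shows "\<exists>r\<in>set rs. Polynomial.poly m r = 0"
  using assms(1)
proof (induction rs)
  case Nil
  then have "m dvd [:c:]" by simp
  then have "Polynomial.degree m \<le> 0" using dvd_imp_degree_le[of m "[:c:]"] assms(2) by simp
  then show ?case using assms(3) by simp
next
  case (Cons r rs)
  let ?Q = "Polynomial.smult c (\<Prod>r\<leftarrow>rs. [:- r, 1:])"
  show ?case
  proof (cases "Polynomial.poly m r = 0")
    case False
    have "m dvd [:- r, 1:] * ?Q" using Cons.prems by (simp add: mult_smult_right del: mult_pCons_left)
    then obtain k where k: "[:- r, 1:] * ?Q = m * k" by (elim dvdE)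
    have "Polynomial.poly (m * k) r = 0" unfolding k[symmetric] by simp
    then have "[:- r, 1:] dvd k" using False by (simp add: poly_eq_0_iff_dvd)
    then obtain k' where "k = [:- r, 1:] * k'" by (elim dvdE)
    then have "[:- r, 1:] * ?Q = [:- r, 1:] * (m * k')" unfolding k by (simp only: mult.left_commute)
    then have "?Q = m * k'" by (metis mult_left_cancel pCons_eq_0_iff zero_neq_one)
    then show ?thesis using Cons.IH by auto
  qed auto
qed

locale algebraic_subfield = subring_of_field K for K :: "'l::field set" +
  assumes divide_mem: "x \<in> K \<Longrightarrow> y \<in> K \<Longrightarrow> x / y \<in> K"
    and algebraic: "algebraic_extension K"
begin

lemma algebraic_poly:
  obtains q where "q \<in> polys_over K" "q \<noteq> 0" "Polynomial.poly q x = 0"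
  using algebraic unfolding algebraic_extension_def by blast

text \<open>
  Graphs of \<open>K\<close>-homomorphisms from intermediate rings to the whole field: the last condition makes
  the relation single-valued. As sets of pairs, partial homomorphisms are ordered by inclusion,
  and their domains need not be named.
\<close>
definition hom_graph :: "('l \<times> 'l) set \<Rightarrow> bool"
  where "hom_graph \<Gamma> \<longleftrightarrow> (\<forall>c\<in>K. (c, c) \<in> \<Gamma>) \<and>
    (\<forall>a b c d. (a, b) \<in> \<Gamma> \<longrightarrow> (c, d) \<in> \<Gamma> \<longrightarrow> (a - c, b - d) \<in> \<Gamma> \<and> (a * c, b * d) \<in> \<Gamma>) \<and>
    (\<forall>b. (0, b) \<in> \<Gamma> \<longrightarrow> b = 0)"

definition poly_rel :: "('l \<times> 'l) set \<Rightarrow> 'l Polynomial.poly \<Rightarrow> 'l Polynomial.poly \<Rightarrow> bool"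
  where "poly_rel \<Gamma> p q \<longleftrightarrow> (\<forall>i. (Polynomial.coeff p i, Polynomial.coeff q i) \<in> \<Gamma>)"

context
  fixes \<Gamma> assumes \<Gamma>: "hom_graph \<Gamma>"
begin

lemma graph_base: "c \<in> K \<Longrightarrow> (c, c) \<in> \<Gamma>"
  using \<Gamma> by (simp add: hom_graph_def)

lemma graph_diff: "(a, b) \<in> \<Gamma> \<Longrightarrow> (c, d) \<in> \<Gamma> \<Longrightarrow> (a - c, b - d) \<in> \<Gamma>"
  using \<Gamma> by (simp add: hom_graph_def)

lemma graph_mult: "(a, b) \<in> \<Gamma> \<Longrightarrow> (c, d) \<in> \<Gamma> \<Longrightarrow> (a * c, b * d) \<in> \<Gamma>"
  using \<Gamma> by (simp add: hom_graph_def)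

lemma graph_zero: "(0, b) \<in> \<Gamma> \<Longrightarrow> b = 0"
  using \<Gamma> by (simp add: hom_graph_def)

lemma graph_uminus: "(a, b) \<in> \<Gamma> \<Longrightarrow> (- a, - b) \<in> \<Gamma>"
  using graph_diff[OF graph_base[OF zero_mem]] by force

lemma graph_add: "(a, b) \<in> \<Gamma> \<Longrightarrow> (c, d) \<in> \<Gamma> \<Longrightarrow> (a + c, b + d) \<in> \<Gamma>"
  using graph_diff[of a b "- c" "- d"] graph_uminus[of c d] by simp

lemma graph_sum: "(\<And>i. i \<in> A \<Longrightarrow> (f i, g i) \<in> \<Gamma>) \<Longrightarrow> (sum f A, sum g A) \<in> \<Gamma>"
  by (induction A rule: infinite_finite_induct) (auto intro: graph_add graph_base)

lemma graph_power: "(a, b) \<in> \<Gamma> \<Longrightarrow> (a ^ n, b ^ n) \<in> \<Gamma>"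
  by (induction n) (auto intro: graph_mult graph_base)

lemma graph_unique: "(a, b) \<in> \<Gamma> \<Longrightarrow> (a, c) \<in> \<Gamma> \<Longrightarrow> b = c"
  using graph_diff[of a b a c] graph_zero by force

lemma graph_poly: "p \<in> polys_over K \<Longrightarrow> (a, b) \<in> \<Gamma> \<Longrightarrow> (Polynomial.poly p a, Polynomial.poly p b) \<in> \<Gamma>"
  unfolding poly_altdef
  by (intro graph_sum graph_mult graph_power graph_base) (auto simp: polys_over_def)

text \<open>
  The domain of \<open>\<Gamma>\<close> is a field, since an algebraic element has its inverse in the ring that it
  generates.
\<close>
lemma graph_inverse:
  assumes ab: "(a, b) \<in> \<Gamma>" and a: "a \<noteq> 0"
  shows "(1 / a, 1 / b) \<in> \<Gamma>"
proof -
  have ex: "\<exists>q\<in>polys_over K. Polynomial.coeff q 0 \<noteq> 0 \<and> Polynomial.poly q a = 0"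
    if "q \<in> polys_over K" "q \<noteq> 0" "Polynomial.poly q a = 0" for q
    using that
  proof (induction q rule: pCons_induct)
    case (pCons c q)
    show ?case
    proof (cases "c = 0")
      case True
      have "Polynomial.coeff q i \<in> K" for i
        using pCons.prems(1) unfolding polys_over_def by (metis coeff_pCons_Suc mem_Collect_eq)
      then have "q \<in> polys_over K" by (simp add: polys_over_def)
      moreover have "q \<noteq> 0" "Polynomial.poly q a = 0" using True pCons.prems a by auto
      ultimately show ?thesis by (rule pCons.IH)
    qed (use pCons.prems in \<open>intro bexI[of _ "pCons c q"]; simp\<close>)
  qed simp
  obtain q0 where "q0 \<in> polys_over K" "q0 \<noteq> 0" "Polynomial.poly q0 a = 0" by (rule algebraic_poly)
  from ex[OF this] obtain q where q: "q \<in> polys_over K" "Polynomial.coeff q 0 \<noteq> 0" "Polynomial.poly q a = 0"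
    by blast
  obtain c p where cp: "q = pCons c p" by (cases q)
  have "Polynomial.coeff p i \<in> K" for i
    using q(1) unfolding polys_over_def cp by (metis coeff_pCons_Suc mem_Collect_eq)
  then have p: "p \<in> polys_over K" by (simp add: polys_over_def)
  have c: "c \<noteq> 0" "c \<in> K" using q cp by (auto simp: polys_over_def dest: spec[of _ 0])
  have "c + a * Polynomial.poly p a = 0" using q cp by simp
  then have inv: "1 / a = (- 1 / c) * Polynomial.poly p a"
    using a c by (simp add: field_simps add_eq_0_iff)
  have "- 1 / c \<in> K" using c by (intro divide_mem uminus_mem) auto
  then have e: "(1 / a, (- 1 / c) * Polynomial.poly p b) \<in> \<Gamma>"
    unfolding inv by (intro graph_mult graph_base graph_poly p ab)
  have "(1 / a * a, ((- 1 / c) * Polynomial.poly p b) * b) \<in> \<Gamma>" by (rule graph_mult[OF e ab])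
  then have "(1, ((- 1 / c) * Polynomial.poly p b) * b) \<in> \<Gamma>" using a by simp
  then have "((- 1 / c) * Polynomial.poly p b) * b = 1" using graph_unique graph_base[OF one_mem] by blast
  then have "b \<noteq> 0" "(- 1 / c) * Polynomial.poly p b = 1 / b" by (auto simp: eq_divide_eq)
  then show ?thesis using e by simp
qed

lemma poly_rel_unique: "poly_rel \<Gamma> p q \<Longrightarrow> poly_rel \<Gamma> p q' \<Longrightarrow> q = q'"
  unfolding poly_rel_def by (intro poly_eqI) (metis graph_unique)

lemma poly_rel_base: "p \<in> polys_over K \<Longrightarrow> poly_rel \<Gamma> p p"
  by (simp add: poly_rel_def polys_over_def graph_base)

lemma poly_rel_diff: "poly_rel \<Gamma> p q \<Longrightarrow> poly_rel \<Gamma> p' q' \<Longrightarrow> poly_rel \<Gamma> (p - p') (q - q')"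
  by (simp add: poly_rel_def graph_diff)

lemma poly_rel_add: "poly_rel \<Gamma> p q \<Longrightarrow> poly_rel \<Gamma> p' q' \<Longrightarrow> poly_rel \<Gamma> (p + p') (q + q')"
  by (simp add: poly_rel_def graph_add)

lemma poly_rel_mult: "poly_rel \<Gamma> p q \<Longrightarrow> poly_rel \<Gamma> p' q' \<Longrightarrow> poly_rel \<Gamma> (p * p') (q * q')"
  unfolding poly_rel_def coeff_mult by (intro allI graph_sum graph_mult) auto

lemma poly_rel_monom: "(a, b) \<in> \<Gamma> \<Longrightarrow> poly_rel \<Gamma> (Polynomial.monom a n) (Polynomial.monom b n)"
  using graph_base[OF zero_mem] by (simp add: poly_rel_def)

lemma poly_rel_degree:
  assumes "poly_rel \<Gamma> m m'" "Polynomial.lead_coeff m = 1"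
  shows "Polynomial.degree m' = Polynomial.degree m" "Polynomial.lead_coeff m' = 1"
proof -
  have *: "Polynomial.coeff m' i = 0" if "i > Polynomial.degree m" for i
    using assms(1) graph_zero coeff_eq_0[OF that] unfolding poly_rel_def by metis
  have **: "Polynomial.coeff m' (Polynomial.degree m) = 1"
    using assms graph_unique graph_base[OF one_mem] unfolding poly_rel_def by metis
  show "Polynomial.degree m' = Polynomial.degree m"
    by (rule antisym[OF degree_le le_degree]) (auto simp: * **)
  then show "Polynomial.lead_coeff m' = 1" using ** by simp
qed

text \<open>
  Division of \<open>p\<close> by the monic \<open>m\<close> only uses ring operations on coefficients, so that it runs in
  parallel for the images under the homomorphism.
\<close>
lemma poly_rel_division:
  assumes m: "poly_rel \<Gamma> m m'" "Polynomial.lead_coeff m = 1"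
  shows "poly_rel \<Gamma> p p' \<Longrightarrow> \<exists>h h' r r'. poly_rel \<Gamma> h h' \<and> poly_rel \<Gamma> r r' \<and> p = m * h + r \<and> p' = m' * h' + r' \<and>
    (r = 0 \<or> Polynomial.degree r < Polynomial.degree m)"
proof (induction "Polynomial.degree p" arbitrary: p p' rule: less_induct)
  case less
  have zero: "poly_rel \<Gamma> 0 0" using graph_base[OF zero_mem] by (simp add: poly_rel_def)
  show ?case
  proof (cases "p = 0 \<or> Polynomial.degree p < Polynomial.degree m")
    case True
    then show ?thesis using less.prems zero by (intro exI[of _ 0] exI[of _ p] exI[of _ p'] exI[of _ p]) auto
  next
    case False
    let ?n = "Polynomial.degree p - Polynomial.degree m"
    define t where "t = Polynomial.monom (Polynomial.lead_coeff p) ?n"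
    define t' where "t' = Polynomial.monom (Polynomial.coeff p' (Polynomial.degree p)) ?n"
    have t: "poly_rel \<Gamma> t t'"
      unfolding t_def t'_def using less.prems by (intro poly_rel_monom) (simp add: poly_rel_def)
    have rel: "poly_rel \<Gamma> (p - m * t) (p' - m' * t')"
      by (intro poly_rel_diff poly_rel_mult less.prems t m)
    have m0: "m \<noteq> 0" using m(2) by auto
    have t0: "t \<noteq> 0" "Polynomial.degree t = ?n" "Polynomial.lead_coeff t = Polynomial.lead_coeff p"
      using False by (auto simp: t_def degree_monom_eq)
    have deg: "Polynomial.degree (m * t) = Polynomial.degree p"
      using False m0 t0 by (simp add: degree_mult_eq)
    have lead: "Polynomial.coeff (m * t) (Polynomial.degree p) = Polynomial.lead_coeff p"
      using lead_coeff_mult[of m t] deg t0 m(2) by simp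
    show ?thesis
    proof (cases "p - m * t = 0")
      case True
      then have "p' - m' * t' = 0" using rel zero poly_rel_unique by metis
      then show ?thesis using True t zero
        by (intro exI[of _ t] exI[of _ t'] exI[of _ 0]) auto
    next
      case nz: False
      have "Polynomial.degree (p - m * t) \<le> Polynomial.degree p"
        using deg by (intro degree_diff_le) auto
      moreover have "Polynomial.degree (p - m * t) \<noteq> Polynomial.degree p"
        using nz lead by (metis coeff_diff eq_iff_diff_eq_0 leading_coeff_0_iff)
      ultimately have "Polynomial.degree (p - m * t) < Polynomial.degree p" by simp
      from less.hyps[OF this rel]
      obtain h h' r r' where *: "poly_rel \<Gamma> h h'" "poly_rel \<Gamma> r r'" "p - m * t = m * h + r"
        "p' - m' * t' = m' * h' + r'" "r = 0 \<or> Polynomial.degree r < Polynomial.degree m" by metis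
      have "p = m * (h + t) + r" "p' = m' * (h' + t') + r'"
        using *(3,4) by (simp_all add: algebra_simps)
      then show ?thesis using *(1,2,5) poly_rel_add[OF *(1) t] by blast
    qed
  qed
qed

text \<open>
  The extension sends \<open>p x\<close> to the image of \<open>p\<close> at \<open>x'\<close>; it is well defined because the remainder
  of division by \<open>m\<close> vanishes.
\<close>
lemma hom_graph_adjoin:
  assumes m: "poly_rel \<Gamma> m m'" "Polynomial.lead_coeff m = 1" "Polynomial.poly m' x' = 0"
    and min: "\<And>p q. poly_rel \<Gamma> p q \<Longrightarrow> Polynomial.poly p x = 0 \<Longrightarrow> Polynomial.degree p < Polynomial.degree m \<Longrightarrow> p = 0"
    and mx: "Polynomial.poly m x = 0"
  shows "\<exists>\<Delta>. hom_graph \<Delta> \<and> \<Gamma> \<subseteq> \<Delta> \<and> (x, x') \<in> \<Delta>"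
proof -
  define \<Delta> where "\<Delta> = {(Polynomial.poly p x, Polynomial.poly q x') | p q. poly_rel \<Gamma> p q}"
  have sub: "\<Gamma> \<subseteq> \<Delta>"
  proof
    fix ab assume ab: "ab \<in> \<Gamma>"
    obtain a b where [simp]: "ab = (a, b)" by force
    have "poly_rel \<Gamma> (Polynomial.monom a 0) (Polynomial.monom b 0)" using ab by (intro poly_rel_monom) simp
    moreover have "ab = (Polynomial.poly (Polynomial.monom a 0) x, Polynomial.poly (Polynomial.monom b 0) x')"
      by (simp add: poly_monom)
    ultimately show "ab \<in> \<Delta>" unfolding \<Delta>_def by blast
  qed
  have "poly_rel \<Gamma> (Polynomial.monom 1 1) (Polynomial.monom 1 1)" by (intro poly_rel_monom graph_base one_mem)
  moreover have "(x, x') = (Polynomial.poly (Polynomial.monom 1 1) x, Polynomial.poly (Polynomial.monom 1 1) x')"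
    by (simp add: poly_monom)
  ultimately have x: "(x, x') \<in> \<Delta>" unfolding \<Delta>_def by blast
  have "hom_graph \<Delta>"
    unfolding hom_graph_def
  proof (intro conjI ballI allI impI)
    show "(c, c) \<in> \<Delta>" if "c \<in> K" for c using graph_base[OF that] sub by blast
    fix a b c d assume "(a, b) \<in> \<Delta>" "(c, d) \<in> \<Delta>"
    then obtain p q p' q' where *: "poly_rel \<Gamma> p q" "a = Polynomial.poly p x" "b = Polynomial.poly q x'"
      "poly_rel \<Gamma> p' q'" "c = Polynomial.poly p' x" "d = Polynomial.poly q' x'"
      by (auto simp: \<Delta>_def)
    have "(a - c, b - d) = (Polynomial.poly (p - p') x, Polynomial.poly (q - q') x')"
      "(a * c, b * d) = (Polynomial.poly (p * p') x, Polynomial.poly (q * q') x')"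
      using * by simp_all
    then show "(a - c, b - d) \<in> \<Delta>" "(a * c, b * d) \<in> \<Delta>"
      unfolding \<Delta>_def using poly_rel_diff[OF *(1,4)] poly_rel_mult[OF *(1,4)] by blast+
  next
    fix b assume "(0, b) \<in> \<Delta>"
    then obtain p q where pq: "poly_rel \<Gamma> p q" "Polynomial.poly p x = 0" "b = Polynomial.poly q x'"
      by (auto simp: \<Delta>_def)
    obtain h h' r r' where *: "poly_rel \<Gamma> h h'" "poly_rel \<Gamma> r r'" "p = m * h + r"
        "q = m' * h' + r'" "r = 0 \<or> Polynomial.degree r < Polynomial.degree m"
      using poly_rel_division[OF m(1,2) pq(1)] by metis
    have "Polynomial.poly r x = 0" using pq(2) mx *(3) by simp
    then have r: "r = 0" using min[OF *(2)] *(5) by blast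
    have "poly_rel \<Gamma> 0 0" using graph_base[OF zero_mem] by (simp add: poly_rel_def)
    then have "r' = 0" using *(2) poly_rel_unique unfolding r by blast
    then show "b = 0" using pq(3) *(4) m(3) by simp
  qed
  then show ?thesis using sub x by blast
qed

lemma minimal_polynomial:
  obtains m m' where "poly_rel \<Gamma> m m'" "Polynomial.lead_coeff m = 1" "Polynomial.poly m x = 0"
    "Polynomial.degree m > 0"
    "\<And>p q. poly_rel \<Gamma> p q \<Longrightarrow> Polynomial.poly p x = 0 \<Longrightarrow> Polynomial.degree p < Polynomial.degree m \<Longrightarrow> p = 0"
proof -
  define Q where "Q p \<longleftrightarrow> p \<noteq> 0 \<and> Polynomial.poly p x = 0 \<and> (\<exists>q. poly_rel \<Gamma> p q)" for p
  obtain q0 where "q0 \<in> polys_over K" "q0 \<noteq> 0" "Polynomial.poly q0 x = 0" by (rule algebraic_poly)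
  then have "Q q0" using poly_rel_base by (auto simp: Q_def)
  define p where "p = arg_min Polynomial.degree Q"
  have p: "Q p" "\<And>r. Q r \<Longrightarrow> Polynomial.degree p \<le> Polynomial.degree r"
    using arg_min_nat_lemma[of Q q0 Polynomial.degree, OF \<open>Q q0\<close>] by (auto simp: p_def)
  obtain q where q: "poly_rel \<Gamma> p q" using p(1) by (auto simp: Q_def)
  let ?c = "Polynomial.lead_coeff p"
  have c: "?c \<noteq> 0" using p(1) by (simp add: Q_def)
  have "(?c, Polynomial.coeff q (Polynomial.degree p)) \<in> \<Gamma>" using q by (simp add: poly_rel_def)
  from graph_inverse[OF this c]
  obtain d where d: "(1 / ?c, d) \<in> \<Gamma>" by blast
  have rel: "poly_rel \<Gamma> (Polynomial.monom (1 / ?c) 0 * p) (Polynomial.monom d 0 * q)"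
    by (intro poly_rel_mult poly_rel_monom d q)
  define m where "m = Polynomial.smult (1 / ?c) p"
  have m: "Polynomial.monom (1 / ?c) 0 * p = m" by (simp add: m_def monom_0)
  have deg: "Polynomial.degree m = Polynomial.degree p" using c by (simp add: m_def)
  show thesis
  proof (rule that)
    show "poly_rel \<Gamma> m (Polynomial.monom d 0 * q)" using rel m by simp
    show "Polynomial.lead_coeff m = 1" using c by (simp add: m_def)
    show mx: "Polynomial.poly m x = 0" using p(1) by (simp add: m_def Q_def)
    show "Polynomial.degree m > 0"
    proof (rule ccontr)
      assume "\<not> Polynomial.degree m > 0"
      then obtain e where "m = [:e:]" by (metis degree_eq_zeroE neq0_conv)
      then show False using mx \<open>Polynomial.lead_coeff m = 1\<close> by simp
    qed
    show "r = 0" if "poly_rel \<Gamma> r s" "Polynomial.poly r x = 0" "Polynomial.degree r < Polynomial.degree m" for r s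
      using p(2)[of r] that deg by (force simp: Q_def)
  qed
qed

end

lemma hom_graph_Id: "hom_graph (Id_on K)"
  by (auto simp: hom_graph_def intro: closed)

lemma poly_rel_Id: "poly_rel (Id_on K) p q \<longleftrightarrow> p \<in> polys_over K \<and> q = p"
  by (auto simp: poly_rel_def polys_over_def Id_on_iff poly_eq_iff)

lemma minimal_polynomial_K:
  obtains m where "m \<in> polys_over K" "Polynomial.lead_coeff m = 1" "Polynomial.poly m x = 0"
    "Polynomial.degree m > 0" "irreducible_over K m"
    "\<And>p. p \<in> polys_over K \<Longrightarrow> Polynomial.poly p x = 0 \<Longrightarrow> Polynomial.degree p < Polynomial.degree m \<Longrightarrow> p = 0"
proof -
  obtain m where m: "m \<in> polys_over K" "Polynomial.lead_coeff m = 1" "Polynomial.poly m x = 0"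
    "Polynomial.degree m > 0"
    "\<And>p. p \<in> polys_over K \<Longrightarrow> Polynomial.poly p x = 0 \<Longrightarrow> Polynomial.degree p < Polynomial.degree m \<Longrightarrow> p = 0"
    using minimal_polynomial[OF hom_graph_Id, of x] unfolding poly_rel_Id by metis
  have "irreducible_over K m"
    unfolding irreducible_over_def
  proof (intro conjI ballI impI m(1,4))
    fix q r assume qr: "q \<in> polys_over K" "r \<in> polys_over K" "m = q * r"
    then have nz: "q \<noteq> 0" "r \<noteq> 0" using m(4) by auto
    then have deg: "Polynomial.degree m = Polynomial.degree q + Polynomial.degree r"
      using qr(3) by (simp add: degree_mult_eq)
    have "Polynomial.poly q x = 0 \<or> Polynomial.poly r x = 0" using m(3) qr(3) by simp
    then show "Polynomial.degree q = 0 \<or> Polynomial.degree r = 0"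
      using m(5)[OF qr(1)] m(5)[OF qr(2)] nz deg by (metis add_gr_0 less_add_same_cancel1 less_add_same_cancel2 not_gr_zero)
  qed
  then show thesis using that m by metis
qed

text \<open>
  The roots of a polynomial over \<open>K\<close>: this finiteness is behind the compactness of the Galois
  group.
\<close>
lemma finite_conjugates:
  obtains F where "finite F" "x \<in> F" "\<And>\<sigma>. \<sigma> \<in> carrier (Gal K) \<Longrightarrow> \<sigma> ` F \<subseteq> F"
proof -
  obtain q where q: "q \<in> polys_over K" "q \<noteq> 0" "Polynomial.poly q x = 0" by (rule algebraic_poly)
  have "\<sigma> ` {y. Polynomial.poly q y = 0} \<subseteq> {y. Polynomial.poly q y = 0}" if "\<sigma> \<in> carrier (Gal K)" for \<sigma>
    by (auto simp: Gal_poly[OF that q(1), symmetric] GalD(6)[OF that])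
  then show thesis using that[of "{y. Polynomial.poly q y = 0}"] poly_roots_finite[OF q(2)] q(3) by blast
qed

end

locale galois_subfield = algebraic_subfield +
  assumes galois: "galois_extension K"
begin

text \<open>
  The minimal polynomial \<open>m\<close> of \<open>x\<close> over the domain of \<open>\<Gamma>\<close> divides the one over \<open>K\<close>, which is
  fixed by the homomorphism; hence the image \<open>m'\<close> of \<open>m\<close> divides it too. By normality it splits,
  and so \<open>m'\<close> has a root, to which \<open>x\<close> can be sent.
\<close>
lemma hom_graph_step:
  assumes \<Gamma>: "hom_graph \<Gamma>"
  shows "\<exists>\<Delta>. hom_graph \<Delta> \<and> \<Gamma> \<subseteq> \<Delta> \<and> x \<in> fst ` \<Delta>"
proof -
  obtain m m' where m: "poly_rel \<Gamma> m m'" "Polynomial.lead_coeff m = 1" "Polynomial.poly m x = 0"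
    "Polynomial.degree m > 0"
    "\<And>p q. poly_rel \<Gamma> p q \<Longrightarrow> Polynomial.poly p x = 0 \<Longrightarrow> Polynomial.degree p < Polynomial.degree m \<Longrightarrow> p = 0"
    using minimal_polynomial[OF \<Gamma>, of x] by (metis (no_types, lifting))
  obtain n where n: "n \<in> polys_over K" "Polynomial.lead_coeff n = 1" "Polynomial.poly n x = 0"
    "irreducible_over K n"
    using minimal_polynomial_K[of x] by (metis (no_types, lifting))
  obtain c rs where split: "n = Polynomial.smult c (\<Prod>r\<leftarrow>rs. [:- r, 1:])"
    using galois n(3,4) unfolding galois_extension_def normal_extension_def by metis
  have "c \<noteq> 0" using n(2) split by auto
  obtain h h' r r' where *: "poly_rel \<Gamma> h h'" "poly_rel \<Gamma> r r'" "n = m * h + r"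
      "n = m' * h' + r'" "r = 0 \<or> Polynomial.degree r < Polynomial.degree m"
    using poly_rel_division[OF \<Gamma> m(1,2) poly_rel_base[OF \<Gamma> n(1)]] by metis
  have "Polynomial.poly r x = 0" using n(3) m(3) *(3) by simp
  then have r: "r = 0" using m(5)[OF *(2)] *(5) by blast
  have "poly_rel \<Gamma> 0 0" using graph_base[OF \<Gamma> zero_mem] by (simp add: poly_rel_def)
  then have "r' = 0" using *(2) poly_rel_unique[OF \<Gamma>] unfolding r by blast
  then have "m' dvd Polynomial.smult c (\<Prod>r\<leftarrow>rs. [:- r, 1:])" using *(4) split by (metis add.right_neutral dvd_triv_left)
  then obtain x' where "Polynomial.poly m' x' = 0"
    using dvd_split_has_root[OF _ \<open>c \<noteq> 0\<close>] m(4) poly_rel_degree(1)[OF \<Gamma> m(1,2)] by metis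
  from hom_graph_adjoin[OF \<Gamma> m(1,2) this m(5) m(3)] show ?thesis by force
qed

text \<open>
  By Zorn's lemma and \<open>hom_graph_step\<close> there is an extension to the whole field. It is surjective
  because it permutes the finitely many roots of each polynomial over \<open>K\<close>.
\<close>
lemma extend_to_automorphism:
  assumes \<Gamma>: "hom_graph \<Gamma>"
  obtains \<sigma> where "\<sigma> \<in> carrier (Gal K)" "\<And>a b. (a, b) \<in> \<Gamma> \<Longrightarrow> \<sigma> a = b"
proof -
  define \<A> where "\<A> = {\<Delta>. hom_graph \<Delta> \<and> \<Gamma> \<subseteq> \<Delta>}"
  have "\<exists>M\<in>\<A>. \<forall>\<Delta>\<in>\<A>. M \<subseteq> \<Delta> \<longrightarrow> \<Delta> = M"
  proof (rule subset_Zorn_nonempty)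
    show "\<A> \<noteq> {}" using \<Gamma> by (auto simp: \<A>_def)
    fix C assume C: "C \<noteq> {}" "subset.chain \<A> C"
    have CA: "\<And>\<Delta>. \<Delta> \<in> C \<Longrightarrow> hom_graph \<Delta>" "\<And>\<Delta>. \<Delta> \<in> C \<Longrightarrow> \<Gamma> \<subseteq> \<Delta>"
      and lin: "\<And>U V. U \<in> C \<Longrightarrow> V \<in> C \<Longrightarrow> U \<subseteq> V \<or> V \<subseteq> U"
      using C(2) by (auto simp: subset_chain_def \<A>_def)
    obtain \<Delta>0 where d0: "\<Delta>0 \<in> C" using C(1) by blast
    have "hom_graph (\<Union>C)"
      unfolding hom_graph_def
    proof (intro conjI ballI allI impI)
      show "(c, c) \<in> \<Union>C" if "c \<in> K" for c using graph_base[OF CA(1)[OF d0] that] d0 by blast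
      show "b = 0" if "(0, b) \<in> \<Union>C" for b using that graph_zero CA(1) by blast
      fix a b c d assume "(a, b) \<in> \<Union>C" "(c, d) \<in> \<Union>C"
      then obtain U V where "U \<in> C" "V \<in> C" "(a, b) \<in> U" "(c, d) \<in> V" by blast
      then obtain W where W: "W \<in> C" "(a, b) \<in> W" "(c, d) \<in> W" using lin by blast
      then show "(a - c, b - d) \<in> \<Union>C" "(a * c, b * d) \<in> \<Union>C"
        using graph_diff[OF CA(1)[OF W(1)] W(2,3)] graph_mult[OF CA(1)[OF W(1)] W(2,3)] by blast+
    qed
    moreover have "\<Gamma> \<subseteq> \<Union>C" using CA(2)[OF d0] d0 by blast
    ultimately show "\<Union>C \<in> \<A>" by (simp add: \<A>_def)
  qed
  then obtain M where M: "hom_graph M" "\<Gamma> \<subseteq> M" and max: "\<And>\<Delta>. hom_graph \<Delta> \<Longrightarrow> M \<subseteq> \<Delta> \<Longrightarrow> \<Delta> = M"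
    unfolding \<A>_def by (metis (mono_tags, lifting) mem_Collect_eq order_trans)
  have "\<exists>y. (x, y) \<in> M" for x
  proof -
    obtain \<Delta> where "hom_graph \<Delta>" "M \<subseteq> \<Delta>" "x \<in> fst ` \<Delta>" using hom_graph_step[OF M(1)] by metis
    then show ?thesis using max by force
  qed
  then obtain \<sigma> where s: "\<And>x. (x, \<sigma> x) \<in> M" by metis
  have eq: "\<sigma> a = b" if "(a, b) \<in> M" for a b using graph_unique[OF M(1)] s that by blast
  have hom: "\<sigma> (x + y) = \<sigma> x + \<sigma> y" "\<sigma> (x * y) = \<sigma> x * \<sigma> y" "\<sigma> (x - y) = \<sigma> x - \<sigma> y" for x y
    using graph_add[OF M(1) s s] graph_mult[OF M(1) s s] graph_diff[OF M(1) s s] eq by blast+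
  have fix_K: "\<sigma> c = c" if "c \<in> K" for c using graph_base[OF M(1) that] eq by blast
  have inj: "inj \<sigma>"
  proof (rule injI, rule ccontr)
    fix x y assume xy: "\<sigma> x = \<sigma> y" "x \<noteq> y"
    have "\<sigma> (1 / (x - y)) * \<sigma> (x - y) = \<sigma> (1 / (x - y) * (x - y))" by (simp only: hom(2))
    also have "\<dots> = 1" using xy(2) fix_K[OF one_mem] by simp
    finally show False using xy(1) hom(3) by simp
  qed
  have "\<exists>x. \<sigma> x = y" for y
  proof -
    obtain q where q: "q \<in> polys_over K" "q \<noteq> 0" "Polynomial.poly q y = 0" by (rule algebraic_poly)
    let ?Z = "{z. Polynomial.poly q z = 0}"
    have "\<sigma> ` ?Z \<subseteq> ?Z"
    proof
      fix v assume "v \<in> \<sigma> ` ?Z"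
      then obtain z where z: "v = \<sigma> z" "Polynomial.poly q z = 0" by blast
      have "(0, Polynomial.poly q (\<sigma> z)) \<in> M" using graph_poly[OF M(1) q(1) s[of z]] z(2) by simp
      then show "v \<in> ?Z" using graph_zero[OF M(1)] z(1) by simp
    qed
    then have "\<sigma> ` ?Z = ?Z"
      using endo_inj_surj[OF poly_roots_finite[OF q(2)]] inj by (metis inj_on_subset subset_UNIV)
    then show ?thesis using q(3) by (metis (mono_tags, lifting) imageE mem_Collect_eq)
  qed
  then have "bij \<sigma>" using inj by (metis bij_def surj_def)
  then have "\<sigma> \<in> carrier (Gal K)" unfolding Gal_iff using hom fix_K by auto
  then show thesis using that eq M(2) by blast
qed

lemma conjugate_roots:
  assumes "m \<in> polys_over K" "Polynomial.lead_coeff m = 1" "Polynomial.poly m x = 0" "Polynomial.poly m y = 0"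
    "\<And>p. p \<in> polys_over K \<Longrightarrow> Polynomial.poly p x = 0 \<Longrightarrow> Polynomial.degree p < Polynomial.degree m \<Longrightarrow> p = 0"
  obtains \<sigma> where "\<sigma> \<in> carrier (Gal K)" "\<sigma> x = y"
proof -
  have "\<exists>\<Delta>. hom_graph \<Delta> \<and> Id_on K \<subseteq> \<Delta> \<and> (x, y) \<in> \<Delta>"
    by (rule hom_graph_adjoin[OF hom_graph_Id, of m m]) (use assms in \<open>auto simp: poly_rel_Id\<close>)
  then show thesis using extend_to_automorphism that by metis
qed

text \<open>
  Roots of the minimal polynomial of \<open>x\<close> are conjugate to \<open>x\<close>; if \<open>x\<close> is fixed, then \<open>x\<close> is the
  only root, and by separability the minimal polynomial is linear.
\<close>
lemma fixed_field:
  assumes fixed: "\<And>\<sigma>. \<sigma> \<in> carrier (Gal K) \<Longrightarrow> \<sigma> x = x"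
  shows "x \<in> K"
proof (rule ccontr)
  assume x: "x \<notin> K"
  obtain m where m: "m \<in> polys_over K" "Polynomial.lead_coeff m = 1" "Polynomial.poly m x = 0"
    "Polynomial.degree m > 0" "irreducible_over K m"
    "\<And>p. p \<in> polys_over K \<Longrightarrow> Polynomial.poly p x = 0 \<Longrightarrow> Polynomial.degree p < Polynomial.degree m \<Longrightarrow> p = 0"
    using minimal_polynomial_K[of x] by (metis (no_types, lifting))
  obtain c rs where split: "m = Polynomial.smult c (\<Prod>r\<leftarrow>rs. [:- r, 1:])"
    using galois m(3,5) unfolding galois_extension_def normal_extension_def by metis
  have cop: "coprime m (Polynomial.pderiv m)"
    using galois m(3,5) unfolding galois_extension_def separable_extension_def by metis
  have all: "r = x" if "r \<in> set rs" for r
  proof -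
    have "Polynomial.poly m r = 0" using that by (auto simp: split poly_prod_list image_iff)
    then obtain \<sigma> where "\<sigma> \<in> carrier (Gal K)" "\<sigma> x = r"
      using conjugate_roots[OF m(1-3) _ m(6)] by metis
    then show ?thesis using fixed by metis
  qed
  then have "rs = replicate (length rs) x" by (metis replicate_length_same)
  then have pow: "m = Polynomial.smult c ([:- x, 1:] ^ length rs)"
    using split by (metis map_replicate prod_list_replicate)
  have c: "c \<noteq> 0" using m(2) split by auto
  have deg: "Polynomial.degree m = length rs"
    using c by (simp add: pow degree_power_eq)
  have "length rs \<noteq> 1"
  proof
    assume "length rs = 1"
    then have "m = Polynomial.smult c [:- x, 1:]" using pow by simp
    then have "Polynomial.coeff m 0 = - (c * x)" "c = 1" using m(2) c by auto
    then have "- x \<in> K" using m(1) unfolding polys_over_def by (metis mem_Collect_eq mult_1)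
    then show False using x uminus_mem by force
  qed
  then obtain k where k: "length rs = Suc (Suc k)" using deg m(4) by (metis One_nat_def gr0_implies_Suc not0_implies_Suc)
  define g where "g = Polynomial.smult c ([:- x, 1:] ^ k)"
  have mg: "m = [:- x, 1:] * ([:- x, 1:] * g)" unfolding pow k g_def by (simp add: mult_smult_right)
  have "[:- x, 1:] dvd m" unfolding mg by (rule dvd_triv_left)
  moreover have "[:- x, 1:] dvd Polynomial.pderiv m"
  proof -
    have "u dvd Polynomial.pderiv (u * (u * g))" for u
      unfolding pderiv_mult by (intro dvd_add dvd_triv_left dvd_mult2)
    then show ?thesis unfolding mg .
  qed
  ultimately have "[:- x, 1:] dvd 1" using cop by (metis coprime_common_divisor)
  then have "Polynomial.degree [:- x, 1:] \<le> Polynomial.degree (1 :: 'a Polynomial.poly)"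
    by (intro dvd_imp_degree_le) auto
  then show False by simp
qed

end

section \<open>The Krull topology\<close>

lemma (in algebraic_subfield) subfield_LL: "subfield K (LL :: 'l ring)"
proof -
  interpret L: field "LL :: 'l ring" by (rule field_from_type_algebra)
  have "inv\<^bsub>LL\<^esub> k = 1 / k" if "k \<noteq> 0" for k :: 'l
    using that by (intro L.comm_inv_char) auto
  then show ?thesis
    using divide_mem[OF one_mem] by (intro L.subfieldI'[OF subring]) auto
qed

context algebraic_subfield
begin

abbreviation G :: "('l \<Rightarrow> 'l) set" where "G \<equiv> carrier (Gal K)"

lemma topspace_krull: "topspace (krull_topology K) = G"
  by (rule topspace_krull_topology[OF subfield_LL])

text \<open>
  Needed to see that \<open>Gal E\<close> contains all the automorphisms that fix a suitable finite set, for
  \<open>E\<close> finite over \<open>K\<close>. The dimension predicate is inductive in a chain of spaces, each spanned by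
  the previous one and one more vector.
\<close>
lemma dimension_generators:
  assumes "ring.dimension LL n K' E" "K' = K"
  shows "0 \<in> E \<and> (\<exists>B. finite B \<and> B \<subseteq> E \<and> (\<forall>\<rho>\<in>G. (\<forall>b\<in>B. \<rho> b = b) \<longrightarrow> (\<forall>x\<in>E. \<rho> x = x)))"
proof -
  interpret L: ring "LL :: 'l ring" by (rule ring_from_type_algebra)
  show ?thesis
    using assms
  proof (induction rule: L.dimension.induct)
    case zero_dim
    show ?case using GalD(6)[of _ K] by (intro conjI exI[of _ "{}"]) auto
  next
    case (Suc_dim v E n K')
    then have [simp]: "K' = K" by simp
    from Suc_dim.IH[OF this] obtain B where B: "0 \<in> E" "finite B" "B \<subseteq> E"
      and B_fix: "\<forall>\<rho>\<in>G. (\<forall>b\<in>B. \<rho> b = b) \<longrightarrow> (\<forall>x\<in>E. \<rho> x = x)" by (elim conjE exE)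
    have iff: "u \<in> L.line_extension K v E \<longleftrightarrow> (\<exists>k\<in>K. \<exists>e\<in>E. u = k * v + e)" for u
      using L.line_extension_mem_iff[of u K v E] by simp
    have "v \<in> L.line_extension K v E"
      unfolding iff by (intro bexI[of _ 1] bexI[of _ 0]) (use B(1) in auto)
    moreover have "u \<in> L.line_extension K v E" if "u \<in> E" for u
      unfolding iff by (intro bexI[of _ 0] bexI[of _ u]) (use that in auto)
    ultimately have sub: "insert v E \<subseteq> L.line_extension K v E" by blast
    have span_fixed: "\<rho> x = x" if \<rho>: "\<rho> \<in> G" "\<forall>b\<in>insert v B. \<rho> b = b" and x: "x \<in> L.line_extension K v E" for \<rho> x
    proof -
      obtain k e where ke: "k \<in> K" "e \<in> E" "x = k * v + e" using x unfolding iff by blast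
      have "\<rho> e = e" using bspec[OF B_fix \<rho>(1)] \<rho>(2) ke(2) by simp
      then show ?thesis using \<rho> ke GalD(2,3,5)[OF \<rho>(1)] by simp
    qed
    have fix_ext: "\<forall>\<rho>\<in>G. (\<forall>b\<in>insert v B. \<rho> b = b) \<longrightarrow> (\<forall>x\<in>L.line_extension K v E. \<rho> x = x)"
      using span_fixed by blast
    have "finite (insert v B)" "insert v B \<subseteq> L.line_extension K v E" "0 \<in> L.line_extension K v E"
      using B(1-3) sub by auto
    then show ?case using fix_ext unfolding \<open>K' = K\<close> by (intro conjI exI[of _ "insert v B"])
  qed
qed

text \<open>A basic neighbourhood in the topology of pointwise convergence prescribes finitely many values.\<close>
lemma openin_point_topology:
  assumes C: "\<And>x. finite (C x)" and U: "U \<subseteq> PiE UNIV C"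
    and F: "\<And>\<sigma>. \<sigma> \<in> U \<Longrightarrow> \<exists>F. finite F \<and> (\<forall>\<tau>\<in>PiE UNIV C. (\<forall>x\<in>F. \<tau> x = \<sigma> x) \<longrightarrow> \<tau> \<in> U)"
  shows "openin (product_topology (\<lambda>x::'x. discrete_topology (C x :: 'y set)) UNIV) U"
proof (subst openin_subopen, intro ballI)
  fix \<sigma> assume s: "\<sigma> \<in> U"
  obtain F where F: "finite F" "\<forall>\<tau>\<in>PiE UNIV C. (\<forall>x\<in>F. \<tau> x = \<sigma> x) \<longrightarrow> \<tau> \<in> U" using F[OF s] by blast
  define Y where "Y x = (if x \<in> F then {\<sigma> x} else C x)" for x
  have sC: "\<sigma> x \<in> C x" for x using s U by (auto simp: PiE_def Pi_def)
  have "openin (product_topology (\<lambda>x. discrete_topology (C x)) UNIV) (PiE UNIV Y)"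
  proof (rule product_topology_basis)
    show "openin (discrete_topology (C i)) (Y i)" for i using sC by (auto simp: Y_def)
    show "finite {i. Y i \<noteq> topspace (discrete_topology (C i))}"
      by (rule finite_subset[OF _ F(1)]) (auto simp: Y_def)
  qed
  moreover have "\<sigma> \<in> PiE UNIV Y" using sC by (auto simp: Y_def)
  moreover have "PiE UNIV Y \<subseteq> U"
  proof
    fix \<tau> assume t: "\<tau> \<in> PiE UNIV Y"
    then have tY: "\<tau> x \<in> Y x" for x by (auto simp: PiE_def Pi_def)
    have "\<tau> x \<in> C x" for x using tY[of x] sC[of x] by (auto simp: Y_def split: if_splits)
    moreover have "\<tau> x = \<sigma> x" if "x \<in> F" for x using tY[of x] that by (simp add: Y_def)
    ultimately have "\<tau> \<in> PiE UNIV C" "\<forall>x\<in>F. \<tau> x = \<sigma> x" by auto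
    then show "\<tau> \<in> U" using F(2) by blast
  qed
  ultimately show "\<exists>T. openin (product_topology (\<lambda>x. discrete_topology (C x)) UNIV) T \<and> \<sigma> \<in> T \<and> T \<subseteq> U"
    by blast
qed

lemma krull_open_coset:
  assumes "\<sigma> \<in> G" "subfield E (LL :: 'l ring)" "K \<subseteq> E" "ring.finite_dimension LL K E"
  shows "openin (krull_topology K) (l_coset (Gal K) \<sigma> (carrier (Gal E)))"
  unfolding krull_topology_def by (rule topology_generated_by_Basis) (use assms in blast)

lemma Gal_mono: "K \<subseteq> E \<Longrightarrow> \<rho> \<in> carrier (Gal E) \<Longrightarrow> \<rho> \<in> G"
  unfolding Gal_iff by blast

text \<open>
  Together with unions and finite intersections, this yields all the open sets needed below. The
  value at one point \<open>z\<close> determines the restriction to \<open>K[z]\<close>, which is a finite extension of \<open>K\<close>,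
  spanned by the powers of \<open>z\<close> below the degree of its minimal polynomial.
\<close>
lemma openin_krull_point:
  assumes U: "U \<subseteq> G" and pt: "\<And>\<sigma>. \<sigma> \<in> U \<Longrightarrow> \<exists>z. \<forall>\<tau>\<in>G. \<tau> z = \<sigma> z \<longrightarrow> \<tau> \<in> U"
  shows "openin (krull_topology K) U"
proof (subst openin_subopen, intro ballI)
  fix \<sigma> assume s: "\<sigma> \<in> U"
  then obtain z where z: "\<And>\<tau>. \<tau> \<in> G \<Longrightarrow> \<tau> z = \<sigma> z \<Longrightarrow> \<tau> \<in> U" using pt by blast
  interpret L: field "LL :: 'l ring" by (rule field_from_type_algebra)
  define E where "E = (\<lambda>p. Polynomial.poly p z) ` polys_over K"
  have EI: "Polynomial.poly p z \<in> E" if "p \<in> polys_over K" for p using that by (auto simp: E_def)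
  have KE: "K \<subseteq> E"
  proof
    fix c assume "c \<in> K"
    then show "c \<in> E" using EI[OF polys_over_const[of c]] by simp
  qed
  interpret E: subring_of_field E
  proof
    show "1 \<in> E" using KE by auto
    fix x y assume "x \<in> E" "y \<in> E"
    then obtain p q where pq: "x = Polynomial.poly p z" "y = Polynomial.poly q z" "p \<in> polys_over K" "q \<in> polys_over K"
      by (auto simp: E_def)
    have "p + - q \<in> polys_over K" "p * q \<in> polys_over K"
      using polys_over_add[OF pq(3) polys_over_uminus[OF pq(4)]] polys_over_mult[OF pq(3,4)] by auto
    then show "x - y \<in> E" "x * y \<in> E" using EI[of "p + - q"] EI[of "p * q"] pq by simp_all
  qed
  have graph: "hom_graph (Id_on E)"
    using KE E.diff_mem E.mult_mem by (auto simp: hom_graph_def)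
  have "1 / k \<in> E" if "k \<in> E" "k \<noteq> 0" for k
    using graph_inverse[OF graph, of k k] that by auto
  moreover have "inv\<^bsub>LL\<^esub> k = 1 / k" if "k \<noteq> 0" for k :: 'l
    using that by (intro L.comm_inv_char) auto
  ultimately have subfield_E: "subfield E LL" by (intro L.subfieldI'[OF E.subring]) auto
  have fin_dim: "L.finite_dimension K E"
  proof -
    obtain m where m: "m \<in> polys_over K" "Polynomial.lead_coeff m = 1" "Polynomial.poly m z = 0"
      using minimal_polynomial_K[of z] by (metis (no_types, lifting))
    define n where "n = Polynomial.degree m"
    define us where "us k = map (\<lambda>i. z ^ i) (rev [0..<k])" for k
    have us_Suc: "us (Suc k) = z ^ k # us k" for k by (simp add: us_def)
    have span: "x \<in> L.Span K (us k) \<longleftrightarrow> (\<exists>c. (\<forall>i. c i \<in> K) \<and> x = (\<Sum>i<k. c i * z ^ i))" for x k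
    proof (induction k arbitrary: x)
      case 0
      then show ?case by (auto simp: us_def intro!: exI[of _ "\<lambda>_. 0"])
    next
      case (Suc k)
      have "x \<in> L.Span K (us (Suc k)) \<longleftrightarrow> (\<exists>d\<in>K. \<exists>e\<in>L.Span K (us k). x = d * z ^ k + e)"
        unfolding us_Suc using L.line_extension_mem_iff[of x K "z ^ k" "L.Span K (us k)"] by simp
      also have "\<dots> \<longleftrightarrow> (\<exists>c. (\<forall>i. c i \<in> K) \<and> x = (\<Sum>i<Suc k. c i * z ^ i))" (is "?A \<longleftrightarrow> ?B")
      proof
        assume ?A
        then obtain d e where de: "d \<in> K" "e \<in> L.Span K (us k)" "x = d * z ^ k + e" by blast
        obtain c where "\<forall>i. c i \<in> K" "e = (\<Sum>i<k. c i * z ^ i)"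
          using de(2) unfolding Suc.IH by blast
        note * = de(1) this de(3)
        have "(\<Sum>i<k. (c(k := d)) i * z ^ i) = e" unfolding *(3) by (rule sum.cong) auto
        then have "x = (\<Sum>i<Suc k. (c(k := d)) i * z ^ i)" using *(4) by (simp add: add.commute)
        moreover have "\<forall>i. (c(k := d)) i \<in> K" using * by simp
        ultimately show ?B by blast
      next
        assume ?B
        then obtain c where "\<forall>i. c i \<in> K" "x = (\<Sum>i<Suc k. c i * z ^ i)" by blast
        moreover have "(\<Sum>i<k. c i * z ^ i) \<in> L.Span K (us k)"
          unfolding Suc.IH using \<open>\<forall>i. c i \<in> K\<close> by blast
        ultimately show ?A
          by (intro bexI[of _ "c k"] bexI[of _ "\<Sum>i<k. c i * z ^ i"]) (simp_all add: add.commute)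
      qed
      finally show ?case .
    qed
    have "E = L.Span K (us n)"
    proof (intro subset_antisym subsetI)
      fix x assume "x \<in> E"
      then obtain p where p: "x = Polynomial.poly p z" "p \<in> polys_over K" by (auto simp: E_def)
      have "poly_rel (Id_on K) m m" "poly_rel (Id_on K) p p" using m(1) p(2) by (simp_all add: poly_rel_Id)
      from poly_rel_division[OF hom_graph_Id this(1) m(2) this(2)]
      obtain h r where hr: "h \<in> polys_over K" "r \<in> polys_over K" "p = m * h + r"
        "r = 0 \<or> Polynomial.degree r < Polynomial.degree m"
        unfolding poly_rel_Id by blast
      have "x = Polynomial.poly r z" using p(1) hr(3) m(3) by simp
      also have "\<dots> = (\<Sum>i<n. Polynomial.coeff r i * z ^ i)"
      proof (cases "r = 0")
        case False
        then have "Polynomial.degree r < n" using hr(4) by (simp add: n_def)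
        then show ?thesis
          unfolding poly_altdef by (intro sum.mono_neutral_left) (auto simp: coeff_eq_0)
      qed simp
      finally show "x \<in> L.Span K (us n)" using hr(2) unfolding span polys_over_def by blast
    next
      fix x assume "x \<in> L.Span K (us n)"
      then obtain c where c: "\<forall>i. c i \<in> K" "x = (\<Sum>i<n. c i * z ^ i)" unfolding span by blast
      have "x = Polynomial.poly (\<Sum>i<n. Polynomial.monom (c i) i) z" by (simp add: c(2) poly_sum poly_monom)
      then show "x \<in> E" using EI[OF polys_over_sum[OF polys_over_monom]] c(1) by metis
    qed
    then show ?thesis using L.Span_finite_dimension[OF subfield_LL, of "us n"] by simp
  qed
  have open_coset: "openin (krull_topology K) (l_coset (Gal K) \<sigma> (carrier (Gal E)))"
    by (rule krull_open_coset[OF subsetD[OF U s] subfield_E KE fin_dim])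
  have "z = Polynomial.poly [:0, 1:] z" by simp
  then have zE: "z \<in> E" using EI[OF polys_over_subring(3)] by simp
  have "l_coset (Gal K) \<sigma> (carrier (Gal E)) \<subseteq> U"
  proof
    fix \<tau> assume "\<tau> \<in> l_coset (Gal K) \<sigma> (carrier (Gal E))"
    then obtain \<rho> where \<rho>: "\<rho> \<in> carrier (Gal E)" "\<tau> = \<sigma> \<circ> \<rho>" by (auto simp: l_coset_def)
    then have "\<tau> \<in> G" using Gal_comp[of \<sigma> K \<rho>] Gal_mono[OF KE] s U by blast
    moreover have "\<tau> z = \<sigma> z" using \<rho> GalD(5)[OF \<rho>(1) zE] by simp
    ultimately show "\<tau> \<in> U" by (rule z)
  qed
  moreover have "\<sigma> \<in> l_coset (Gal K) \<sigma> (carrier (Gal E))"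
    using Gal_id[of E] by (auto simp: l_coset_def intro!: bexI[of _ id])
  ultimately show "\<exists>T. openin (krull_topology K) T \<and> \<sigma> \<in> T \<and> T \<subseteq> U" using open_coset by blast
qed

end

context galois_subfield
begin

lemma Gal_hom_iff:
  "\<sigma> \<in> G \<longleftrightarrow> (\<forall>x y. \<sigma> (x - y) = \<sigma> x - \<sigma> y \<and> \<sigma> (x * y) = \<sigma> x * \<sigma> y) \<and> (\<forall>c\<in>K. \<sigma> c = c)"
proof
  assume *: "(\<forall>x y. \<sigma> (x - y) = \<sigma> x - \<sigma> y \<and> \<sigma> (x * y) = \<sigma> x * \<sigma> y) \<and> (\<forall>c\<in>K. \<sigma> c = c)"
  then have "\<sigma> 0 = 0" by simp
  have "hom_graph {(x, y). y = \<sigma> x}"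
    unfolding hom_graph_def using * by auto
  then obtain \<tau> where \<tau>: "\<tau> \<in> G" "\<And>a b. (a, b) \<in> {(x, y). y = \<sigma> x} \<Longrightarrow> \<tau> a = b"
    using extend_to_automorphism by metis
  then have "\<tau> = \<sigma>" by auto
  then show "\<sigma> \<in> G" using \<tau> by simp
next
  assume s: "\<sigma> \<in> G"
  show "(\<forall>x y. \<sigma> (x - y) = \<sigma> x - \<sigma> y \<and> \<sigma> (x * y) = \<sigma> x * \<sigma> y) \<and> (\<forall>c\<in>K. \<sigma> c = c)"
    by (simp add: GalD(3,5,8)[OF s])
qed

text \<open>
  In the product of the finite sets of conjugates, which is compact by Tychonoff's theorem, being
  a \<open>K\<close>-homomorphism is a closed condition, and every \<open>K\<close>-homomorphism is an automorphism. The
  Krull topology is coarser than the topology of the product, so it is compact as well.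
\<close>
lemma compact_krull: "compactin (krull_topology K) G"
proof -
  have "\<forall>x. \<exists>F. finite F \<and> x \<in> F \<and> (\<forall>\<sigma>\<in>G. \<sigma> ` F \<subseteq> F)" using finite_conjugates by metis
  then obtain C where C: "\<And>x. finite (C x)" "\<And>x. x \<in> C x" "\<And>x \<sigma>. \<sigma> \<in> G \<Longrightarrow> \<sigma> ` C x \<subseteq> C x" by metis
  define T where "T = product_topology (\<lambda>x. discrete_topology (C x)) UNIV"
  have top: "topspace T = PiE UNIV C" by (simp add: T_def)
  have GT: "G \<subseteq> PiE UNIV C"
  proof
    fix \<sigma> assume s: "\<sigma> \<in> G"
    have "\<sigma> x \<in> C x" for x using C(3)[OF s, of x] C(2)[of x] by blast
    then show "\<sigma> \<in> PiE UNIV C" by auto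
  qed
  have "openin T (PiE UNIV C - G)"
    unfolding T_def
  proof (rule openin_point_topology[OF C(1)])
    fix \<sigma> assume s: "\<sigma> \<in> PiE UNIV C - G"
    then have "\<sigma> \<notin> G" by simp
    then consider x y where "\<sigma> (x - y) \<noteq> \<sigma> x - \<sigma> y" | x y where "\<sigma> (x * y) \<noteq> \<sigma> x * \<sigma> y"
      | c where "c \<in> K" "\<sigma> c \<noteq> c" unfolding Gal_hom_iff by blast
    then show "\<exists>F. finite F \<and> (\<forall>\<tau>\<in>PiE UNIV C. (\<forall>x\<in>F. \<tau> x = \<sigma> x) \<longrightarrow> \<tau> \<in> PiE UNIV C - G)"
    proof cases
      case (1 x y)
      then show ?thesis by (intro exI[of _ "{x, y, x - y}"]) (auto dest: GalD(8)[of _ K x y])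
    next
      case (2 x y)
      then show ?thesis by (intro exI[of _ "{x, y, x * y}"]) (auto dest: GalD(3)[of _ K x y])
    next
      case (3 c)
      then show ?thesis by (intro exI[of _ "{c}"]) (auto dest: GalD(5)[of _ K c])
    qed
  qed auto
  then have "closedin T G" using GT by (simp add: closedin_def top)
  moreover have "compact_space T"
    unfolding T_def by (simp add: compact_space_product_topology compact_space_discrete_topology C(1))
  ultimately have "compactin T G" by (simp add: closedin_compact_space)
  then have comp: "compactin (subtopology T G) G" by (simp add: compactin_subtopology)
  have topG: "topspace (subtopology T G) = G" using GT top by auto
  have "continuous_map (subtopology T G) (krull_topology K) id"
    unfolding krull_topology_def
  proof (rule continuous_on_generated_topo)
    have "G \<subseteq> topspace (krull_topology K)" by (simp add: topspace_krull)
    then show "id ` topspace (subtopology T G) \<subseteq> \<Union> {l_coset (Gal K) \<sigma> (carrier (Gal E)) | \<sigma> E.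
       \<sigma> \<in> G \<and> subfield E LL \<and> K \<subseteq> E \<and> ring.finite_dimension LL K E}"
      unfolding krull_topology_def topology_generated_by_topspace topG by simp
    fix U assume "U \<in> {l_coset (Gal K) \<sigma> (carrier (Gal E)) | \<sigma> E.
       \<sigma> \<in> G \<and> subfield E LL \<and> K \<subseteq> E \<and> ring.finite_dimension LL K E}"
    then obtain \<sigma> E where U: "U = l_coset (Gal K) \<sigma> (carrier (Gal E))" "\<sigma> \<in> G" "K \<subseteq> E"
      "ring.finite_dimension LL K E" by blast
    interpret L: ring "LL :: 'a ring" by (rule ring_from_type_algebra)
    obtain n where "L.dimension n K E" using U(4) by (auto simp: L.finite_dimension_def)
    from dimension_generators[OF this refl] obtain B where B: "finite B" "B \<subseteq> E"
      and B_fix: "\<forall>\<rho>\<in>G. (\<forall>b\<in>B. \<rho> b = b) \<longrightarrow> (\<forall>x\<in>E. \<rho> x = x)" by (elim conjE exE)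
    define V where "V = {\<tau> \<in> PiE UNIV C. \<forall>b\<in>B. \<tau> b = \<sigma> b}"
    have "openin T V"
      unfolding T_def by (rule openin_point_topology[OF C(1)]) (auto simp: V_def intro!: exI[of _ B] B(1))
    moreover have "id -` U \<inter> topspace (subtopology T G) = V \<inter> G"
    proof (intro subset_antisym subsetI)
      fix \<tau> assume t: "\<tau> \<in> id -` U \<inter> topspace (subtopology T G)"
      then obtain \<rho> where \<rho>: "\<rho> \<in> carrier (Gal E)" "\<tau> = \<sigma> \<circ> \<rho>" "\<tau> \<in> G" using U(1) topG by (auto simp: l_coset_def)
      have "\<tau> b = \<sigma> b" if "b \<in> B" for b using GalD(5)[OF \<rho>(1)] B(2) that \<rho>(2) by auto
      then show "\<tau> \<in> V \<inter> G" using \<rho>(3) GT by (auto simp: V_def)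
    next
      fix \<tau> assume t: "\<tau> \<in> V \<inter> G"
      let ?\<rho> = "Hilbert_Choice.inv \<sigma> \<circ> \<tau>"
      have \<rho>: "?\<rho> \<in> G" using Gal_comp[OF Gal_inverse[OF U(2)]] t by blast
      have "\<forall>b\<in>B. ?\<rho> b = b"
        using t GalD(14)[OF U(2)] by (simp add: V_def)
      then have "\<forall>x\<in>E. ?\<rho> x = x" using bspec[OF B_fix \<rho>] by (rule rev_mp)
      then have "?\<rho> \<in> carrier (Gal E)" using \<rho> unfolding Gal_iff by blast
      moreover have "\<tau> = \<sigma> \<circ> ?\<rho>" using GalD(15)[OF U(2)] by (auto simp: surj_f_inv_f)
      ultimately have "\<tau> \<in> U" unfolding U(1) by (force simp: l_coset_def)
      then show "\<tau> \<in> id -` U \<inter> topspace (subtopology T G)" using t topG by auto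
    qed
    ultimately show "openin (subtopology T G) (id -` U \<inter> topspace (subtopology T G))"
      by (auto simp: openin_subtopology)
  qed
  from image_compactin[OF comp this] show ?thesis by simp
qed

end

section \<open>The Galois action on primes and valuations\<close>

locale dedekind_galois = dedekind_extension +
  assumes galois: "galois_extension K"

sublocale dedekind_galois \<subseteq> galois_subfield "fraction_field R"
  by unfold_locales (use K_divide algebraic galois in auto)

context dedekind_galois
begin

lemma Gal_R: "\<sigma> \<in> G \<Longrightarrow> x \<in> R \<Longrightarrow> \<sigma> x = x"
  using GalD(5) R_sub_K by metis

lemma Gal_S: "\<sigma> \<in> G \<Longrightarrow> x \<in> S \<Longrightarrow> \<sigma> x \<in> S"
proof -
  assume s: "\<sigma> \<in> G" and "x \<in> S"
  then obtain p where p: "p \<in> polys_over R" "Polynomial.lead_coeff p = 1" "Polynomial.poly p x = 0"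
    by (auto simp: integral_closure_def integral_over_def)
  have "p \<in> polys_over K" using p(1) R_sub_K by (auto simp: polys_over_def)
  then have "Polynomial.poly p (\<sigma> x) = 0" using Gal_poly[OF s, of p x] p(3) GalD(6)[OF s] by simp
  then show "\<sigma> x \<in> S" using p by (auto simp: integral_closure_def integral_over_def)
qed

lemma Gal_inv_app: "\<sigma> \<in> G \<Longrightarrow> Hilbert_Choice.inv \<sigma> (\<sigma> x) = x" "\<sigma> \<in> G \<Longrightarrow> \<sigma> (Hilbert_Choice.inv \<sigma> x) = x"
  using GalD(14,15)[of \<sigma> K] by (auto simp: inv_f_f surj_f_inv_f)

lemma Gal_image_inv: "\<sigma> \<in> G \<Longrightarrow> Hilbert_Choice.inv \<sigma> ` \<sigma> ` I = I" "\<sigma> \<in> G \<Longrightarrow> \<sigma> ` Hilbert_Choice.inv \<sigma> ` I = I"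
  by (simp_all add: image_image Gal_inv_app)

lemma Gal_image_iff: "\<sigma> \<in> G \<Longrightarrow> x \<in> \<sigma> ` I \<longleftrightarrow> Hilbert_Choice.inv \<sigma> x \<in> I"
  using Gal_inv_app by (metis imageE image_eqI)

lemma Gal_ideal:
  assumes s: "\<sigma> \<in> G" and I: "ideal_of S I"
  shows "ideal_of S (\<sigma> ` I)"
  unfolding ideal_of_def
proof (intro conjI ballI)
  show "\<sigma> ` I \<subseteq> S" using Gal_S[OF s] ideal_ofD(1)[OF I] by auto
  show "0 \<in> \<sigma> ` I" using GalD(6)[OF s] ideal_ofD(2)[OF I] by (metis image_eqI)
  fix x y assume "x \<in> \<sigma> ` I" "y \<in> \<sigma> ` I"
  then obtain a b where "x = \<sigma> a" "y = \<sigma> b" "a \<in> I" "b \<in> I" by blast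
  then show "x + y \<in> \<sigma> ` I" using GalD(2)[OF s, of a b] ideal_ofD(3)[OF I, of a b] by (metis image_eqI)
next
  fix r x assume r: "r \<in> S" and "x \<in> \<sigma> ` I"
  then obtain a where a: "x = \<sigma> a" "a \<in> I" by blast
  have "Hilbert_Choice.inv \<sigma> r * a \<in> I"
    by (rule ideal_ofD(4)[OF I Gal_S[OF Gal_inverse[OF s] r] a(2)])
  moreover have "r * x = \<sigma> (Hilbert_Choice.inv \<sigma> r * a)"
    using GalD(3)[OF s] Gal_inv_app(2)[OF s] a by simp
  ultimately show "r * x \<in> \<sigma> ` I" by blast
qed

lemma Gal_image_S: "\<sigma> \<in> G \<Longrightarrow> \<sigma> ` S = S"
  using Gal_S Gal_inverse Gal_image_iff by (metis image_subsetI subsetI subset_antisym)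

lemma Gal_mSpec:
  assumes s: "\<sigma> \<in> G" and P: "P \<in> mSpec S"
  shows "\<sigma> ` P \<in> mSpec S"
  unfolding S.mSpec_iff
proof (intro conjI allI impI)
  show "ideal_of S (\<sigma> ` P)" by (rule Gal_ideal[OF s S.mSpecD(1)[OF P]])
  show "\<sigma> ` P \<noteq> S"
  proof
    assume "\<sigma> ` P = S"
    then have "P = Hilbert_Choice.inv \<sigma> ` S" using Gal_image_inv(1)[OF s] by metis
    then show False using P Gal_image_S[OF Gal_inverse[OF s]] S.mSpec_iff by blast
  qed
  fix J assume J: "ideal_of S J" "\<sigma> ` P \<subseteq> J"
  have "P \<subseteq> Hilbert_Choice.inv \<sigma> ` J" using image_mono[OF J(2)] Gal_image_inv(1)[OF s] by metis
  moreover have "ideal_of S (Hilbert_Choice.inv \<sigma> ` J)" by (rule Gal_ideal[OF Gal_inverse[OF s] J(1)])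
  ultimately have "Hilbert_Choice.inv \<sigma> ` J = P \<or> Hilbert_Choice.inv \<sigma> ` J = S"
    using P unfolding S.mSpec_iff by blast
  then show "J = \<sigma> ` P \<or> J = S" using Gal_image_inv(2)[OF s] Gal_image_S[OF s] by metis
qed

lemma Gal_below:
  assumes s: "\<sigma> \<in> G"
  shows "below (\<sigma> ` P) = below P"
proof -
  have "x \<in> \<sigma> ` P \<longleftrightarrow> x \<in> P" if "x \<in> R" for x
    using Gal_image_iff[OF s] Gal_R[OF Gal_inverse[OF s] that] by simp
  then show ?thesis by (auto simp: below_def)
qed

lemma Gal_loc:
  assumes s: "\<sigma> \<in> G" and P: "P \<in> mSpec S"
  shows "x \<in> S.loc P \<Longrightarrow> \<sigma> x \<in> S.loc (\<sigma> ` P)"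
proof -
  assume "x \<in> S.loc P"
  then obtain a t where at: "a \<in> S" "t \<in> S" "t \<notin> P" "x = a / t" using S.locE[OF _ P] by metis
  have "\<sigma> t \<notin> \<sigma> ` P" using at(3) Gal_image_iff[OF s] Gal_inv_app(1)[OF s] by metis
  then have "\<sigma> a / \<sigma> t \<in> S.loc (\<sigma> ` P)" by (intro S.locI Gal_S[OF s] at)
  then show "\<sigma> x \<in> S.loc (\<sigma> ` P)" using at(4) GalD(10)[OF s] by simp
qed

text \<open>
  By uniqueness of valuations: transporting the valuation at \<open>P\<close> by \<open>\<sigma>\<close> gives a normalized
  valuation with the local ring of \<open>\<sigma> ` P\<close>.
\<close>
lemma Gal_val:
  assumes s: "\<sigma> \<in> G" and P: "P \<in> mSpec S"
  shows "val_at (\<sigma> ` P) (\<sigma> x) = val_at P x"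
proof -
  let ?i = "Hilbert_Choice.inv \<sigma>"
  have i: "?i \<in> G" by (rule Gal_inverse[OF s])
  have "val_at (\<sigma> ` P) = (\<lambda>x. val_at P (?i x))"
  proof (rule val_at_unique[OF Gal_mSpec[OF s P]])
    show "rational_valuation (\<lambda>x. val_at P (?i x))"
      unfolding rational_valuation_def
    proof (intro conjI allI impI)
      note v = val_at_correct(1)[OF P, unfolded rational_valuation_def]
      show "val_at P (?i 0) = \<infinity>" using v GalD(6)[OF i] by simp
      show "\<exists>q::rat. val_at P (?i x) = ereal (of_rat q)" if "x \<noteq> 0" for x
        using v GalD(9)[OF i, of x] that by blast
      show "val_at P (?i (x * y)) = val_at P (?i x) + val_at P (?i y)" for x y
        using v GalD(3)[OF i] by simp
      show "min (val_at P (?i x)) (val_at P (?i y)) \<le> val_at P (?i (x + y))" for x y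
        using v GalD(2)[OF i] by simp
    qed
    have loc: "x \<in> S.loc (\<sigma> ` P) \<longleftrightarrow> ?i x \<in> S.loc P" for x
    proof
      assume "x \<in> S.loc (\<sigma> ` P)"
      then have "?i x \<in> S.loc (?i ` \<sigma> ` P)" by (rule Gal_loc[OF i Gal_mSpec[OF s P]])
      then show "?i x \<in> S.loc P" by (simp only: Gal_image_inv(1)[OF s])
    next
      assume "?i x \<in> S.loc P"
      then have "\<sigma> (?i x) \<in> S.loc (\<sigma> ` P)" by (rule Gal_loc[OF s P])
      then show "x \<in> S.loc (\<sigma> ` P)" by (simp only: Gal_inv_app(2)[OF s])
    qed
    have nonneg: "0 \<le> val_at P y \<longleftrightarrow> y \<in> S.loc P" for y
      unfolding val_at_correct(2)[OF P, symmetric] by simp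
    show "{x. 0 \<le> val_at P (?i x)} = S.loc (\<sigma> ` P)"
      by (rule Set.set_eqI) (simp only: mem_Collect_eq loc nonneg)
    have "(\<lambda>x. val_at P (?i x)) ` (K - {0}) = val_at P ` (K - {0})"
      using GalD(5)[OF i] by (intro image_cong) auto
    then show "(\<lambda>x. val_at P (?i x)) ` (K - {0}) = range (\<lambda>n::int. ereal (of_int n))"
      using val_at_correct(3)[OF P] by simp
  qed
  from fun_cong[OF this, of "\<sigma> x"] show ?thesis by (simp only: Gal_inv_app(1)[OF s])
qed

lemma Gal_val_inv:
  assumes "\<sigma> \<in> G" "P \<in> mSpec S"
  shows "val_at (\<sigma> ` P) x = val_at P (Hilbert_Choice.inv \<sigma> x)"
  using Gal_val[OF assms, of "Hilbert_Choice.inv \<sigma> x"] Gal_inv_app(2)[OF assms(1)] by simp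

lemma Gal_w_inv:
  assumes "\<sigma> \<in> G" "P \<in> mSpec S"
  shows "w (\<sigma> ` P) x = w P (Hilbert_Choice.inv \<sigma> x)"
  unfolding w_def by (simp add: Gal_val_inv[OF assms])

text \<open>
  With \<open>Q\<close> a condition on values at \<open>P\<close>, these are conditions on the value of one element at a
  varying conjugate of \<open>P\<close>.
\<close>
lemma openin_krull_inverse_point:
  "openin (krull_topology K) {\<tau> \<in> G. Q (Hilbert_Choice.inv \<tau> y)}"
proof (rule openin_krull_point)
  fix \<sigma> assume s: "\<sigma> \<in> {\<tau> \<in> G. Q (Hilbert_Choice.inv \<tau> y)}"
  show "\<exists>z. \<forall>\<tau>\<in>G. \<tau> z = \<sigma> z \<longrightarrow> \<tau> \<in> {\<tau> \<in> G. Q (Hilbert_Choice.inv \<tau> y)}"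
  proof (intro exI ballI impI)
    fix \<tau> assume t: "\<tau> \<in> G" "\<tau> (Hilbert_Choice.inv \<sigma> y) = \<sigma> (Hilbert_Choice.inv \<sigma> y)"
    then have "\<tau> (Hilbert_Choice.inv \<sigma> y) = y" using s Gal_inv_app(2) by simp
    then have "Hilbert_Choice.inv \<tau> y = Hilbert_Choice.inv \<sigma> y" using Gal_inv_app(1)[OF t(1)] by metis
    then show "\<tau> \<in> {\<tau> \<in> G. Q (Hilbert_Choice.inv \<tau> y)}" using t s by simp
  qed
qed blast

lemma map_poly_Gal_mult:
  assumes s: "\<sigma> \<in> G"
  shows "map_poly \<sigma> (p * q) = map_poly \<sigma> p * map_poly \<sigma> q"
  by (intro poly_eqI) (simp add: coeff_map_poly coeff_mult GalD[OF s])

lemma map_poly_Gal_prod: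
  assumes s: "\<sigma> \<in> G"
  shows "map_poly \<sigma> (\<Prod>i\<in>A. f i) = (\<Prod>i\<in>A. map_poly \<sigma> (f i))"
proof (induction A rule: infinite_finite_induct)
  case (insert i A)
  then show ?case by (simp add: map_poly_Gal_mult[OF s])
qed (simp_all add: map_poly_1 GalD[OF s])

text \<open>
  Gauss's lemma: the first coefficients of \<open>g\<close> and \<open>h\<close> outside \<open>P\<close> give a coefficient of \<open>g * h\<close>
  outside \<open>P\<close>.
\<close>
lemma polys_over_prime:
  assumes P: "P \<in> mSpec S" and gh: "g \<in> polys_over S" "h \<in> polys_over S" "g * h \<in> polys_over P"
  shows "g \<in> polys_over P \<or> h \<in> polys_over P"
proof (rule ccontr)
  assume "\<not> (g \<in> polys_over P \<or> h \<in> polys_over P)"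
  then have ex: "\<exists>i. Polynomial.coeff g i \<notin> P" "\<exists>j. Polynomial.coeff h j \<notin> P"
    by (auto simp: polys_over_def)
  define i where "i = (LEAST i. Polynomial.coeff g i \<notin> P)"
  define j where "j = (LEAST j. Polynomial.coeff h j \<notin> P)"
  have i: "Polynomial.coeff g i \<notin> P" "\<And>k. k < i \<Longrightarrow> Polynomial.coeff g k \<in> P"
    unfolding i_def using LeastI_ex[OF ex(1)] not_less_Least by blast+
  have j: "Polynomial.coeff h j \<notin> P" "\<And>k. k < j \<Longrightarrow> Polynomial.coeff h k \<in> P"
    unfolding j_def using LeastI_ex[OF ex(2)] not_less_Least by blast+
  have S: "Polynomial.coeff g k \<in> S" "Polynomial.coeff h k \<in> S" for k using gh by (auto simp: polys_over_def)
  note I = S.mSpecD(1)[OF P]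
  let ?t = "\<lambda>k. Polynomial.coeff g k * Polynomial.coeff h (i + j - k)"
  have whole: "(\<Sum>k\<le>i + j. ?t k) \<in> P" using gh(3) by (simp add: polys_over_def coeff_mult)
  have split: "(\<Sum>k\<le>i + j. ?t k) = ?t i + (\<Sum>k\<in>{..i + j} - {i}. ?t k)"
    by (rule sum.remove) auto
  have "(\<Sum>k\<in>{..i + j} - {i}. ?t k) \<in> P"
  proof (rule ideal_of_sum[OF I])
    fix k assume k: "k \<in> {..i + j} - {i}"
    show "?t k \<in> P"
    proof (cases "k < i")
      case True
      then show ?thesis by (intro ideal_ofD(5)[OF I S(2)] i(2))
    next
      case False
      then have "i + j - k < j" using k by auto
      then show ?thesis by (intro ideal_ofD(4)[OF I S(1)] j(2))
    qed
  qed
  from S.ideal_of_diff[OF I whole this] have "?t i \<in> P" unfolding split by (simp only: add_diff_cancel_right')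
  then have "Polynomial.coeff g i * Polynomial.coeff h j \<in> P" by simp
  from S.mSpec_prime[OF P S this] show False using i(1) j(1) by blast
qed

lemma polys_over_prime_prod:
  assumes P: "P \<in> mSpec S" and "finite A" "\<And>g. g \<in> A \<Longrightarrow> g \<in> polys_over S" "\<Prod>A \<in> polys_over P"
  shows "\<exists>g\<in>A. g \<in> polys_over P"
  using assms(2-4)
proof (induction A rule: finite_induct)
  case empty
  then show ?case using S.mSpecD(2)[OF P] by (auto simp: polys_over_def dest: spec[of _ 0])
next
  case (insert g A)
  have "\<Prod>A \<in> polys_over S" using S.polys_over_prod[of A "\<lambda>x. x"] insert.prems by simp
  moreover have "g \<in> polys_over S" "g * \<Prod>A \<in> polys_over P" using insert by simp_all
  ultimately have "g \<in> polys_over P \<or> \<Prod>A \<in> polys_over P" by (intro polys_over_prime[OF P])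
  then show ?case using insert.IH insert.prems(1) by blast
qed

text \<open>
  If \<open>Q\<close> is none of the conjugates of \<open>P\<close>, then by compactness it has a finite subset \<open>A\<close> that is
  contained in no conjugate of \<open>P\<close>. Let \<open>f\<close> be the polynomial with the elements of \<open>A\<close> as
  coefficients. Its norm, the product of its finitely many conjugates, has coefficients in
  \<open>Q \<inter> R\<close>, hence in \<open>P\<close>, and by Gauss's lemma one of the conjugates of \<open>f\<close> has all its
  coefficients in \<open>P\<close>. The polynomial stands for all of \<open>A\<close> at once, and it is an object of which
  a norm can be formed.
\<close>
lemma Gal_transitive:
  assumes P: "P \<in> mSpec S" and Q: "Q \<in> mSpec S" and eq: "below P = below Q"
  shows "\<exists>\<sigma>\<in>G. Q = \<sigma> ` P"
proof (rule ccontr)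
  assume no: "\<not> (\<exists>\<sigma>\<in>G. Q = \<sigma> ` P)"
  define U where "U x = {\<tau> \<in> G. Hilbert_Choice.inv \<tau> x \<notin> P}" for x
  have open_U: "openin (krull_topology K) (U x)" for x
    unfolding U_def by (rule openin_krull_inverse_point)
  have "G \<subseteq> (\<Union>x\<in>Q. U x)"
  proof
    fix \<sigma> assume s: "\<sigma> \<in> G"
    have "\<not> Q \<subseteq> \<sigma> ` P" using S.mSpec_eqI[OF Q Gal_mSpec[OF s P]] no s by blast
    then obtain x where "x \<in> Q" "x \<notin> \<sigma> ` P" by blast
    then show "\<sigma> \<in> (\<Union>x\<in>Q. U x)" using s Gal_image_iff[OF s] by (auto simp: U_def)
  qed
  moreover have "openin (krull_topology K) V" if "V \<in> U ` Q" for V using that open_U by blast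
  ultimately obtain \<F> where F: "finite \<F>" "\<F> \<subseteq> U ` Q" "G \<subseteq> \<Union>\<F>"
    using compactinD[OF compact_krull, of "U ` Q"] by blast
  obtain A where A: "A \<subseteq> Q" "finite A" "\<F> = U ` A" using finite_subset_image[OF F(1,2)] by blast
  obtain n h where h: "A = h ` {i::nat. i < n}" using finite_imp_nat_seg_image_inj_on[OF A(2)] by blast
  define f where "f \<sigma> = (\<Sum>i<n. Polynomial.monom (\<sigma> (h i)) i)" for \<sigma> :: "'a \<Rightarrow> 'a"
  have cf: "Polynomial.coeff (f \<sigma>) i = (if i < n then \<sigma> (h i) else 0)" for \<sigma> i
    by (simp add: f_def coeff_sum if_distrib cong: if_cong)
  define \<Phi> where "\<Phi> = f ` G"
  have hS: "h i \<in> Q" "h i \<in> S" if "i < n" for i using A(1) h that S.mSpecD(3)[OF Q] by auto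
  have fS: "f \<sigma> \<in> polys_over S" if "\<sigma> \<in> G" for \<sigma>
    using Gal_S[OF that] hS by (auto simp: polys_over_def cf)
  have fin: "finite \<Phi>"
  proof -
    have "\<forall>x. \<exists>F. finite F \<and> x \<in> F \<and> (\<forall>\<sigma>\<in>G. \<sigma> ` F \<subseteq> F)" using finite_conjugates by metis
    then obtain C where C: "\<And>x. finite (C x)" "\<And>x. x \<in> C x" "\<And>x \<sigma>. \<sigma> \<in> G \<Longrightarrow> \<sigma> ` C x \<subseteq> C x" by metis
    have sub: "\<Phi> \<subseteq> (\<lambda>c. \<Sum>i<n. Polynomial.monom (c i) i) ` (PiE {..<n} (\<lambda>i. C (h i)))"
    proof
      fix g assume "g \<in> \<Phi>"
      then obtain \<sigma> where s: "\<sigma> \<in> G" "g = f \<sigma>" by (auto simp: \<Phi>_def)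
      have "g = (\<Sum>i<n. Polynomial.monom (restrict (\<lambda>i. \<sigma> (h i)) {..<n} i) i)"
        by (simp add: s(2) f_def)
      moreover have "restrict (\<lambda>i. \<sigma> (h i)) {..<n} \<in> PiE {..<n} (\<lambda>i. C (h i))"
        using C(2,3) s(1) by (auto simp: image_subset_iff)
      ultimately show "g \<in> (\<lambda>c. \<Sum>i<n. Polynomial.monom (c i) i) ` (PiE {..<n} (\<lambda>i. C (h i)))" by blast
    qed
    have "finite (PiE {..<n} (\<lambda>i. C (h i)))" by (intro finite_PiE C(1)) auto
    from finite_subset[OF sub finite_imageI[OF this]] show ?thesis .
  qed
  have map_f: "map_poly \<sigma> (f \<tau>) = f (\<sigma> \<circ> \<tau>)" if "\<sigma> \<in> G" for \<sigma> \<tau>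
    by (intro poly_eqI) (simp add: coeff_map_poly cf GalD[OF that])
  have perm: "map_poly \<sigma> ` \<Phi> = \<Phi>" if s: "\<sigma> \<in> G" for \<sigma>
  proof (intro subset_antisym subsetI)
    fix g assume "g \<in> map_poly \<sigma> ` \<Phi>"
    then show "g \<in> \<Phi>" using map_f[OF s] Gal_comp[OF s] by (auto simp: \<Phi>_def)
  next
    fix g assume "g \<in> \<Phi>"
    then obtain \<tau> where t: "\<tau> \<in> G" "g = f \<tau>" by (auto simp: \<Phi>_def)
    have "\<sigma> \<circ> (Hilbert_Choice.inv \<sigma> \<circ> \<tau>) = \<tau>" using Gal_inv_app(2)[OF s] by auto
    then have "g = map_poly \<sigma> (f (Hilbert_Choice.inv \<sigma> \<circ> \<tau>))" using map_f[OF s] t(2) by metis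
    then show "g \<in> map_poly \<sigma> ` \<Phi>"
      using Gal_comp[OF Gal_inverse[OF s] t(1)] by (auto simp: \<Phi>_def)
  qed
  define N where "N = \<Prod>\<Phi>"
  have N_fixed: "map_poly \<sigma> N = N" if s: "\<sigma> \<in> G" for \<sigma>
  proof -
    have inj: "inj_on (map_poly \<sigma>) \<Phi>" using perm[OF s] fin by (simp add: eq_card_imp_inj_on)
    have "map_poly \<sigma> N = (\<Prod>g\<in>\<Phi>. map_poly \<sigma> g)" unfolding N_def by (rule map_poly_Gal_prod[OF s])
    also have "\<dots> = \<Prod>(map_poly \<sigma> ` \<Phi>)" using prod.reindex[OF inj, of "\<lambda>x. x"] by simp
    finally show ?thesis by (simp add: perm[OF s] N_def)
  qed
  have N_S: "N \<in> polys_over S"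
    unfolding N_def using fS by (intro S.polys_over_prod) (auto simp: \<Phi>_def)
  have "N \<in> polys_over P"
  proof -
    have "Polynomial.coeff N k \<in> P" for k
    proof -
      have "\<sigma> (Polynomial.coeff N k) = Polynomial.coeff N k" if "\<sigma> \<in> G" for \<sigma>
        using N_fixed[OF that] coeff_map_poly[of \<sigma> N k] GalD(6)[OF that] by simp
      then have "Polynomial.coeff N k \<in> K" by (rule fixed_field)
      then have "Polynomial.coeff N k \<in> R" using N_S by (intro S_inter_K) (auto simp: polys_over_def)
      moreover have "Polynomial.coeff N k \<in> Q"
      proof -
        have id: "f id \<in> \<Phi>" using Gal_id by (auto simp: \<Phi>_def)
        have "N = f id * \<Prod>(\<Phi> - {f id})" unfolding N_def by (rule prod.remove[OF fin id])
        then have "Polynomial.coeff N k = (\<Sum>i\<le>k. Polynomial.coeff (f id) i * Polynomial.coeff (\<Prod>(\<Phi> - {f id})) (k - i))"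
          by (simp add: coeff_mult)
        also have "\<dots> \<in> Q"
        proof (rule ideal_of_sum[OF S.mSpecD(1)[OF Q]], rule ideal_ofD(5)[OF S.mSpecD(1)[OF Q]])
          have "\<Prod>(\<Phi> - {f id}) \<in> polys_over S"
            using fS by (intro S.polys_over_prod) (auto simp: \<Phi>_def)
          then show "Polynomial.coeff (\<Prod>(\<Phi> - {f id})) (k - i) \<in> S" for i by (simp add: polys_over_def)
          show "Polynomial.coeff (f id) i \<in> Q" for i
            using hS(1) S.mSpecD(4)[OF Q] by (auto simp: cf)
        qed
        finally show ?thesis .
      qed
      ultimately have "Polynomial.coeff N k \<in> below P" unfolding eq by (simp add: below_def)
      then show ?thesis by (simp add: below_def)
    qed
    then show ?thesis by (simp add: polys_over_def)
  qed
  moreover have "g \<in> polys_over S" if "g \<in> \<Phi>" for g using that fS by (auto simp: \<Phi>_def)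
  ultimately obtain g where g: "g \<in> \<Phi>" "g \<in> polys_over P"
    using polys_over_prime_prod[OF P fin] unfolding N_def by blast
  obtain \<sigma> where s: "\<sigma> \<in> G" "g = f \<sigma>" using g(1) by (auto simp: \<Phi>_def)
  let ?i = "Hilbert_Choice.inv \<sigma>"
  have i: "?i \<in> G" by (rule Gal_inverse[OF s(1)])
  have inv_inv: "Hilbert_Choice.inv ?i = \<sigma>" using GalD(1)[OF s(1)] by (rule inv_inv_eq)
  obtain x where x: "x \<in> A" "?i \<in> U x" using i F(3) A(3) by blast
  then obtain k where "k < n" "x = h k" using h by blast
  have "Polynomial.coeff (f \<sigma>) k \<in> P" using g(2) unfolding s(2) polys_over_def by simp
  then have "\<sigma> x \<in> P" using \<open>k < n\<close> \<open>x = h k\<close> by (simp add: cf)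
  then show False using x(2) by (simp add: U_def inv_inv)
qed

end

section \<open>The function of a fractional ideal\<close>

lemma RT_le [simp]: "RT a s \<le> RT b t \<longleftrightarrow> a < b \<or> a = b \<and> (s \<longrightarrow> t)"
  by (auto simp: less_eq_rtilde_def)

text \<open>
  With \<open>f_tilde_le_iff\<close> this reduces equations between values of \<open>f_tilde\<close> to the existence of
  elements.
\<close>
lemma rtilde_eqI:
  assumes "\<And>\<beta>. u \<le> RT \<beta> False \<longleftrightarrow> v \<le> RT \<beta> False"
  shows "u = v"
proof -
  obtain a s b t where uv: "u = RT a s" "v = RT b t" by (cases u; cases v)
  have *: "a < \<beta> \<or> a = \<beta> \<and> \<not> s \<longleftrightarrow> b < \<beta> \<or> b = \<beta> \<and> \<not> t" for \<beta>
    using assms[of \<beta>] by (simp add: uv)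
  have "\<not> a < b" using *[of "(a + b) / 2"] by auto
  moreover have "\<not> b < a" using *[of "(a + b) / 2"] by auto
  ultimately show ?thesis using *[of a] uv by auto
qed

lemma rtilde_sum_le_iff:
  "u + v \<le> RT \<beta> False \<longleftrightarrow> (\<exists>a b. a + b = \<beta> \<and> u \<le> RT a False \<and> v \<le> RT b False)"
proof -
  obtain a s b t where uv: "u = RT a s" "v = RT b t" by (cases u; cases v)
  show ?thesis
  proof
    assume l: "u + v \<le> RT \<beta> False"
    show "\<exists>a b. a + b = \<beta> \<and> u \<le> RT a False \<and> v \<le> RT b False"
    proof (cases "a + b = \<beta>")
      case True
      then show ?thesis using l by (intro exI[of _ a] exI[of _ b]) (auto simp: uv max_def split: if_splits)
    next
      case False
      then show ?thesis using l
        by (intro exI[of _ "a + (\<beta> - a - b) / 2"] exI[of _ "b + (\<beta> - a - b) / 2"]) (auto simp: uv field_simps)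
    qed
  qed (auto simp: uv max_def)
qed

lemma rtilde_less_iff: "u < RT \<alpha> t \<longleftrightarrow> (\<exists>\<beta>. u \<le> RT \<beta> False \<and> RT \<beta> False < RT \<alpha> t)"
proof -
  obtain a s where u: "u = RT a s" by (cases u)
  show ?thesis
  proof
    assume l: "u < RT \<alpha> t"
    show "\<exists>\<beta>. u \<le> RT \<beta> False \<and> RT \<beta> False < RT \<alpha> t"
    proof (cases "a < \<alpha>")
      case True
      then show ?thesis by (intro exI[of _ "(a + \<alpha>) / 2"]) (auto simp: u)
    next
      case False
      then show ?thesis using l by (intro exI[of _ \<alpha>]) (auto simp: u)
    qed
  qed (auto simp: u)
qed

lemma RT_less_True_iff: "u < RT \<alpha> True \<longleftrightarrow> u \<le> RT \<alpha> False"
  by (cases u) auto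

text \<open>A subgroup of the reals with arbitrarily small positive elements is dense.\<close>
lemma real_subgroup_gap:
  fixes V :: "real set"
  assumes "0 \<in> V" and diff: "\<And>x y. x \<in> V \<Longrightarrow> y \<in> V \<Longrightarrow> x - y \<in> V" and nd: "closure V \<noteq> UNIV"
  shows "\<exists>e>0. \<forall>v\<in>V. v > 0 \<longrightarrow> e \<le> v"
proof (rule ccontr)
  assume no: "\<not> ?thesis"
  have small: "\<exists>v\<in>V. v > 0 \<and> v < e" if "e > 0" for e using no that by (metis not_le)
  have neg: "- x \<in> V" if "x \<in> V" for x using diff[OF assms(1) that] by simp
  have mult: "of_int k * v \<in> V" if v: "v \<in> V" for k :: int and v
  proof -
    have nat: "of_nat n * v \<in> V" for n
    proof (induction n)
      case (Suc n)
      then have "of_nat n * v - (- v) \<in> V" using neg[OF v] by (intro diff)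
      then show ?case by (simp add: algebra_simps)
    qed (simp add: assms(1))
    show ?thesis using nat[of "nat k"] neg[OF nat[of "nat (- k)"]] by (cases "k \<ge> 0") auto
  qed
  have "x \<in> closure V" for x
    unfolding closure_approachable
  proof (intro allI impI)
    fix e :: real assume "e > 0"
    then obtain v where v: "v \<in> V" "v > 0" "v < e" using small by blast
    obtain k :: int where "of_int k \<le> x / v" "x / v < of_int k + 1"
      by (rule that[of "\<lfloor>x / v\<rfloor>"]) linarith+
    then have "of_int k * v \<le> x" "x < (of_int k + 1) * v" using v(2) by (simp_all add: field_simps)
    then have "dist (of_int k * v) x < e" using v by (simp add: dist_real_def algebra_simps)
    then show "\<exists>y\<in>V. dist y x < e" using mult[OF v(1), of k] by (rule bexI)
  qed
  then show False using nd by auto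
qed

context dedekind_galois
begin

lemma fi_closed:
  assumes "fractional_ideal S I"
  shows "0 \<in> I" "x \<in> I \<Longrightarrow> y \<in> I \<Longrightarrow> x + y \<in> I" "r \<in> S \<Longrightarrow> x \<in> I \<Longrightarrow> r * x \<in> I"
    "\<exists>x\<in>I. x \<noteq> 0" "\<exists>d. d \<noteq> 0 \<and> (\<forall>x\<in>I. d * x \<in> S)"
proof -
  have I: "additive_subgroup I LL" "I \<noteq> {0}" using assms by (auto simp: fractional_ideal_def)
  show "0 \<in> I" using additive_subgroup.zero_closed[OF I(1)] by simp
  then show "\<exists>x\<in>I. x \<noteq> 0" using I(2) by blast
  show "x \<in> I \<Longrightarrow> y \<in> I \<Longrightarrow> x + y \<in> I" using additive_subgroup.a_closed[OF I(1), of x y] by simp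
qed (use assms in \<open>auto simp: fractional_ideal_def\<close>)

lemma fractional_idealI:
  assumes "0 \<in> I" "\<And>x y. x \<in> I \<Longrightarrow> y \<in> I \<Longrightarrow> x + y \<in> I" "\<And>r x. r \<in> S \<Longrightarrow> x \<in> I \<Longrightarrow> r * x \<in> I"
    "x \<in> I" "x \<noteq> 0" "d \<noteq> 0" "\<And>x. x \<in> I \<Longrightarrow> d * x \<in> S"
  shows "fractional_ideal S I"
proof -
  interpret L: ring "LL :: 'a ring" by (rule ring_from_type_algebra)
  have neg: "- x \<in> I" if "x \<in> I" for x
    using assms(3)[OF S.uminus_mem[OF S.one_mem] that] by simp
  have "additive_subgroup I LL"
    using assms(1,2) neg by (intro additive_subgroup.intro L.add.subgroupI) auto
  then show ?thesis using assms(3-7) unfolding fractional_ideal_def by blast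
qed

lemma S_fractional: "fractional_ideal S S"
  by (rule fractional_idealI[of S 1 1]) (auto intro: S.add_mem S.mult_mem)

lemma value_group_eq: "P \<in> mSpec S \<Longrightarrow> value_group K S P = {w P x | x. x \<noteq> 0}"
  unfolding value_group_def using val_at_eq by fastforce

lemma f_tilde_characterization:
  assumes P: "P \<in> mSpec S" and I: "fractional_ideal S I"
  shows "\<exists>\<phi>. f_tilde K S I P = RT \<phi> (\<not> (\<exists>y\<in>I. y \<noteq> 0 \<and> w P y = \<phi>)) \<and>
    (\<forall>y\<in>I. y \<noteq> 0 \<longrightarrow> \<phi> \<le> w P y) \<and> (\<forall>e>\<phi>. \<exists>y\<in>I. y \<noteq> 0 \<and> w P y < e)"
proof -
  obtain x0 where x0: "x0 \<in> I" "x0 \<noteq> 0" using fi_closed(4)[OF I] by blast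
  obtain d where d: "d \<noteq> 0" "\<forall>x\<in>I. d * x \<in> S" using fi_closed(5)[OF I] by blast
  have lower: "ereal (- w P d) \<le> val_at P y" if "y \<in> I" for y
  proof (cases "y = 0")
    case False
    then have "0 \<le> w P (d * y)" using d that by (intro w_nonneg[OF P]) auto
    then show ?thesis using False d w_mult[OF P d(1) False] by (simp add: val_at_eq[OF P])
  qed (simp add: val_at_zero[OF P])
  have "ereal (- w P d) \<le> inf_val K S I P" unfolding inf_val_def by (rule INF_greatest) (rule lower)
  moreover have le: "inf_val K S I P \<le> val_at P y" if "y \<in> I" for y
    unfolding inf_val_def by (rule INF_lower[OF that])
  moreover have "inf_val K S I P \<le> ereal (w P x0)" using le[OF x0(1)] val_at_eq[OF P x0(2)] by simp
  ultimately obtain \<phi> where phi: "inf_val K S I P = ereal \<phi>" by (cases "inf_val K S I P") auto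
  show ?thesis
  proof (intro exI[of _ \<phi>] conjI ballI allI impI)
    have "P \<in> Max_set K S I \<longleftrightarrow> (\<exists>y\<in>I. y \<noteq> 0 \<and> w P y = \<phi>)"
    proof -
      have "val_at P y = ereal \<phi> \<longleftrightarrow> y \<noteq> 0 \<and> w P y = \<phi>" for y
        using val_at_zero[OF P] val_at_eq[OF P, of y] by (cases "y = 0") auto
      then show ?thesis using P by (simp add: Max_set_def phi)
    qed
    then show "f_tilde K S I P = RT \<phi> (\<not> (\<exists>y\<in>I. y \<noteq> 0 \<and> w P y = \<phi>))"
      by (simp add: f_tilde_def phi)
    show "\<phi> \<le> w P y" if "y \<in> I" "y \<noteq> 0" for y using le[OF that(1)] val_at_eq[OF P that(2)] phi by simp
    show "\<exists>y\<in>I. y \<noteq> 0 \<and> w P y < e" if e: "\<phi> < e" for e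
    proof -
      have "(INF x\<in>I. val_at P x) < ereal e" using e phi by (simp add: inf_val_def)
      then obtain y where y: "y \<in> I" "val_at P y < ereal e" unfolding INF_less_iff by blast
      then have "y \<noteq> 0" using val_at_zero[OF P] by auto
      then show ?thesis using y val_at_eq[OF P, of y] by auto
    qed
  qed
qed

text \<open>
  If the infimum is \<open>\<beta>\<close> itself, then such a \<open>y\<close> exists if and only if the infimum is attained,
  which is what the second component says.
\<close>
lemma f_tilde_le_iff:
  assumes P: "P \<in> mSpec S" and I: "fractional_ideal S I"
  shows "f_tilde K S I P \<le> RT \<beta> False \<longleftrightarrow> (\<exists>y\<in>I. y \<noteq> 0 \<and> w P y \<le> \<beta>)"
proof -
  from f_tilde_characterization[OF P I]
  obtain \<phi> where "f_tilde K S I P = RT \<phi> (\<not> (\<exists>y\<in>I. y \<noteq> 0 \<and> w P y = \<phi>))"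
    "\<forall>y\<in>I. y \<noteq> 0 \<longrightarrow> \<phi> \<le> w P y" "\<forall>e>\<phi>. \<exists>y\<in>I. y \<noteq> 0 \<and> w P y < e" by (elim exE conjE)
  note phi = this(1) this(2,3)[rule_format]
  show ?thesis
  proof
    assume "f_tilde K S I P \<le> RT \<beta> False"
    then consider "\<phi> < \<beta>" | "\<phi> = \<beta>" "\<exists>y\<in>I. y \<noteq> 0 \<and> w P y = \<phi>" unfolding phi(1) RT_le by blast
    then show "\<exists>y\<in>I. y \<noteq> 0 \<and> w P y \<le> \<beta>"
    proof cases
      case 1
      then show ?thesis using phi(3)[of \<beta>] by (auto intro: less_imp_le)
    qed auto
  next
    assume "\<exists>y\<in>I. y \<noteq> 0 \<and> w P y \<le> \<beta>"
    then obtain y where y: "y \<in> I" "y \<noteq> 0" "w P y \<le> \<beta>" by blast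
    have "\<phi> \<le> w P y" by (rule phi(2)[OF y(1,2)])
    show "f_tilde K S I P \<le> RT \<beta> False"
    proof (cases "\<phi> < \<beta>")
      case False
      then have "w P y = \<phi>" "\<phi> = \<beta>" using y(3) \<open>\<phi> \<le> w P y\<close> by auto
      then show ?thesis unfolding phi(1) RT_le using y by blast
    qed (simp add: phi(1))
  qed
qed

lemma f_tilde_less_iff:
  assumes P: "P \<in> mSpec S" and I: "fractional_ideal S I"
  shows "f_tilde K S I P < a \<longleftrightarrow> (\<exists>y\<in>I. y \<noteq> 0 \<and> RT (w P y) False < a)"
proof -
  obtain \<alpha> t where a: "a = RT \<alpha> t" by (cases a)
  show ?thesis
    unfolding a rtilde_less_iff[of "f_tilde K S I P"] f_tilde_le_iff[OF P I]
  proof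
    assume "\<exists>\<beta>. (\<exists>y\<in>I. y \<noteq> 0 \<and> w P y \<le> \<beta>) \<and> RT \<beta> False < RT \<alpha> t"
    then obtain \<beta> y where "y \<in> I" "y \<noteq> 0" "w P y \<le> \<beta>" "RT \<beta> False < RT \<alpha> t" by blast
    moreover from this have "RT (w P y) False < RT \<alpha> t" by auto
    ultimately show "\<exists>y\<in>I. y \<noteq> 0 \<and> RT (w P y) False < RT \<alpha> t" by blast
  next
    assume "\<exists>y\<in>I. y \<noteq> 0 \<and> RT (w P y) False < RT \<alpha> t"
    then show "\<exists>\<beta>. (\<exists>y\<in>I. y \<noteq> 0 \<and> w P y \<le> \<beta>) \<and> RT \<beta> False < RT \<alpha> t"
      by (meson order_refl)
  qed
qed

text \<open>
  If the condition holds at \<open>P\<close>, then \<open>x\<close> is a multiple in the local ring at \<open>P\<close> of some \<open>y \<in> I\<close>,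
  so the ideal of all \<open>s\<close> with \<open>s * x \<in> I\<close> is not contained in \<open>P\<close>.
\<close>
lemma fi_mem_iff:
  assumes I: "fractional_ideal S I" and x: "x \<noteq> 0"
  shows "x \<in> I \<longleftrightarrow> (\<forall>P\<in>mSpec S. f_tilde K S I P \<le> RT (w P x) False)"
proof
  assume "x \<in> I"
  then show "\<forall>P\<in>mSpec S. f_tilde K S I P \<le> RT (w P x) False" using f_tilde_le_iff[OF _ I] x by blast
next
  assume *: "\<forall>P\<in>mSpec S. f_tilde K S I P \<le> RT (w P x) False"
  define J where "J = {s \<in> S. s * x \<in> I}"
  have J: "ideal_of S J"
    using fi_closed(1-3)[OF I] by (auto simp: ideal_of_def J_def distrib_right mult.assoc intro: S.add_mem S.mult_mem)
  show "x \<in> I"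
  proof (rule ccontr)
    assume "x \<notin> I"
    then have "1 \<notin> J" by (simp add: J_def)
    then obtain P where P: "P \<in> mSpec S" "J \<subseteq> P" using S.exists_maximal_ideal[OF J] by metis
    have "f_tilde K S I P \<le> RT (w P x) False" using * P(1) by blast
    then obtain y where y: "y \<in> I" "y \<noteq> 0" "w P y \<le> w P x" unfolding f_tilde_le_iff[OF P(1) I] by blast
    have "0 \<le> w P (x / y)" using w_divide[OF P(1) x y(2)] y(3) by simp
    then have "x / y \<in> S.loc P" using w_nonneg_iff[OF P(1), of "x / y"] x y(2) by simp
    then obtain s where s: "s \<in> S - P" "s * (x / y) \<in> S" unfolding S.mem_loc_iff[OF P(1)] by blast
    have "s * (x / y) * y \<in> I" by (rule fi_closed(3)[OF I s(2) y(1)])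
    then have "s \<in> J" using s(1) y(2) by (simp add: J_def)
    then show False using P(2) s(1) by blast
  qed
qed

lemma mem_S_iff:
  assumes "x \<noteq> 0"
  shows "x \<in> S \<longleftrightarrow> (\<forall>P\<in>mSpec S. 0 \<le> w P x)"
proof
  assume *: "\<forall>P\<in>mSpec S. 0 \<le> w P x"
  have "f_tilde K S S P \<le> RT (w P x) False" if P: "P \<in> mSpec S" for P
    unfolding f_tilde_le_iff[OF P S_fractional] using * P w_one[OF P] by (intro bexI[of _ 1]) auto
  then show "x \<in> S" using fi_mem_iff[OF S_fractional assms] by blast
qed (use w_nonneg assms in blast)

lemma fi_eqI:
  assumes "fractional_ideal S I" "fractional_ideal S J" "\<And>P. P \<in> mSpec S \<Longrightarrow> f_tilde K S I P = f_tilde K S J P"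
  shows "I = J"
proof (rule Set.set_eqI)
  fix x show "x \<in> I \<longleftrightarrow> x \<in> J"
    using fi_mem_iff[OF assms(1), of x] fi_mem_iff[OF assms(2), of x] assms(3)
      fi_closed(1)[OF assms(1)] fi_closed(1)[OF assms(2)] by (cases "x = 0") auto
qed

lemma ideal_prod_fractional:
  assumes I: "fractional_ideal S I" and J: "fractional_ideal S J"
  shows "fractional_ideal S (ideal_prod LL I J)"
proof -
  obtain x y where xy: "x \<in> I" "x \<noteq> 0" "y \<in> J" "y \<noteq> 0" using fi_closed(4)[OF I] fi_closed(4)[OF J] by blast
  obtain d e where de: "d \<noteq> 0" "\<forall>x\<in>I. d * x \<in> S" "e \<noteq> 0" "\<forall>x\<in>J. e * x \<in> S"
    using fi_closed(5)[OF I] fi_closed(5)[OF J] by blast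
  have prod: "a * b \<in> ideal_prod LL I J" if "a \<in> I" "b \<in> J" for a b
    using ideal_prod.prod[OF that, of LL] by simp
  show ?thesis
  proof (rule fractional_idealI[of _ "x * y" "d * e"])
    show "0 \<in> ideal_prod LL I J" using prod[OF fi_closed(1)[OF I] fi_closed(1)[OF J]] by simp
    show "u + v \<in> ideal_prod LL I J" if "u \<in> ideal_prod LL I J" "v \<in> ideal_prod LL I J" for u v
      using ideal_prod.sum[OF that] by simp
    show "r * u \<in> ideal_prod LL I J" if r: "r \<in> S" and u: "u \<in> ideal_prod LL I J" for r u
      using u
    proof (induction rule: ideal_prod.induct)
      case (prod i j)
      have "r * i \<in> I" by (rule fi_closed(3)[OF I r prod(1)])
      from ideal_prod.prod[OF this prod(2), of LL] show ?case by (simp add: mult.assoc)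
    next
      case (sum s1 s2)
      from ideal_prod.sum[OF sum.IH] show ?case by (simp add: distrib_left)
    qed
    show "x * y \<in> ideal_prod LL I J" by (rule prod[OF xy(1,3)])
    show "x * y \<noteq> 0" "d * e \<noteq> 0" using xy de by simp_all
    show "d * e * u \<in> S" if u: "u \<in> ideal_prod LL I J" for u
      using u
    proof (induction rule: ideal_prod.induct)
      case (prod i j)
      have "d * i \<in> S" "e * j \<in> S" using de prod by auto
      then have "(d * i) * (e * j) \<in> S" by (rule S.mult_mem)
      then show ?case by (simp add: mult_ac)
    next
      case (sum s1 s2)
      from S.add_mem[OF sum.IH] show ?case by (simp add: distrib_left)
    qed
  qed
qed

lemma f_tilde_ideal_prod:
  assumes P: "P \<in> mSpec S" and I: "fractional_ideal S I" and J: "fractional_ideal S J"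
  shows "f_tilde K S (ideal_prod LL I J) P = f_tilde K S I P + f_tilde K S J P"
proof (rule rtilde_eqI)
  fix \<beta>
  have ex: "z \<noteq> 0 \<longrightarrow> w P z \<le> \<beta> \<longrightarrow> (\<exists>x\<in>I. \<exists>y\<in>J. x \<noteq> 0 \<and> y \<noteq> 0 \<and> w P x + w P y \<le> \<beta>)"
    if "z \<in> ideal_prod LL I J" for z
    using that
  proof (induction rule: ideal_prod.induct)
    case (prod i j)
    show ?case
    proof (intro impI)
      assume nz: "i \<otimes>\<^bsub>LL\<^esub> j \<noteq> 0" and le: "w P (i \<otimes>\<^bsub>LL\<^esub> j) \<le> \<beta>"
      then have "i \<noteq> 0" "j \<noteq> 0" by auto
      moreover from this have "w P i + w P j \<le> \<beta>" using le w_mult[OF P, of i j] by simp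
      ultimately show "\<exists>x\<in>I. \<exists>y\<in>J. x \<noteq> 0 \<and> y \<noteq> 0 \<and> w P x + w P y \<le> \<beta>"
        using prod by (intro bexI[of _ i] bexI[of _ j]) auto
    qed
  next
    case (sum s1 s2)
    show ?case
    proof (intro impI)
      assume nz: "s1 \<oplus>\<^bsub>LL\<^esub> s2 \<noteq> 0" and le: "w P (s1 \<oplus>\<^bsub>LL\<^esub> s2) \<le> \<beta>"
      have "(s1 \<noteq> 0 \<and> w P s1 \<le> \<beta>) \<or> (s2 \<noteq> 0 \<and> w P s2 \<le> \<beta>)"
        using w_add[OF P, of s1 s2] nz le by (cases "s1 = 0"; cases "s2 = 0") (auto simp: min_def split: if_splits)
      then show "\<exists>x\<in>I. \<exists>y\<in>J. x \<noteq> 0 \<and> y \<noteq> 0 \<and> w P x + w P y \<le> \<beta>" using sum.IH by blast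
    qed
  qed
  show "f_tilde K S (ideal_prod LL I J) P \<le> RT \<beta> False \<longleftrightarrow> f_tilde K S I P + f_tilde K S J P \<le> RT \<beta> False"
    unfolding rtilde_sum_le_iff f_tilde_le_iff[OF P I] f_tilde_le_iff[OF P J]
      f_tilde_le_iff[OF P ideal_prod_fractional[OF I J]]
  proof
    assume "\<exists>y\<in>ideal_prod LL I J. y \<noteq> 0 \<and> w P y \<le> \<beta>"
    then obtain x y where "x \<in> I" "y \<in> J" "x \<noteq> 0" "y \<noteq> 0" "w P x + w P y \<le> \<beta>" using ex by blast
    then show "\<exists>a b. a + b = \<beta> \<and> (\<exists>y\<in>I. y \<noteq> 0 \<and> w P y \<le> a) \<and> (\<exists>y\<in>J. y \<noteq> 0 \<and> w P y \<le> b)"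
      by (intro exI[of _ "w P x"] exI[of _ "\<beta> - w P x"] conjI bexI[of _ x] bexI[of _ y]) auto
  next
    assume "\<exists>a b. a + b = \<beta> \<and> (\<exists>y\<in>I. y \<noteq> 0 \<and> w P y \<le> a) \<and> (\<exists>y\<in>J. y \<noteq> 0 \<and> w P y \<le> b)"
    then obtain a b x y where *: "a + b = \<beta>" "x \<in> I" "x \<noteq> 0" "w P x \<le> a" "y \<in> J" "y \<noteq> 0" "w P y \<le> b"
      by blast
    have "x * y \<in> ideal_prod LL I J" using ideal_prod.prod[OF *(2,5), of LL] by simp
    moreover have "w P (x * y) \<le> \<beta>" using w_mult[OF P *(3,6)] * by simp
    ultimately show "\<exists>y\<in>ideal_prod LL I J. y \<noteq> 0 \<and> w P y \<le> \<beta>" using *(3,6) by (intro bexI[of _ "x * y"]) auto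
  qed
qed

text \<open>
  Bounds come from the base ring because its elements have values that are constant along the
  primes above a given one, and are zero above almost all of them.
\<close>
lemma w_bounded:
  assumes x: "x \<noteq> 0"
  obtains c where "c \<in> R" "c \<noteq> 0" "\<And>P. P \<in> mSpec S \<Longrightarrow> \<bar>w P x\<bar> \<le> w P c"
proof -
  obtain a where a: "a \<in> R" "a \<noteq> 0" "a * x \<in> S" by (rule denominator)
  obtain b where b: "b \<in> R" "b \<noteq> 0" "b * (1 / x) \<in> S" by (rule denominator)
  have "\<bar>w P x\<bar> \<le> w P (a * b)" if P: "P \<in> mSpec S" for P
  proof -
    have "0 \<le> w P (a * x)" "0 \<le> w P (b * (1 / x))" "0 \<le> w P a" "0 \<le> w P b"
      using a b x R_sub_S by (auto intro!: w_nonneg[OF P] simp del: mult_1 times_divide_eq_right)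
    moreover have "w P (a * x) = w P a + w P x" by (rule w_mult[OF P a(2) x])
    moreover have "w P (b * (1 / x)) = w P b - w P x"
      using w_divide[OF P b(2) x] by simp
    ultimately show ?thesis unfolding w_mult[OF P a(2) b(2)] by linarith
  qed
  then show thesis using that[of "a * b"] a b mult_mem by auto
qed

lemma f_tilde_bounded:
  assumes I: "fractional_ideal S I"
  obtains c where "c \<in> R" "c \<noteq> 0"
    "\<And>P. P \<in> mSpec S \<Longrightarrow> RT (- w P c) False \<le> f_tilde K S I P \<and> f_tilde K S I P \<le> RT (w P c) False"
proof -
  obtain x where x: "x \<in> I" "x \<noteq> 0" using fi_closed(4)[OF I] by blast
  obtain d where d: "d \<noteq> 0" "\<forall>x\<in>I. d * x \<in> S" using fi_closed(5)[OF I] by blast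
  obtain a where a: "a \<in> R" "a \<noteq> 0" "\<And>P. P \<in> mSpec S \<Longrightarrow> \<bar>w P x\<bar> \<le> w P a" using w_bounded[OF x(2)] by metis
  obtain b where b: "b \<in> R" "b \<noteq> 0" "\<And>P. P \<in> mSpec S \<Longrightarrow> \<bar>w P d\<bar> \<le> w P b" using w_bounded[OF d(1)] by metis
  have "RT (- w P (a * b)) False \<le> f_tilde K S I P \<and> f_tilde K S I P \<le> RT (w P (a * b)) False"
    if P: "P \<in> mSpec S" for P
  proof -
    have ab: "w P (a * b) = w P a + w P b" by (rule w_mult[OF P a(2) b(2)])
    have ge: "w P x \<le> w P (a * b)" "w P d \<le> w P (a * b)"
      using a(3)[OF P] b(3)[OF P] unfolding ab by linarith+
    have "f_tilde K S I P \<le> RT (w P (a * b)) False"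
      unfolding f_tilde_le_iff[OF P I] using x ge by blast
    moreover have "\<not> f_tilde K S I P < RT (- w P (a * b)) False"
    proof
      assume "f_tilde K S I P < RT (- w P (a * b)) False"
      then obtain y where y: "y \<in> I" "y \<noteq> 0" "w P y < - w P (a * b)"
        unfolding f_tilde_less_iff[OF P I] by auto
      have "0 \<le> w P (d * y)" using d y by (intro w_nonneg[OF P]) auto
      then show False using w_mult[OF P d(1) y(2)] y(3) ge(2) by simp
    qed
    ultimately show ?thesis by simp
  qed
  then show thesis using that[of "a * b"] a b mult_mem by auto
qed

lemma w_not_above: "P \<in> mSpec S \<Longrightarrow> c \<in> R \<Longrightarrow> c \<notin> below P \<Longrightarrow> w P c = 0"
  using w_zero R_sub_S by (auto simp: below_def)

text \<open>
  If the infimum is not attained, then there are elements of strictly decreasing values that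
  converge to it. Their differences are arbitrarily small elements of the value group, which is
  therefore dense.
\<close>
lemma f_tilde_in_V_tilde:
  assumes P: "P \<in> mSpec S" and I: "fractional_ideal S I"
  shows "f_tilde K S I P \<in> V_tilde K S P"
proof -
  from f_tilde_characterization[OF P I]
  obtain \<phi> where "f_tilde K S I P = RT \<phi> (\<not> (\<exists>y\<in>I. y \<noteq> 0 \<and> w P y = \<phi>))"
    "\<forall>y\<in>I. y \<noteq> 0 \<longrightarrow> \<phi> \<le> w P y" "\<forall>e>\<phi>. \<exists>y\<in>I. y \<noteq> 0 \<and> w P y < e" by (elim exE conjE)
  note phi = this(1) this(2,3)[rule_format]
  note vg = value_group_eq[OF P]
  show ?thesis
  proof (cases "\<exists>y\<in>I. y \<noteq> 0 \<and> w P y = \<phi>")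
    case True
    then have "\<phi> \<in> value_group K S P" unfolding vg by blast
    then show ?thesis using True phi(1) by (auto simp: V_tilde_def val_set_def)
  next
    case False
    have "closure (value_group K S P) = UNIV"
    proof (rule ccontr)
      assume nd: "closure (value_group K S P) \<noteq> UNIV"
      have zero: "0 \<in> value_group K S P" unfolding vg using w_one[OF P] zero_neq_one by (metis (mono_tags, lifting) mem_Collect_eq)
      have diff: "u - v \<in> value_group K S P" if uv: "u \<in> value_group K S P" "v \<in> value_group K S P" for u v
      proof -
        obtain x y where "x \<noteq> 0" "y \<noteq> 0" "u = w P x" "v = w P y" using uv unfolding vg by blast
        then have "u - v = w P (x / y)" "x / y \<noteq> 0" using w_divide[OF P] by simp_all
        then show ?thesis unfolding vg by blast
      qed
      obtain e where e: "e > 0" "\<And>v. v \<in> value_group K S P \<Longrightarrow> v > 0 \<Longrightarrow> e \<le> v"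
        using real_subgroup_gap[OF zero diff nd] by blast
      obtain y where y: "y \<in> I" "y \<noteq> 0" "w P y < \<phi> + e" using phi(3)[of "\<phi> + e"] e(1) by auto
      have "\<phi> < w P y" using phi(2)[OF y(1,2)] False y(1,2) by force
      then obtain z where z: "z \<in> I" "z \<noteq> 0" "w P z < w P y" using phi(3) by blast
      have "w P y - w P z \<in> value_group K S P" using y(2) z(2) by (intro diff) (auto simp: vg)
      then have "e \<le> w P y - w P z" using e(2) z(3) by simp
      then show False using y(3) phi(2)[OF z(1,2)] by simp
    qed
    then show ?thesis using False phi(1) by (auto simp: V_tilde_def)
  qed
qed

text \<open>
  The set is a union over \<open>y \<in> I\<close> of sets defined by conditions on \<open>w P (\<sigma>\<^sup>-\<^sup>1 y)\<close>, which are
  open.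
\<close>
lemma f_tilde_usc:
  assumes P: "P \<in> mSpec S" and I: "fractional_ideal S I"
  shows "openin (krull_topology K) {\<sigma> \<in> G. f_tilde K S I (\<sigma> ` P) < a}"
proof -
  have "{\<sigma> \<in> G. f_tilde K S I (\<sigma> ` P) < a} =
      (\<Union>y\<in>I - {0}. {\<sigma> \<in> G. RT (w P (Hilbert_Choice.inv \<sigma> y)) False < a})"
    using f_tilde_less_iff[OF Gal_mSpec[OF _ P] I, of _ a] Gal_w_inv[OF _ P] by auto
  also have "openin (krull_topology K) \<dots>"
  proof (rule openin_Union, elim imageE)
    fix U y assume "U = {\<sigma> \<in> G. RT (w P (Hilbert_Choice.inv \<sigma> y)) False < a}"
    then show "openin (krull_topology K) U"
      using openin_krull_inverse_point[of "\<lambda>z. RT (w P z) False < a" y] by simp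
  qed
  finally show ?thesis .
qed

lemma Gal_fractional:
  assumes s: "\<sigma> \<in> G" and I: "fractional_ideal S I"
  shows "fractional_ideal S (\<sigma> ` I)"
proof -
  obtain x where x: "x \<in> I" "x \<noteq> 0" using fi_closed(4)[OF I] by blast
  obtain d where d: "d \<noteq> 0" "\<forall>x\<in>I. d * x \<in> S" using fi_closed(5)[OF I] by blast
  show ?thesis
  proof (rule fractional_idealI[of _ "\<sigma> x" "\<sigma> d"])
    show "0 \<in> \<sigma> ` I" using GalD(6)[OF s] fi_closed(1)[OF I] by (metis image_eqI)
    fix u v assume "u \<in> \<sigma> ` I" "v \<in> \<sigma> ` I"
    then obtain a b where "u = \<sigma> a" "v = \<sigma> b" "a \<in> I" "b \<in> I" by blast
    then show "u + v \<in> \<sigma> ` I" using GalD(2)[OF s, of a b] fi_closed(2)[OF I, of a b] by (metis image_eqI)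
  next
    fix r u assume r: "r \<in> S" and "u \<in> \<sigma> ` I"
    then obtain a where a: "u = \<sigma> a" "a \<in> I" by blast
    have "Hilbert_Choice.inv \<sigma> r * a \<in> I"
      by (rule fi_closed(3)[OF I Gal_S[OF Gal_inverse[OF s] r] a(2)])
    moreover have "r * u = \<sigma> (Hilbert_Choice.inv \<sigma> r * a)"
      using GalD(3)[OF s] Gal_inv_app(2)[OF s] a by simp
    ultimately show "r * u \<in> \<sigma> ` I" by blast
  next
    fix u assume "u \<in> \<sigma> ` I"
    then obtain a where a: "u = \<sigma> a" "a \<in> I" by blast
    have "\<sigma> (d * a) \<in> S" using d a by (intro Gal_S[OF s]) auto
    then show "\<sigma> d * u \<in> S" using GalD(3)[OF s] a by simp
  qed (use x d GalD(9)[OF s] in auto)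
qed

lemma f_tilde_Gal:
  assumes s: "\<sigma> \<in> G" and P: "P \<in> mSpec S" and I: "fractional_ideal S I"
  shows "f_tilde K S (\<sigma> ` I) (\<sigma> ` P) = f_tilde K S I P"
proof (rule rtilde_eqI)
  fix \<beta>
  have "w (\<sigma> ` P) (\<sigma> x) = w P x" for x by (simp add: w_def Gal_val[OF s P])
  then show "f_tilde K S (\<sigma> ` I) (\<sigma> ` P) \<le> RT \<beta> False \<longleftrightarrow> f_tilde K S I P \<le> RT \<beta> False"
    unfolding f_tilde_le_iff[OF P I] f_tilde_le_iff[OF Gal_mSpec[OF s P] Gal_fractional[OF s I]]
    using GalD(9)[OF s] by simp
qed

lemma value_group_Gal:
  assumes s: "\<sigma> \<in> G" and P: "P \<in> mSpec S"
  shows "value_group K S (\<sigma> ` P) = value_group K S P"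
proof -
  have "(\<exists>x. x \<noteq> 0 \<and> val_at (\<sigma> ` P) x = ereal \<alpha>) \<longleftrightarrow> (\<exists>x. x \<noteq> 0 \<and> val_at P x = ereal \<alpha>)" for \<alpha>
    using Gal_val[OF s P] GalD(9)[OF s] Gal_inv_app(2)[OF s] by metis
  then show ?thesis by (simp add: value_group_def)
qed

lemma V_tilde_Gal: "\<sigma> \<in> G \<Longrightarrow> P \<in> mSpec S \<Longrightarrow> V_tilde K S (\<sigma> ` P) = V_tilde K S P"
  by (simp add: V_tilde_def val_set_def value_group_Gal)

end

section \<open>Ideals with a given function\<close>

lemma RT_mono: "u \<le> RT a False \<Longrightarrow> a \<le> b \<Longrightarrow> u \<le> RT b False"
  by (cases u) auto

context dedekind_galois
begin

text \<open>
  The constant \<open>m\<close> has to be uniform in \<open>P\<close>. Values at conjugate primes are values of conjugate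
  elements, and \<open>z\<close> has only finitely many conjugates; so its positive values above \<open>p\<close> are
  bounded away from \<open>0\<close>.
\<close>
lemma power_dominates:
  assumes z: "z \<noteq> 0" "z \<in> S" and y: "y \<noteq> 0" and p: "p \<in> mSpec R"
  shows "\<exists>m::nat. \<forall>P\<in>mSpec S. below P = p \<longrightarrow> z \<in> P \<longrightarrow> (\<forall>M\<ge>m. N \<le> w P y + real M * w P z)"
proof (cases "\<exists>P\<in>mSpec S. below P = p")
  case True
  then obtain Q where Q: "Q \<in> mSpec S" "below Q = p" by blast
  obtain c where c: "c \<in> R" "c \<noteq> 0" "\<And>P. P \<in> mSpec S \<Longrightarrow> \<bar>w P y\<bar> \<le> w P c"
    using w_bounded[OF y] by metis
  obtain k where k: "\<And>P. P \<in> mSpec S \<Longrightarrow> below P = p \<Longrightarrow> w P c = k"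
    using w_K_below[OF p R_sub_K[OF c(1)] c(2)] by blast
  obtain F where F: "finite F" "z \<in> F" "\<And>\<sigma>. \<sigma> \<in> G \<Longrightarrow> \<sigma> ` F \<subseteq> F" using finite_conjugates[of z] by metis
  \<comment> \<open>The positive values of \<open>z\<close> at the primes above \<open>p\<close> are values of its conjugates at \<open>Q\<close>.\<close>
  define A where "A = insert 1 {v \<in> w Q ` F. v > 0}"
  have A: "finite A" "A \<noteq> {}" using F(1) by (auto simp: A_def)
  define e where "e = Min A"
  have e: "e > 0" using Min_in[OF A] by (auto simp: A_def e_def)
  have dom: "N \<le> w P y + real M * w P z"
    if P: "P \<in> mSpec S" "below P = p" "z \<in> P" and M: "M \<ge> nat \<lceil>(N + k) / e\<rceil>" for P M
  proof -
    obtain \<sigma> where s: "\<sigma> \<in> G" "P = \<sigma> ` Q" using Gal_transitive[OF Q(1) P(1)] P(2) Q(2) by auto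
    have "w P z > 0" using w_pos_iff[OF P(1) z] P(3) by simp
    moreover have "w P z = w Q (Hilbert_Choice.inv \<sigma> z)" unfolding s(2) by (rule Gal_w_inv[OF s(1) Q(1)])
    moreover have "Hilbert_Choice.inv \<sigma> z \<in> F" using F(2) F(3)[OF Gal_inverse[OF s(1)]] by blast
    ultimately have "w P z \<in> A" by (auto simp: A_def)
    then have "e \<le> w P z" unfolding e_def by (rule Min_le[OF A(1)])
    then have "real M * e \<le> real M * w P z" by (intro mult_left_mono) auto
    moreover have "(N + k) / e \<le> real M" using M by linarith
    then have "N + k \<le> real M * e" using e by (simp add: field_simps)
    moreover have "- k \<le> w P y" using c(3)[OF P(1)] k[OF P(1,2)] by simp
    ultimately show ?thesis by linarith
  qed
  show ?thesis by (intro exI[of _ "nat \<lceil>(N + k) / e\<rceil>"] ballI impI allI dom)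
qed auto

lemma power_dominates_finite:
  assumes z: "z \<noteq> 0" "z \<in> S" and y: "y \<noteq> 0" and T: "finite T" "T \<subseteq> mSpec R"
  obtains M :: nat where "\<And>P. P \<in> mSpec S \<Longrightarrow> below P \<in> T \<Longrightarrow> z \<in> P \<Longrightarrow> N \<le> w P y + real M * w P z"
proof -
  have "\<forall>p\<in>T. \<exists>m::nat. \<forall>P\<in>mSpec S. below P = p \<longrightarrow> z \<in> P \<longrightarrow> (\<forall>M\<ge>m. N \<le> w P y + real M * w P z)"
    using power_dominates[OF z y] T(2) by (meson subsetD)
  from bchoice[OF this] obtain m :: "'a set \<Rightarrow> nat" where
    m: "\<forall>p\<in>T. \<forall>P\<in>mSpec S. below P = p \<longrightarrow> z \<in> P \<longrightarrow> (\<forall>M\<ge>m p. N \<le> w P y + real M * w P z)"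
    by (elim exE)
  have le: "m p \<le> sum m T" if "p \<in> T" for p using T(1) that by (intro member_le_sum) auto
  have "N \<le> w P y + real (sum m T) * w P z" if "P \<in> mSpec S" "below P \<in> T" "z \<in> P" for P
    using bspec[OF bspec[OF m that(2)] that(1)] that(3) le[OF that(2)] by blast
  then show thesis by (rule that)
qed

text \<open>
  Each single prime \<open>\<tau> ` Q\<close> other than \<open>P0\<close> has an element outside \<open>P0\<close>, which is also in the
  nearby primes. By compactness finitely many such elements suffice outside \<open>U\<close>; take their
  product.
\<close>
lemma separating_element:
  assumes Q: "Q \<in> mSpec S" and P0: "P0 \<in> mSpec S" and U: "openin (krull_topology K) U"
    and sub: "\<And>\<sigma>. \<sigma> \<in> G \<Longrightarrow> \<sigma> ` Q = P0 \<Longrightarrow> \<sigma> \<in> U"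
  shows "\<exists>z\<in>S - P0. \<forall>\<tau>\<in>G - U. z \<in> \<tau> ` Q"
proof -
  define Z where "Z z = {\<tau> \<in> G. Hilbert_Choice.inv \<tau> z \<in> Q}" for z
  have Z_iff: "\<tau> \<in> Z z \<longleftrightarrow> \<tau> \<in> G \<and> z \<in> \<tau> ` Q" for \<tau> z using Gal_image_iff by (auto simp: Z_def)
  have "openin (krull_topology K) (Z z)" for z unfolding Z_def by (rule openin_krull_inverse_point)
  then have op: "openin (krull_topology K) V" if "V \<in> insert U (Z ` (S - P0))" for V using that U by blast
  have cover: "G \<subseteq> \<Union>(insert U (Z ` (S - P0)))"
  proof
    fix \<tau> assume t: "\<tau> \<in> G"
    show "\<tau> \<in> \<Union>(insert U (Z ` (S - P0)))"
    proof (cases "\<tau> \<in> U")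
      case False
      note tQ = Gal_mSpec[OF t Q]
      have "\<tau> ` Q \<noteq> P0" using sub[OF t] False by blast
      then have "\<not> \<tau> ` Q \<subseteq> P0" using S.mSpec_eqI[OF tQ P0] by blast
      then obtain z where "z \<in> \<tau> ` Q" "z \<notin> P0" by blast
      then have "z \<in> S - P0" "\<tau> \<in> Z z" using S.mSpecD(3)[OF tQ] t Z_iff by auto
      then show ?thesis by blast
    qed simp
  qed
  have "\<exists>\<F>. finite \<F> \<and> \<F> \<subseteq> insert U (Z ` (S - P0)) \<and> G \<subseteq> \<Union>\<F>"
    by (rule compactinD[OF compact_krull _ cover]) (rule op)
  then obtain \<F> where F: "finite \<F>" "\<F> \<subseteq> insert U (Z ` (S - P0))" "G \<subseteq> \<Union>\<F>" by (elim exE conjE)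
  have "finite (\<F> - {U})" "\<F> - {U} \<subseteq> Z ` (S - P0)" using F by auto
  from finite_subset_image[OF this]
  obtain A where A: "A \<subseteq> S - P0" "finite A" "\<F> - {U} = Z ` A" by (elim exE conjE)
  have "\<Prod>A \<in> S - P0" using S.mSpec_prod_notin[OF P0, of A "\<lambda>x. x"] A(1) by auto
  moreover have "\<Prod>A \<in> \<tau> ` Q" if t: "\<tau> \<in> G - U" for \<tau>
  proof -
    obtain V where "V \<in> \<F>" "\<tau> \<in> V" using F(3) t by blast
    then have "V \<in> Z ` A" using A(3) t by blast
    then obtain a where a: "a \<in> A" "a \<in> \<tau> ` Q" using \<open>\<tau> \<in> V\<close> Z_iff by blast
    have "\<Prod>(A - {a}) \<in> S" using A(1) S.prod_mem[of "A - {a}" "\<lambda>x. x"] by auto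
    have "\<tau> ` Q \<in> mSpec S" using Gal_mSpec[OF _ Q] t by blast
    from ideal_ofD(5)[OF S.mSpecD(1)[OF this] \<open>\<Prod>(A - {a}) \<in> S\<close> a(2)]
    have "a * \<Prod>(A - {a}) \<in> \<tau> ` Q" .
    moreover have "\<Prod>A = a * \<Prod>(A - {a})" by (rule prod.remove[OF A(2) a(1)])
    ultimately show ?thesis by simp
  qed
  ultimately show ?thesis by blast
qed

text \<open>
  The element \<open>x = y * z ^ M\<close> has to satisfy the inequality at all primes. Write \<open>p\<close> for the prime
  below \<open>P0\<close>. Above \<open>p\<close>, it holds near \<open>P0\<close> thanks to \<open>y\<close>, and elsewhere thanks to the factor \<open>z1\<close>
  of \<open>z\<close>. The other factor \<open>z2\<close> of \<open>z\<close> takes care of the finitely many other primes of the base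
  ring where \<open>h\<close> or \<open>w y\<close> may be non-zero. Both factors are outside \<open>P0\<close>, so that the value there
  is that of \<open>y\<close>.
\<close>
lemma exists_element:
  assumes P0: "P0 \<in> mSpec S" and Q: "Q \<in> mSpec S" "below Q = below P0" and y: "y \<noteq> 0"
    and le: "h P0 \<le> RT (w P0 y) False"
    and usc: "\<And>a. openin (krull_topology K) {\<sigma> \<in> G. h (\<sigma> ` Q) < a}"
    and T: "finite T" "T \<subseteq> mSpec R" "\<And>P. P \<in> mSpec S \<Longrightarrow> below P \<notin> T \<Longrightarrow> h P = 0"
    and N: "\<And>P. P \<in> mSpec S \<Longrightarrow> h P \<le> RT N False"
  shows "\<exists>x. x \<noteq> 0 \<and> w P0 x = w P0 y \<and> (\<forall>P\<in>mSpec S. h P \<le> RT (w P x) False)"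
proof -
  let ?p = "below P0"
  have p: "?p \<in> mSpec R" by (rule below_mSpec[OF P0])
  define U where "U = {\<sigma> \<in> G. h (\<sigma> ` Q) \<le> RT (w (\<sigma> ` Q) y) False}"
  \<comment> \<open>Near \<open>P0\<close> the element \<open>y\<close> itself is good enough.\<close>
  have "openin (krull_topology K) U"
  proof (subst openin_subopen, intro ballI)
    fix \<sigma> assume s: "\<sigma> \<in> U"
    define v where "v = w (\<sigma> ` Q) y"
    let ?V = "{\<tau> \<in> G. h (\<tau> ` Q) < RT v True} \<inter> {\<tau> \<in> G. w Q (Hilbert_Choice.inv \<tau> y) = v}"
    have "openin (krull_topology K) ?V"
      by (intro openin_Int usc openin_krull_inverse_point[of "\<lambda>x. w Q x = v"])
    moreover have "\<sigma> \<in> ?V"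
      using s Gal_w_inv[OF _ Q(1), of \<sigma> y] by (simp add: U_def v_def RT_less_True_iff)
    moreover have "?V \<subseteq> U"
      using Gal_w_inv[OF _ Q(1), of _ y] by (auto simp: U_def RT_less_True_iff)
    ultimately show "\<exists>V. openin (krull_topology K) V \<and> \<sigma> \<in> V \<and> V \<subseteq> U" by blast
  qed
  moreover have "\<sigma> \<in> U" if "\<sigma> \<in> G" "\<sigma> ` Q = P0" for \<sigma> using that le by (simp add: U_def)
  ultimately obtain z1 where z1: "z1 \<in> S - P0" "\<And>\<tau>. \<tau> \<in> G - U \<Longrightarrow> z1 \<in> \<tau> ` Q"
    using separating_element[OF Q(1) P0] by (metis (no_types, lifting))
  obtain c where c: "c \<in> R" "c \<noteq> 0" "\<And>P. P \<in> mSpec S \<Longrightarrow> \<bar>w P y\<bar> \<le> w P c"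
    using w_bounded[OF y] by metis
  \<comment> \<open>The primes of the base ring, other than the one below \<open>P0\<close>, above which \<open>h\<close> or the value of
    \<open>y\<close> may be non-zero.\<close>
  define T' where "T' = (T \<union> {q \<in> mSpec R. c \<in> q}) - {?p}"
  have T': "finite T'" "T' \<subseteq> mSpec R" using T finite_primes_above[OF c(1,2)] by (auto simp: T'_def)
  have "\<forall>q\<in>T'. \<exists>a. a \<in> q \<and> a \<in> R - ?p"
  proof
    fix q assume q: "q \<in> T'"
    then have qm: "q \<in> mSpec R" "q \<noteq> ?p" using T'(2) by (auto simp: T'_def)
    have "\<not> q \<subseteq> ?p" using mSpec_eqI[OF qm(1) p] qm(2) by (rule contrapos_nn[rotated])
    then obtain b where "b \<in> q" "b \<notin> ?p" unfolding subset_iff by (metis (no_types))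
    then show "\<exists>a. a \<in> q \<and> a \<in> R - ?p" using mSpecD(3)[OF qm(1)] by (intro exI[of _ b]) auto
  qed
  from bchoice[OF this] obtain a where a: "\<forall>q\<in>T'. a q \<in> q \<and> a q \<in> R - ?p" by (elim exE)
  define z2 where "z2 = prod a T'"
  have z2: "z2 \<in> R - ?p" unfolding z2_def using a by (intro mSpec_prod_notin[OF p]) auto
  have z2_mem: "z2 \<in> q" if q: "q \<in> T'" for q
  proof -
    have "z2 = a q * prod a (T' - {q})" unfolding z2_def by (rule prod.remove[OF T'(1) q])
    moreover have "prod a (T' - {q}) \<in> R" using a by (intro prod_mem) auto
    moreover have "ideal_of R q" using mSpecD(1) q T'(2) by blast
    ultimately show ?thesis using a q ideal_ofD(5) by metis
  qed
  define z where "z = z1 * z2"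
  have z2S: "z2 \<in> S" "z2 \<notin> P0" using z2 R_sub_S by (auto simp: below_def)
  have z: "z \<in> S" "z \<notin> P0" using z1(1) z2S S.mSpec_prime[OF P0, of z1 z2] by (auto simp: z_def intro: S.mult_mem)
  have z0: "z \<noteq> 0" using z(2) S.mSpecD(4)[OF P0] by blast
  have zP: "z \<in> P" if P: "P \<in> mSpec S" and "z1 \<in> P \<or> z2 \<in> P" for P
    using that(2) ideal_ofD(4)[OF S.mSpecD(1)[OF P], of z1 z2] ideal_ofD(5)[OF S.mSpecD(1)[OF P], of z2 z1] z1(1) z2S(1)
    by (auto simp: z_def)
  have fin: "finite (insert ?p T')" "insert ?p T' \<subseteq> mSpec R" using T' p by auto
  obtain M :: nat where M: "\<And>P. P \<in> mSpec S \<Longrightarrow> below P \<in> insert ?p T' \<Longrightarrow> z \<in> P \<Longrightarrow> N \<le> w P y + real M * w P z"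
    using power_dominates_finite[OF z0 z(1) y fin] by metis
  define x where "x = y * z ^ M"
  have wx: "w P x = w P y + real M * w P z" if "P \<in> mSpec S" for P
    using w_mult[OF that y, of "z ^ M"] w_power[OF that z0] z0 by (simp add: x_def)
  have wz: "0 \<le> real M * w P z" if "P \<in> mSpec S" for P using w_nonneg[OF that z0 z(1)] by simp
  have "h P \<le> RT (w P x) False" if P: "P \<in> mSpec S" for P
  proof -
    have big: "h P \<le> RT (w P x) False" if "below P \<in> insert ?p T'" "z \<in> P"
      using RT_mono[OF N[OF P]] M[OF P that] wx[OF P] by simp
    consider "below P = ?p" | "below P \<in> T'" | "below P \<noteq> ?p" "below P \<notin> T'" by blast
    then show ?thesis
    proof cases
      case 1
      then obtain \<tau> where t: "\<tau> \<in> G" "P = \<tau> ` Q" using Gal_transitive[OF Q(1) P] Q(2) by auto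
      show ?thesis
      proof (cases "\<tau> \<in> U")
        case True
        then have "h P \<le> RT (w P y) False" using t by (simp add: U_def)
        then show ?thesis by (rule RT_mono) (use wx[OF P] wz[OF P] in simp)
      next
        case False
        then have "z1 \<in> P" using z1(2) t by blast
        then show ?thesis using big zP[OF P] 1 by blast
      qed
    next
      case 2
      then have "z2 \<in> P" using z2_mem by (auto simp: below_def)
      then show ?thesis using big zP[OF P] 2 by blast
    next
      case 3
      then have out: "below P \<notin> T" "c \<notin> below P" using below_mSpec[OF P] by (auto simp: T'_def)
      then have "w P y = 0" using c(3)[OF P] w_not_above[OF P c(1)] by simp
      then show ?thesis using T(3)[OF P out(1)] wx[OF P] wz[OF P] by (auto simp: zero_rtilde_def)
    qed
  qed
  moreover have "w P0 x = w P0 y" using wx[OF P0] w_zero[OF P0 z] by simp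
  moreover have "x \<noteq> 0" using y z0 by (simp add: x_def)
  ultimately show ?thesis by blast
qed

text \<open>
  The ideal is the largest possible one. It has at \<open>P\<close> the right value by \<open>exists_element\<close>, which
  is applied to elements \<open>y\<close> whose value \<open>v\<close> at \<open>P\<close> satisfies \<open>h P \<le> (v, 0)\<close> and is close to
  \<open>h P\<close>; such \<open>v\<close> exist in the value group because \<open>h P\<close> belongs to \<open>V_tilde\<close>.
\<close>
lemma realize_function:
  assumes V: "\<And>P. P \<in> mSpec S \<Longrightarrow> h P \<in> V_tilde K S P"
    and T: "finite T" "T \<subseteq> mSpec R" "\<And>P. P \<in> mSpec S \<Longrightarrow> below P \<notin> T \<Longrightarrow> h P = 0"
    and N: "\<And>P. P \<in> mSpec S \<Longrightarrow> RT (- N) False \<le> h P \<and> h P \<le> RT N False"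
    and usc: "\<And>P. P \<in> mSpec S \<Longrightarrow> \<exists>Q\<in>mSpec S. below Q = below P \<and>
      (\<forall>a. openin (krull_topology K) {\<sigma> \<in> G. h (\<sigma> ` Q) < a})"
  shows "\<exists>I. fractional_ideal S I \<and> (\<forall>P\<in>mSpec S. f_tilde K S I P = h P)"
proof -
  define I where "I = {x. x = 0 \<or> (\<forall>P\<in>mSpec S. h P \<le> RT (w P x) False)}"
  have Imem: "x \<in> I \<longleftrightarrow> (\<forall>P\<in>mSpec S. h P \<le> RT (w P x) False)" if "x \<noteq> 0" for x
    using that by (simp add: I_def)
  have "\<forall>q\<in>T. \<exists>a. a \<in> q \<and> a \<noteq> 0"
  proof
    fix q assume "q \<in> T"
    then have "q \<in> mSpec R" using T(2) by blast
    then obtain a where "a \<in> q" "a \<noteq> 0" by (rule mSpec_nonzero)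
    then show "\<exists>a. a \<in> q \<and> a \<noteq> 0" by blast
  qed
  from bchoice[OF this] obtain a where a: "\<forall>q\<in>T. a q \<in> q \<and> a q \<noteq> 0" by (elim exE)
  define z where "z = prod a T"
  have aR: "a q \<in> R" if "q \<in> T" for q using a that T(2) mSpecD(3) by blast
  have z: "z \<in> R" "z \<noteq> 0" using aR a T(1) by (auto simp: z_def intro: prod_mem)
  have z_mem: "z \<in> q" if q: "q \<in> T" for q
  proof -
    have "z = a q * prod a (T - {q})" unfolding z_def by (rule prod.remove[OF T(1) q])
    moreover have "prod a (T - {q}) \<in> R" using aR by (intro prod_mem) auto
    moreover have "ideal_of R q" using mSpecD(1) q T(2) by blast
    ultimately show ?thesis using a q ideal_ofD(5) by metis
  qed
  obtain M :: nat where M: "\<And>P. P \<in> mSpec S \<Longrightarrow> below P \<in> T \<Longrightarrow> z \<in> P \<Longrightarrow> N \<le> w P 1 + real M * w P z"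
    using power_dominates_finite[OF z(2) R_sub_S[OF z(1)] one_neq_zero T(1,2)] by metis
  \<comment> \<open>An element of \<open>R\<close> whose value is at least \<open>N\<close> wherever \<open>h\<close> may be non-zero: it belongs to
    \<open>I\<close> and is a denominator of \<open>I\<close>.\<close>
  define c where "c = z ^ M"
  have c: "c \<in> S" "c \<noteq> 0" using z R_sub_S power_mem by (auto simp: c_def)
  have cN: "N \<le> w P c" if "P \<in> mSpec S" "below P \<in> T" for P
    using M[OF that] z_mem[OF that(2)] w_one[OF that(1)] w_power[OF that(1) z(2)]
    by (simp add: c_def below_def)
  have cx: "c * x \<in> S" if x: "x \<in> I" for x
  proof (cases "x = 0")
    case False
    have "0 \<le> w P (c * x)" if P: "P \<in> mSpec S" for P
    proof (cases "below P \<in> T")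
      case True
      have "RT (- N) False \<le> RT (w P x) False" using N[OF P] x Imem[OF False] P by (meson order_trans)
      then show ?thesis using cN[OF P True] w_mult[OF P c(2) False] by auto
    next
      case no: False
      have "h P \<le> RT (w P x) False" using x Imem[OF False] P by blast
      then have "0 \<le> w P x" using T(3)[OF P no] by (auto simp: zero_rtilde_def)
      then show ?thesis using w_mult[OF P c(2) False] w_nonneg[OF P c(2,1)] by simp
    qed
    then show ?thesis using mem_S_iff[of "c * x"] c(2) False by simp
  qed (use S.zero_mem in simp)
  have I: "fractional_ideal S I"
  proof (rule fractional_idealI[of I c c])
    show "0 \<in> I" by (simp add: I_def)
    show "x + y \<in> I" if xy: "x \<in> I" "y \<in> I" for x y
    proof (cases "x = 0 \<or> y = 0 \<or> x + y = 0")
      case True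
      then show ?thesis using xy by (auto simp: I_def)
    next
      case False
      have "h P \<le> RT (w P (x + y)) False" if P: "P \<in> mSpec S" for P
      proof -
        have "h P \<le> RT (min (w P x) (w P y)) False"
          using xy Imem[of x] Imem[of y] False P by (auto simp: min_def)
        then show ?thesis by (rule RT_mono) (use w_add[OF P, of x y] False in auto)
      qed
      then show ?thesis using Imem[of "x + y"] False by blast
    qed
    show "r * x \<in> I" if rx: "r \<in> S" "x \<in> I" for r x
    proof (cases "r * x = 0")
      case False
      then have nz: "r \<noteq> 0" "x \<noteq> 0" by auto
      have "h P \<le> RT (w P (r * x)) False" if P: "P \<in> mSpec S" for P
      proof -
        have "h P \<le> RT (w P x) False" using rx(2) Imem[OF nz(2)] P by blast
        then show ?thesis by (rule RT_mono) (use w_mult[OF P nz] w_nonneg[OF P nz(1) rx(1)] in simp)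
      qed
      then show ?thesis using Imem[OF False] by blast
    qed (simp add: I_def)
    have "h P \<le> RT (w P c) False" if P: "P \<in> mSpec S" for P
    proof (cases "below P \<in> T")
      case True
      then show ?thesis using RT_mono[of "h P" N] N[OF P] cN[OF P] by blast
    next
      case False
      then show ?thesis using T(3)[OF P False] w_nonneg[OF P c(2,1)] by (auto simp: zero_rtilde_def)
    qed
    then show "c \<in> I" using Imem[OF c(2)] by blast
  qed (use c cx in auto)
  have "f_tilde K S I P = h P" if P: "P \<in> mSpec S" for P
  proof (rule rtilde_eqI)
    fix \<beta>
    show "f_tilde K S I P \<le> RT \<beta> False \<longleftrightarrow> h P \<le> RT \<beta> False"
      unfolding f_tilde_le_iff[OF P I]
    proof
      assume "\<exists>y\<in>I. y \<noteq> 0 \<and> w P y \<le> \<beta>"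
      then obtain y where y: "y \<in> I" "y \<noteq> 0" "w P y \<le> \<beta>" by blast
      then have "h P \<le> RT (w P y) False" using Imem P by blast
      then show "h P \<le> RT \<beta> False" using y(3) by (rule RT_mono)
    next
      assume le: "h P \<le> RT \<beta> False"
      have "\<exists>v\<in>value_group K S P. v \<le> \<beta> \<and> h P \<le> RT v False"
      proof -
        obtain \<gamma> s where hP: "h P = RT \<gamma> s" by (cases "h P")
        show ?thesis
        proof (cases s)
          case False
          then have "\<gamma> \<in> value_group K S P" using V[OF P] hP by (auto simp: V_tilde_def val_set_def split: if_splits)
          then show ?thesis using le hP False by (intro bexI[of _ \<gamma>]) auto
        next
          case True
          then have lt: "\<gamma> < \<beta>" using le hP by auto
          have "closure (value_group K S P) = UNIV"
            using V[OF P] hP True by (auto simp: V_tilde_def val_set_def split: if_splits)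
          then have "(\<gamma> + \<beta>) / 2 \<in> closure (value_group K S P)" by simp
          then obtain v where "v \<in> value_group K S P" "dist v ((\<gamma> + \<beta>) / 2) < (\<beta> - \<gamma>) / 2"
            using lt unfolding closure_approachable by (metis diff_gt_0_iff_gt half_gt_zero)
          then show ?thesis using hP by (intro bexI[of _ v]) (auto simp: dist_real_def abs_less_iff field_simps)
        qed
      qed
      then obtain y where y: "y \<noteq> 0" "w P y \<le> \<beta>" "h P \<le> RT (w P y) False"
        unfolding value_group_eq[OF P] by blast
      obtain Q where Q: "Q \<in> mSpec S" "below Q = below P"
        "\<And>a. openin (krull_topology K) {\<sigma> \<in> G. h (\<sigma> ` Q) < a}" using usc[OF P] by blast
      have "\<exists>x. x \<noteq> 0 \<and> w P x = w P y \<and> (\<forall>P\<in>mSpec S. h P \<le> RT (w P x) False)"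
        by (rule exists_element[OF P Q(1,2) y(1,3) Q(3) T]) (use N in auto)
      then obtain x where "x \<noteq> 0" "w P x = w P y" "x \<in> I" using Imem by blast
      then show "\<exists>y\<in>I. y \<noteq> 0 \<and> w P y \<le> \<beta>" using y(2) by auto
    qed
  qed
  then show ?thesis using I by blast
qed

end

section \<open>Functions on the coset spaces\<close>

lemma RT_plus_zero_iff: "u + v = (0::rtilde) \<longleftrightarrow> (\<exists>a. u = RT a False \<and> v = RT (- a) False)"
proof -
  obtain a s b t where "u = RT a s" "v = RT b t" by (cases u; cases v)
  then show ?thesis by (auto simp: zero_rtilde_def max_def)
qed

lemma rtilde_regular:
  assumes "u = u + v + u"
  shows "v + u + v = iota u"
proof -
  obtain a s b t where "u = RT a s" "v = RT b t" by (cases u; cases v)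
  then show ?thesis using assms by (auto simp: max_def split: if_splits)
qed

lemma rtilde_iota_regular: "u + iota u + u = u"
  by (cases u) simp

lemma direct_sum_carrier:
  "x \<in> carrier (monoid_direct_sum I A) \<longleftrightarrow>
    x \<in> (\<Pi>\<^sub>E i\<in>I. carrier (A i)) \<and> finite {i \<in> I. x i \<noteq> \<one>\<^bsub>A i\<^esub>}"
  by (auto simp: monoid_direct_sum_def product_group_def)

lemma direct_sum_mult: "x \<otimes>\<^bsub>monoid_direct_sum I A\<^esub> y = (\<lambda>i\<in>I. x i \<otimes>\<^bsub>A i\<^esub> y i)"
  by (simp add: monoid_direct_sum_def product_group_def)

lemma S_0b_simps:
  "f \<in> carrier (S_0b T M) \<longleftrightarrow> f \<in> topspace T \<rightarrow>\<^sub>E M \<and> bounded_fun T f \<and> compactly_supported T f \<and> upper_semicont T f"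
  "f \<otimes>\<^bsub>S_0b T M\<^esub> g = (\<lambda>x\<in>topspace T. f x + g x)" "\<one>\<^bsub>S_0b T M\<^esub> = (\<lambda>x\<in>topspace T. 0)"
  "\<one>\<^bsub>S_0ref T M\<^esub> = (\<lambda>x\<in>topspace T. 0)"
  "f \<in> carrier (S_0ref T M) \<longleftrightarrow> f \<in> carrier (S_0b T M) \<and> (\<lambda>x\<in>topspace T. iota (f x)) \<in> carrier (S_0b T M)"
  by (auto simp: S_0b_def S_0ref_def)

locale galois_primes = dedekind_galois +
  fixes pL :: "'a set \<Rightarrow> 'a set"
  assumes pL: "p \<in> mSpec R \<Longrightarrow> pL p \<in> mSpec (integral_closure R) \<and> pL p \<inter> R = p"
begin

abbreviation D :: "'a set \<Rightarrow> ('a \<Rightarrow> 'a) set" where "D p \<equiv> decomposition_group K (pL p)"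
abbreviation T :: "'a set \<Rightarrow> ('a \<Rightarrow> 'a) set topology" where "T p \<equiv> coset_space K (pL p)"
abbreviation coset :: "'a set \<Rightarrow> ('a \<Rightarrow> 'a) \<Rightarrow> ('a \<Rightarrow> 'a) set"
  where "coset p \<sigma> \<equiv> l_coset (Gal K) \<sigma> (D p)"
abbreviation F :: "'a set \<Rightarrow> 'a set \<Rightarrow> ('a \<Rightarrow> 'a) set \<Rightarrow> rtilde"
  where "F \<equiv> F_tilde R K S pL"
abbreviation target :: "('a set \<Rightarrow> ('a \<Rightarrow> 'a) set \<Rightarrow> rtilde) monoid"
  where "target \<equiv> monoid_direct_sum (mSpec R) (\<lambda>p. S_0b (T p) (V_tilde K S (pL p)))"

lemma pL_mSpec: "p \<in> mSpec R \<Longrightarrow> pL p \<in> mSpec S"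
  using pL by blast

lemma below_pL: "p \<in> mSpec R \<Longrightarrow> below (pL p) = p"
  using pL by (simp add: below_def)

text \<open>Cosets of the decomposition group correspond to the conjugates of the chosen prime.\<close>
lemma coset_char: "\<sigma> \<in> G \<Longrightarrow> coset p \<sigma> = {\<rho> \<in> G. \<rho> ` pL p = \<sigma> ` pL p}"
proof (intro subset_antisym subsetI)
  fix \<rho> assume s: "\<sigma> \<in> G" and "\<rho> \<in> coset p \<sigma>"
  then obtain g where g: "g \<in> G" "g ` pL p = pL p" "\<rho> = \<sigma> \<circ> g"
    by (auto simp: l_coset_def decomposition_group_def stabilizer_def)
  then show "\<rho> \<in> {\<rho> \<in> G. \<rho> ` pL p = \<sigma> ` pL p}"
    using Gal_comp[OF s g(1)] image_comp[of \<sigma> g "pL p"] by simp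
next
  fix \<rho> assume s: "\<sigma> \<in> G" and "\<rho> \<in> {\<rho> \<in> G. \<rho> ` pL p = \<sigma> ` pL p}"
  then have r: "\<rho> \<in> G" "\<rho> ` pL p = \<sigma> ` pL p" by auto
  let ?g = "Hilbert_Choice.inv \<sigma> \<circ> \<rho>"
  have "?g ` pL p = pL p"
    using image_comp[of "Hilbert_Choice.inv \<sigma>" \<rho> "pL p"] r(2) Gal_image_inv(1)[OF s] by simp
  then have "?g \<in> D p"
    using Gal_comp[OF Gal_inverse[OF s] r(1)] by (simp add: decomposition_group_def stabilizer_def)
  moreover have "\<rho> = \<sigma> \<circ> ?g" using Gal_inv_app(2)[OF s] by auto
  ultimately show "\<rho> \<in> coset p \<sigma>" by (auto simp: l_coset_def intro!: bexI[of _ ?g])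
qed

lemma coset_self: "\<sigma> \<in> G \<Longrightarrow> \<sigma> \<in> coset p \<sigma>"
  by (simp add: coset_char)

lemma topspace_T: "topspace (T p) = coset p ` G"
  by (simp add: coset_space_def topspace_quotient_topology topspace_krull)

lemma openin_T: "openin (T p) U \<longleftrightarrow> U \<subseteq> coset p ` G \<and> openin (krull_topology K) {\<sigma> \<in> G. coset p \<sigma> \<in> U}"
  by (simp add: coset_space_def openin_quotient_topology topspace_krull)

lemma compact_T: "compactin (T p) (topspace (T p))"
proof -
  have "continuous_map (krull_topology K) (T p) (coset p)"
    unfolding continuous_map_def topspace_krull by (auto simp: topspace_T openin_T)
  from image_compactin[OF compact_krull this] show ?thesis by (simp add: topspace_T)
qed

lemma usc_iff: "upper_semicont (T p) f \<longleftrightarrow> (\<forall>a. openin (krull_topology K) {\<sigma> \<in> G. f (coset p \<sigma>) < a})"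
proof -
  have "{\<sigma> \<in> G. coset p \<sigma> \<in> {x \<in> topspace (T p). f x < a}} = {\<sigma> \<in> G. f (coset p \<sigma>) < a}" for a
    by (auto simp: topspace_T)
  then show ?thesis by (auto simp: upper_semicont_def openin_T topspace_T)
qed

text \<open>The whole coset space is compact, so every function on it is compactly supported.\<close>
lemma S_0b_T:
  "f \<in> carrier (S_0b (T p) M) \<longleftrightarrow> f \<in> coset p ` G \<rightarrow>\<^sub>E M \<and> bounded_fun (T p) f \<and>
    (\<forall>a. openin (krull_topology K) {\<sigma> \<in> G. f (coset p \<sigma>) < a})"
proof -
  have "compactly_supported (T p) f" unfolding compactly_supported_def using compact_T by blast
  then show ?thesis by (simp add: S_0b_simps usc_iff topspace_T)
qed

lemma F_at:
  assumes p: "p \<in> mSpec R" and s: "\<sigma> \<in> G"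
  shows "F I p (coset p \<sigma>) = f_tilde K S I (\<sigma> ` pL p)"
proof -
  have "(\<lambda>\<sigma>. f_tilde K S I (\<sigma> ` pL p)) ` coset p \<sigma> = {f_tilde K S I (\<sigma> ` pL p)}"
    using coset_self[OF s, of p] unfolding coset_char[OF s] by auto
  then show ?thesis using p s by (simp add: F_tilde_def topspace_T)
qed

lemma prime_conjugate:
  assumes "P \<in> mSpec S"
  shows "\<exists>\<sigma>\<in>G. P = \<sigma> ` pL (below P)"
  using Gal_transitive[OF pL_mSpec[OF below_mSpec[OF assms]] assms] below_pL[OF below_mSpec[OF assms]] by auto

lemma below_conjugate: "p \<in> mSpec R \<Longrightarrow> \<sigma> \<in> G \<Longrightarrow> below (\<sigma> ` pL p) = p"
  using Gal_below below_pL by simp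

lemma bounded_funI:
  assumes "\<And>\<sigma>. \<sigma> \<in> G \<Longrightarrow> a \<le> f (coset p \<sigma>) \<and> f (coset p \<sigma>) \<le> b"
  shows "bounded_fun (T p) f"
  using assms unfolding bounded_fun_def topspace_T by blast

lemma F_component:
  assumes I: "fractional_ideal S I" and p: "p \<in> mSpec R"
  shows "F I p \<in> carrier (S_0b (T p) (V_tilde K S (pL p)))"
proof -
  obtain c where c: "c \<in> R" "c \<noteq> 0"
    "\<And>P. P \<in> mSpec S \<Longrightarrow> RT (- w P c) False \<le> f_tilde K S I P \<and> f_tilde K S I P \<le> RT (w P c) False"
    using f_tilde_bounded[OF I] by metis
  obtain k where k: "\<And>P. P \<in> mSpec S \<Longrightarrow> below P = p \<Longrightarrow> w P c = k"
    using w_K_below[OF p R_sub_K[OF c(1)] c(2)] by blast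
  note Q = Gal_mSpec[OF _ pL_mSpec[OF p]]
  show ?thesis
    unfolding S_0b_T
  proof (intro conjI allI)
    have "F I p (coset p \<sigma>) \<in> V_tilde K S (pL p)" if s: "\<sigma> \<in> G" for \<sigma>
      using f_tilde_in_V_tilde[OF Q[OF s] I] V_tilde_Gal[OF s pL_mSpec[OF p]] F_at[OF p s] by simp
    moreover have "F I p c = undefined" if "c \<notin> coset p ` G" for c
      using that p by (simp add: F_tilde_def topspace_T)
    ultimately show "F I p \<in> coset p ` G \<rightarrow>\<^sub>E V_tilde K S (pL p)" by (intro PiE_I) auto
    have "RT (- k) False \<le> F I p (coset p \<sigma>) \<and> F I p (coset p \<sigma>) \<le> RT k False" if s: "\<sigma> \<in> G" for \<sigma>
      using c(3)[OF Q[OF s]] k[OF Q[OF s] below_conjugate[OF p s]] F_at[OF p s] by simp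
    then show "bounded_fun (T p) (F I p)" by (rule bounded_funI)
    fix a
    have "{\<sigma> \<in> G. F I p (coset p \<sigma>) < a} = {\<sigma> \<in> G. f_tilde K S I (\<sigma> ` pL p) < a}"
      using F_at[OF p] by auto
    then show "openin (krull_topology K) {\<sigma> \<in> G. F I p (coset p \<sigma>) < a}"
      using f_tilde_usc[OF pL_mSpec[OF p] I] by simp
  qed
qed

text \<open>Components are trivial at the primes not containing \<open>c\<close>, where the bounds \<open>w P c\<close> vanish.\<close>
lemma F_closed:
  assumes I: "fractional_ideal S I"
  shows "F I \<in> carrier target"
  unfolding direct_sum_carrier
proof
  show "F I \<in> (\<Pi>\<^sub>E p\<in>mSpec R. carrier (S_0b (T p) (V_tilde K S (pL p))))"
    using F_component[OF I] by (intro PiE_I) (auto simp: F_tilde_def)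
  obtain c where c: "c \<in> R" "c \<noteq> 0"
    "\<And>P. P \<in> mSpec S \<Longrightarrow> RT (- w P c) False \<le> f_tilde K S I P \<and> f_tilde K S I P \<le> RT (w P c) False"
    using f_tilde_bounded[OF I] by metis
  have "F I p = (\<lambda>x\<in>topspace (T p). 0)" if p: "p \<in> mSpec R" "c \<notin> p" for p
  proof
    fix x
    show "F I p x = (\<lambda>x\<in>topspace (T p). 0) x"
    proof (cases "x \<in> coset p ` G")
      case True
      then obtain \<sigma> where s: "\<sigma> \<in> G" "x = coset p \<sigma>" by blast
      have P: "\<sigma> ` pL p \<in> mSpec S" by (rule Gal_mSpec[OF s(1) pL_mSpec[OF p(1)]])
      have "w (\<sigma> ` pL p) c = 0"
        using w_not_above[OF P c(1)] below_conjugate[OF p(1) s(1)] p(2) by simp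
      then have "f_tilde K S I (\<sigma> ` pL p) = RT 0 False" using c(3)[OF P] by (auto intro: antisym)
      then show ?thesis using True F_at[OF p(1) s(1)] s(2) by (simp add: topspace_T zero_rtilde_def)
    next
      case False
      then show ?thesis using p(1) by (simp add: F_tilde_def topspace_T)
    qed
  qed
  then have "{p \<in> mSpec R. F I p \<noteq> \<one>\<^bsub>S_0b (T p) (V_tilde K S (pL p))\<^esub>} \<subseteq> {p \<in> mSpec R. c \<in> p}"
    by (auto simp: S_0b_simps)
  then show "finite {p \<in> mSpec R. F I p \<noteq> \<one>\<^bsub>S_0b (T p) (V_tilde K S (pL p))\<^esub>}"
    using finite_primes_above[OF c(1,2)] by (rule finite_subset)
qed

text \<open>
  Outside of the index sets both sides have the default value, so they are compared at cosets of
  automorphisms.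
\<close>
lemma target_eqI:
  assumes "x \<in> (\<Pi>\<^sub>E p\<in>mSpec R. coset p ` G \<rightarrow>\<^sub>E UNIV)" "y \<in> (\<Pi>\<^sub>E p\<in>mSpec R. coset p ` G \<rightarrow>\<^sub>E UNIV)"
    and "\<And>p \<sigma>. p \<in> mSpec R \<Longrightarrow> \<sigma> \<in> G \<Longrightarrow> x p (coset p \<sigma>) = y p (coset p \<sigma>)"
  shows "x = y"
proof (rule PiE_ext[OF assms(1,2)])
  fix p assume p: "p \<in> mSpec R"
  show "x p = y p"
    by (rule PiE_ext[OF PiE_mem[OF assms(1) p] PiE_mem[OF assms(2) p]]) (use assms(3)[OF p] in auto)
qed

lemma target_component: "x \<in> carrier target \<Longrightarrow> p \<in> mSpec R \<Longrightarrow> x p \<in> carrier (S_0b (T p) (V_tilde K S (pL p)))"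
  unfolding direct_sum_carrier by (auto dest: PiE_mem)

lemma target_value: "x \<in> carrier target \<Longrightarrow> p \<in> mSpec R \<Longrightarrow> c \<in> coset p ` G \<Longrightarrow> x p c \<in> V_tilde K S (pL p)"
  using target_component[of x p] unfolding S_0b_T by (auto dest: PiE_mem)

lemma target_PiE:
  assumes x: "x \<in> carrier target"
  shows "x \<in> (\<Pi>\<^sub>E p\<in>mSpec R. coset p ` G \<rightarrow>\<^sub>E UNIV)"
proof (rule PiE_I)
  fix p assume "p \<in> mSpec R"
  then have "x p \<in> coset p ` G \<rightarrow>\<^sub>E V_tilde K S (pL p)" using target_component[OF x] unfolding S_0b_T by blast
  then show "x p \<in> coset p ` G \<rightarrow>\<^sub>E UNIV" by (simp add: PiE_iff)
next
  fix p assume "p \<notin> mSpec R"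
  then show "x p = undefined" using x unfolding direct_sum_carrier by (auto dest: PiE_arb)
qed

lemma target_mult:
  "p \<in> mSpec R \<Longrightarrow> \<sigma> \<in> G \<Longrightarrow> (x \<otimes>\<^bsub>target\<^esub> y) p (coset p \<sigma>) = x p (coset p \<sigma>) + y p (coset p \<sigma>)"
  by (simp add: direct_sum_mult S_0b_simps topspace_T)

lemma target_mult_PiE: "x \<otimes>\<^bsub>target\<^esub> y \<in> (\<Pi>\<^sub>E p\<in>mSpec R. coset p ` G \<rightarrow>\<^sub>E UNIV)"
  by (auto simp: direct_sum_mult S_0b_simps topspace_T)

lemma F_PiE: "F I \<in> (\<Pi>\<^sub>E p\<in>mSpec R. coset p ` G \<rightarrow>\<^sub>E UNIV)"
  by (auto simp: F_tilde_def topspace_T)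

lemma F_mult:
  assumes I: "fractional_ideal S I" and J: "fractional_ideal S J"
  shows "F (ideal_prod LL I J) = F I \<otimes>\<^bsub>target\<^esub> F J"
proof (rule target_eqI[OF F_PiE target_mult_PiE])
  fix p \<sigma> assume ps: "p \<in> mSpec R" "\<sigma> \<in> G"
  show "F (ideal_prod LL I J) p (coset p \<sigma>) = (F I \<otimes>\<^bsub>target\<^esub> F J) p (coset p \<sigma>)"
    unfolding target_mult[OF ps] F_at[OF ps] by (rule f_tilde_ideal_prod[OF Gal_mSpec[OF ps(2) pL_mSpec[OF ps(1)]] I J])
qed

lemma F_inj:
  assumes I: "fractional_ideal S I" and J: "fractional_ideal S J" and eq: "F I = F J"
  shows "I = J"
proof (rule fi_eqI[OF I J])
  fix P assume P: "P \<in> mSpec S"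
  obtain \<sigma> where s: "\<sigma> \<in> G" "P = \<sigma> ` pL (below P)" using prime_conjugate[OF P] by blast
  show "f_tilde K S I P = f_tilde K S J P"
    using F_at[OF below_mSpec[OF P] s(1), of I] F_at[OF below_mSpec[OF P] s(1), of J] eq s(2) by simp
qed

lemma F_surj:
  assumes g: "g \<in> carrier target"
  shows "\<exists>I. fractional_ideal S I \<and> F I = g"
proof -
  \<comment> \<open>The function on the maximal ideals of \<open>S\<close> that corresponds to \<open>g\<close>; the choice of \<open>\<sigma>\<close> does
    not matter.\<close>
  define h where "h P = g (below P) (coset (below P) (SOME \<sigma>. \<sigma> \<in> G \<and> P = \<sigma> ` pL (below P)))" for P
  have h: "h (\<sigma> ` pL p) = g p (coset p \<sigma>)" if p: "p \<in> mSpec R" and s: "\<sigma> \<in> G" for p \<sigma>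
  proof -
    define \<tau> where "\<tau> = (SOME \<tau>. \<tau> \<in> G \<and> \<sigma> ` pL p = \<tau> ` pL p)"
    have t: "\<tau> \<in> G \<and> \<sigma> ` pL p = \<tau> ` pL p" unfolding \<tau>_def by (rule someI[of _ \<sigma>]) (use s in simp)
    then have "coset p \<tau> = coset p \<sigma>" using s by (simp add: coset_char)
    then show ?thesis unfolding h_def below_conjugate[OF p s] \<tau>_def[symmetric] by simp
  qed
  define T0 where "T0 = {p \<in> mSpec R. g p \<noteq> \<one>\<^bsub>S_0b (T p) (V_tilde K S (pL p))\<^esub>}"
  have T0: "finite T0" "T0 \<subseteq> mSpec R" using g unfolding direct_sum_carrier T0_def by auto
  have gp: "g p \<in> carrier (S_0b (T p) (V_tilde K S (pL p)))" if "p \<in> mSpec R" for p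
    by (rule target_component[OF g that])
  have ex: "\<exists>p\<in>mSpec R. \<exists>\<sigma>\<in>G. P = \<sigma> ` pL p \<and> below P = p" if P: "P \<in> mSpec S" for P
  proof -
    obtain \<sigma> where "\<sigma> \<in> G" "P = \<sigma> ` pL (below P)" using prime_conjugate[OF P] by (elim bexE)
    then show ?thesis using below_mSpec[OF P] by (intro bexI[of _ "below P"] bexI[of _ \<sigma>] conjI refl)
  qed
  have "\<forall>p\<in>mSpec R. \<exists>n. 0 \<le> n \<and> (\<forall>\<sigma>\<in>G. RT (- n) False \<le> g p (coset p \<sigma>) \<and> g p (coset p \<sigma>) \<le> RT n False)"
  proof
    fix p assume "p \<in> mSpec R"
    then have "bounded_fun (T p) (g p)" using gp[of p] unfolding S_0b_T by simp
    then obtain a b where "\<forall>x\<in>topspace (T p). a \<le> g p x \<and> g p x \<le> b" unfolding bounded_fun_def by (elim exE)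
    then have ab: "a \<le> g p (coset p \<sigma>) \<and> g p (coset p \<sigma>) \<le> b" if "\<sigma> \<in> G" for \<sigma>
      using that by (simp add: topspace_T)
    obtain a1 s b1 t where [simp]: "a = RT a1 s" "b = RT b1 t" by (cases a; cases b)
    define n where "n = max \<bar>a1\<bar> \<bar>b1\<bar> + 1"
    have "RT (- n) False \<le> a" "b \<le> RT n False" by (auto simp: n_def)
    then show "\<exists>n. 0 \<le> n \<and> (\<forall>\<sigma>\<in>G. RT (- n) False \<le> g p (coset p \<sigma>) \<and> g p (coset p \<sigma>) \<le> RT n False)"
      using ab order_trans[OF _ conjunct1[OF ab]] order_trans[OF conjunct2[OF ab]]
      by (intro exI[of _ n]) (simp add: n_def)
  qed
  from bchoice[OF this] obtain n where
    n: "\<forall>p\<in>mSpec R. 0 \<le> n p \<and> (\<forall>\<sigma>\<in>G. RT (- n p) False \<le> g p (coset p \<sigma>) \<and> g p (coset p \<sigma>) \<le> RT (n p) False)"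
    by (elim exE)
  have zero: "h P = 0" if P: "P \<in> mSpec S" "below P \<notin> T0" for P
  proof -
    obtain p \<sigma> where ps: "p \<in> mSpec R" "\<sigma> \<in> G" "P = \<sigma> ` pL p" "below P = p" using ex[OF P(1)] by blast
    then have "g p = (\<lambda>x\<in>topspace (T p). 0)" using P(2) by (simp add: T0_def S_0b_simps)
    then show ?thesis using h[OF ps(1,2)] ps(2,3) by (simp add: topspace_T)
  qed
  have "\<exists>I. fractional_ideal S I \<and> (\<forall>P\<in>mSpec S. f_tilde K S I P = h P)"
  proof (rule realize_function[OF _ T0 zero])
    fix P assume P: "P \<in> mSpec S"
    then obtain p \<sigma> where ps: "p \<in> mSpec R" "\<sigma> \<in> G" "P = \<sigma> ` pL p" "below P = p" using ex by blast
    note hP = h[OF ps(1,2), folded ps(3)]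
    have "g p (coset p \<sigma>) \<in> V_tilde K S (pL p)" using gp[OF ps(1)] ps(2) unfolding S_0b_T by (auto dest: PiE_mem)
    then show "h P \<in> V_tilde K S P" unfolding hP using V_tilde_Gal[OF ps(2) pL_mSpec[OF ps(1)]] ps(3) by simp
    have nonneg: "0 \<le> sum n T0" using n T0(2) by (intro sum_nonneg) blast
    show "RT (- sum n T0) False \<le> h P \<and> h P \<le> RT (sum n T0) False"
    proof (cases "p \<in> T0")
      case True
      have "n p \<le> sum n T0" using n T0 True by (intro member_le_sum) auto
      then have "RT (- sum n T0) False \<le> RT (- n p) False" "RT (n p) False \<le> RT (sum n T0) False" by auto
      then show ?thesis unfolding hP using n ps(1,2) by (meson order_trans)
    next
      case False
      then have "h P = RT 0 False" using zero[OF P] ps(4) by (simp add: zero_rtilde_def)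
      then show ?thesis using nonneg by auto
    qed
    have "{\<sigma> \<in> G. h (\<sigma> ` pL p) < a} = {\<sigma> \<in> G. g p (coset p \<sigma>) < a}" for a using h[OF ps(1)] by auto
    then have "\<forall>a. openin (krull_topology K) {\<sigma> \<in> G. h (\<sigma> ` pL p) < a}" using gp[OF ps(1)] unfolding S_0b_T by simp
    then show "\<exists>Q\<in>mSpec S. below Q = below P \<and> (\<forall>a. openin (krull_topology K) {\<sigma> \<in> G. h (\<sigma> ` Q) < a})"
      using pL_mSpec[OF ps(1)] below_pL[OF ps(1)] ps(4) by (intro bexI[of _ "pL p"] conjI) auto
  qed
  then obtain I where I: "fractional_ideal S I" "\<And>P. P \<in> mSpec S \<Longrightarrow> f_tilde K S I P = h P" by blast
  have "F I = g"
  proof (rule target_eqI[OF F_PiE target_PiE[OF g]])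
    fix p \<sigma> assume ps: "p \<in> mSpec R" "\<sigma> \<in> G"
    show "F I p (coset p \<sigma>) = g p (coset p \<sigma>)"
      unfolding F_at[OF ps] I(2)[OF Gal_mSpec[OF ps(2) pL_mSpec[OF ps(1)]]] by (rule h[OF ps])
  qed
  then show ?thesis using I(1) by blast
qed

lemma fi_carrier: "I \<in> carrier (fractional_ideals S) \<longleftrightarrow> fractional_ideal S I"
  by (simp add: fractional_ideals_def)

lemma fi_mult: "I \<otimes>\<^bsub>fractional_ideals S\<^esub> J = ideal_prod LL I J"
  by (simp add: fractional_ideals_def)

lemma F_iso: "F \<in> iso (fractional_ideals S) target"
proof (rule isoI)
  show "F \<in> hom (fractional_ideals S) target"
    by (rule homI) (simp_all add: fi_carrier fi_mult F_closed F_mult)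
  show "bij_betw F (carrier (fractional_ideals S)) (carrier target)"
    unfolding bij_betw_def
  proof
    show "inj_on F (carrier (fractional_ideals S))"
      by (rule inj_onI) (simp add: fi_carrier F_inj)
    show "F ` carrier (fractional_ideals S) = carrier target"
      using F_closed F_surj by (fastforce simp: fi_carrier)
  qed
qed

lemma F_equivariant:
  assumes s: "\<sigma> \<in> G" and I: "fractional_ideal S I"
  shows "F (\<sigma> ` I) = galois_action R K pL \<sigma> (F I)"
proof (rule target_eqI[OF F_PiE])
  show "galois_action R K pL \<sigma> (F I) \<in> (\<Pi>\<^sub>E p\<in>mSpec R. coset p ` G \<rightarrow>\<^sub>E UNIV)"
    by (auto simp: galois_action_def topspace_T)
  fix p \<tau> assume ps: "p \<in> mSpec R" "\<tau> \<in> G"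
  let ?i = "Hilbert_Choice.inv \<sigma>"
  have i: "?i \<in> G" by (rule Gal_inverse[OF s])
  have it: "?i \<circ> \<tau> \<in> G" by (rule Gal_comp[OF i ps(2)])
  have "l_coset (Gal K) ?i (coset p \<tau>) = coset p (?i \<circ> \<tau>)"
    by (auto simp: l_coset_def comp_assoc)
  then have "galois_action R K pL \<sigma> (F I) p (coset p \<tau>) = F I p (coset p (?i \<circ> \<tau>))"
    using ps s by (simp add: galois_action_def topspace_T)
  also have "\<dots> = f_tilde K S I (?i ` \<tau> ` pL p)" unfolding F_at[OF ps(1) it] by (simp add: image_comp)
  also have "\<dots> = f_tilde K S (\<sigma> ` I) (\<sigma> ` ?i ` \<tau> ` pL p)"
    by (rule f_tilde_Gal[OF s _ I, symmetric]) (intro Gal_mSpec i ps(2) pL_mSpec ps(1))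
  also have "\<dots> = F (\<sigma> ` I) p (coset p \<tau>)" unfolding F_at[OF ps] Gal_image_inv(2)[OF s] ..
  finally show "F (\<sigma> ` I) p (coset p \<tau>) = galois_action R K pL \<sigma> (F I) p (coset p \<tau>)" by simp
qed

text \<open>
  The pointwise reflection of a family of functions, by which the conditions defining \<open>S_0ref\<close> are
  stated for all components at once.
\<close>
definition reflect :: "('a set \<Rightarrow> ('a \<Rightarrow> 'a) set \<Rightarrow> rtilde) \<Rightarrow> 'a set \<Rightarrow> ('a \<Rightarrow> 'a) set \<Rightarrow> rtilde"
  where "reflect x = (\<lambda>p\<in>mSpec R. \<lambda>c\<in>topspace (T p). iota (x p c))"

text \<open>
  The value monoid \<open>M\<close> may be smaller than \<open>V_tilde\<close>, which puts the regular and the invertible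
  ideals into one framework: the condition splits into semicontinuity of both functions and a
  condition on values.
\<close>
lemma ref_sum_iff:
  assumes M: "\<And>p. p \<in> mSpec R \<Longrightarrow> M p \<subseteq> V_tilde K S (pL p)"
  shows "x \<in> carrier (monoid_direct_sum (mSpec R) (\<lambda>p. S_0ref (T p) (M p))) \<longleftrightarrow>
    x \<in> carrier target \<and> reflect x \<in> carrier target \<and>
    (\<forall>p\<in>mSpec R. \<forall>c\<in>coset p ` G. x p c \<in> M p \<and> iota (x p c) \<in> M p)"
proof -
  have comp: "f \<in> carrier (S_0ref (T p) (M p)) \<longleftrightarrow> f \<in> carrier (S_0b (T p) (V_tilde K S (pL p))) \<and>
      (\<lambda>c\<in>topspace (T p). iota (f c)) \<in> carrier (S_0b (T p) (V_tilde K S (pL p))) \<and>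
      (\<forall>c\<in>coset p ` G. f c \<in> M p \<and> iota (f c) \<in> M p)" if p: "p \<in> mSpec R" for f p
    using M[OF p] unfolding S_0b_simps(5) S_0b_T topspace_T by (auto simp: PiE_iff)
  have "{p \<in> mSpec R. reflect x p \<noteq> (\<lambda>c\<in>topspace (T p). 0)} \<subseteq> {p \<in> mSpec R. x p \<noteq> (\<lambda>c\<in>topspace (T p). 0)}"
    by (auto simp: reflect_def zero_rtilde_def intro!: restrict_ext)
  then have fin: "finite {p \<in> mSpec R. x p \<noteq> (\<lambda>c\<in>topspace (T p). 0)} \<Longrightarrow>
      finite {p \<in> mSpec R. reflect x p \<noteq> (\<lambda>c\<in>topspace (T p). 0)}" by (rule finite_subset)
  have refl: "reflect x p = (\<lambda>c\<in>topspace (T p). iota (x p c))" if "p \<in> mSpec R" for p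
    using that by (simp add: reflect_def)
  have ext: "reflect x \<in> extensional (mSpec R)" by (simp add: reflect_def)
  have ref: "x \<in> carrier (monoid_direct_sum (mSpec R) (\<lambda>p. S_0ref (T p) (M p))) \<longleftrightarrow>
      x \<in> extensional (mSpec R) \<and> (\<forall>p\<in>mSpec R. x p \<in> carrier (S_0ref (T p) (M p))) \<and>
      finite {p \<in> mSpec R. x p \<noteq> (\<lambda>c\<in>topspace (T p). 0)}"
    unfolding direct_sum_carrier S_0b_simps(3,4) PiE_iff by blast
  have tgt: "y \<in> carrier target \<longleftrightarrow> y \<in> extensional (mSpec R) \<and>
      (\<forall>p\<in>mSpec R. y p \<in> carrier (S_0b (T p) (V_tilde K S (pL p)))) \<and>
      finite {p \<in> mSpec R. y p \<noteq> (\<lambda>c\<in>topspace (T p). 0)}" for y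
    unfolding direct_sum_carrier S_0b_simps(3,4) PiE_iff by blast
  have "(\<forall>p\<in>mSpec R. x p \<in> carrier (S_0ref (T p) (M p))) \<longleftrightarrow>
      (\<forall>p\<in>mSpec R. x p \<in> carrier (S_0b (T p) (V_tilde K S (pL p)))) \<and>
      (\<forall>p\<in>mSpec R. reflect x p \<in> carrier (S_0b (T p) (V_tilde K S (pL p)))) \<and>
      (\<forall>p\<in>mSpec R. \<forall>c\<in>coset p ` G. x p c \<in> M p \<and> iota (x p c) \<in> M p)"
    unfolding ball_conj_distrib[symmetric] by (rule ball_cong[OF HOL.refl]) (simp only: comp refl)
  then show ?thesis unfolding ref tgt using fin ext by argo
qed

lemma reflect_at: "p \<in> mSpec R \<Longrightarrow> \<sigma> \<in> G \<Longrightarrow> reflect x p (coset p \<sigma>) = iota (x p (coset p \<sigma>))"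
  by (simp add: reflect_def topspace_T)

lemma reflect_PiE: "reflect x \<in> (\<Pi>\<^sub>E p\<in>mSpec R. coset p ` G \<rightarrow>\<^sub>E UNIV)"
  by (auto simp: reflect_def topspace_T)

text \<open>
  If \<open>I = I J I\<close>, then \<open>J I J\<close> has the reflected function, which therefore lies in the target.
  Conversely, if the reflected function is that of an ideal \<open>J\<close>, then \<open>I\<close> and \<open>I J I\<close> have the
  same function.
\<close>
lemma F_Reg:
  "F ` Reg (fractional_ideals S) =
    carrier (monoid_direct_sum (mSpec R) (\<lambda>p. S_0ref (T p) (V_tilde K S (pL p))))"
proof (intro subset_antisym subsetI)
  fix x assume "x \<in> F ` Reg (fractional_ideals S)"
  then obtain I J where I: "fractional_ideal S I" "x = F I" and J: "fractional_ideal S J"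
    and IJI: "I = ideal_prod LL (ideal_prod LL I J) I"
    by (auto simp: Reg_def fi_carrier fi_mult)
  have JIJ: "fractional_ideal S (ideal_prod LL (ideal_prod LL J I) J)"
    by (intro ideal_prod_fractional I J)
  have FI: "F I = F I \<otimes>\<^bsub>target\<^esub> F J \<otimes>\<^bsub>target\<^esub> F I"
    unfolding F_mult[OF I(1) J, symmetric] F_mult[OF ideal_prod_fractional[OF I(1) J] I(1), symmetric] IJI[symmetric] ..
  have "F (ideal_prod LL (ideal_prod LL J I) J) = reflect x"
  proof (rule target_eqI[OF F_PiE reflect_PiE])
    fix p \<sigma> assume ps: "p \<in> mSpec R" "\<sigma> \<in> G"
    have "F I p (coset p \<sigma>) = F I p (coset p \<sigma>) + F J p (coset p \<sigma>) + F I p (coset p \<sigma>)"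
      by (rule arg_cong[OF FI, of "\<lambda>z. z p (coset p \<sigma>)", unfolded target_mult[OF ps]])
    from rtilde_regular[OF this]
    show "F (ideal_prod LL (ideal_prod LL J I) J) p (coset p \<sigma>) = reflect x p (coset p \<sigma>)"
      unfolding F_mult[OF ideal_prod_fractional[OF J I(1)] J] F_mult[OF J I(1)] target_mult[OF ps] reflect_at[OF ps] I(2) .
  qed
  then have r: "reflect x \<in> carrier target" using F_closed[OF JIJ] by simp
  moreover have x: "x \<in> carrier target" using F_closed[OF I(1)] I(2) by simp
  moreover have "x p c \<in> V_tilde K S (pL p) \<and> iota (x p c) \<in> V_tilde K S (pL p)"
    if p: "p \<in> mSpec R" and c: "c \<in> coset p ` G" for p c
  proof -
    have "x p c \<in> V_tilde K S (pL p)" "reflect x p c \<in> V_tilde K S (pL p)"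
      using target_value[OF x p c] target_value[OF r p c] by auto
    then show ?thesis using reflect_at[OF p] c by auto
  qed
  ultimately show "x \<in> carrier (monoid_direct_sum (mSpec R) (\<lambda>p. S_0ref (T p) (V_tilde K S (pL p))))"
    by (subst ref_sum_iff) auto
next
  fix x assume "x \<in> carrier (monoid_direct_sum (mSpec R) (\<lambda>p. S_0ref (T p) (V_tilde K S (pL p))))"
  then have x: "x \<in> carrier target" "reflect x \<in> carrier target"
    using ref_sum_iff[of "\<lambda>p. V_tilde K S (pL p)" x] by simp_all
  obtain I where I: "fractional_ideal S I" "F I = x" using F_surj[OF x(1)] by (elim exE conjE)
  obtain J where J: "fractional_ideal S J" "F J = reflect x" using F_surj[OF x(2)] by (elim exE conjE)
  have "F I = F (ideal_prod LL (ideal_prod LL I J) I)"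
  proof (rule target_eqI[OF F_PiE F_PiE])
    fix p \<sigma> assume ps: "p \<in> mSpec R" "\<sigma> \<in> G"
    show "F I p (coset p \<sigma>) = F (ideal_prod LL (ideal_prod LL I J) I) p (coset p \<sigma>)"
      unfolding F_mult[OF ideal_prod_fractional[OF I(1) J(1)] I(1)] F_mult[OF I(1) J(1)] target_mult[OF ps]
        I(2) J(2) reflect_at[OF ps] by (rule rtilde_iota_regular[symmetric])
  qed
  then have "I = ideal_prod LL (ideal_prod LL I J) I"
    by (intro F_inj ideal_prod_fractional I J)
  then have "I \<in> Reg (fractional_ideals S)" using I(1) J(1) by (auto simp: Reg_def fi_carrier fi_mult)
  then show "x \<in> F ` Reg (fractional_ideals S)" using I(2) by blast
qed

lemma F_one:
  assumes "p \<in> mSpec R" "\<sigma> \<in> G"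
  shows "F S p (coset p \<sigma>) = 0"
proof -
  have P: "\<sigma> ` pL p \<in> mSpec S" by (rule Gal_mSpec[OF assms(2) pL_mSpec[OF assms(1)]])
  have "f_tilde K S S (\<sigma> ` pL p) = RT 0 False"
  proof (rule rtilde_eqI)
    fix \<beta>
    show "f_tilde K S S (\<sigma> ` pL p) \<le> RT \<beta> False \<longleftrightarrow> RT 0 False \<le> RT \<beta> False"
      unfolding f_tilde_le_iff[OF P S_fractional]
    proof
      assume "\<exists>y\<in>S. y \<noteq> 0 \<and> w (\<sigma> ` pL p) y \<le> \<beta>"
      then show "RT 0 False \<le> RT \<beta> False" using w_nonneg[OF P] by force
    next
      assume "RT 0 False \<le> RT \<beta> False"
      then show "\<exists>y\<in>S. y \<noteq> 0 \<and> w (\<sigma> ` pL p) y \<le> \<beta>"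
        using w_one[OF P] by (intro bexI[of _ 1]) auto
    qed
  qed
  then show ?thesis using F_at[OF assms, of S] by (simp add: zero_rtilde_def)
qed

lemma val_set_V_tilde: "val_set K S P \<subseteq> V_tilde K S P" "RT a False \<in> V_tilde K S P \<Longrightarrow> RT a False \<in> val_set K S P"
  by (auto simp: V_tilde_def val_set_def split: if_splits)

text \<open>
  The function of an inverse is the reflected function, and a sum in \<open>rtilde\<close> is zero only if both
  second components vanish. So the values are in \<open>val_set\<close>; and for such values the sum with the
  reflection is zero.
\<close>
lemma F_invertible:
  "F ` invertible_ideals S =
    carrier (monoid_direct_sum (mSpec R) (\<lambda>p. S_0ref (T p) (val_set K S (pL p))))"
proof (intro subset_antisym subsetI)
  fix x assume "x \<in> F ` invertible_ideals S"
  then obtain I J where I: "fractional_ideal S I" "x = F I" and J: "fractional_ideal S J"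
    and IJ: "ideal_prod LL I J = S"
    by (auto simp: invertible_ideals_def fi_carrier fi_mult)
  have sum: "x p (coset p \<sigma>) + F J p (coset p \<sigma>) = 0" if ps: "p \<in> mSpec R" "\<sigma> \<in> G" for p \<sigma>
    using F_one[OF ps] target_mult[OF ps, of "F I" "F J"] F_mult[OF I(1) J] IJ I(2) by simp
  have J_refl: "F J = reflect x"
  proof (rule target_eqI[OF F_PiE reflect_PiE])
    fix p \<sigma> assume ps: "p \<in> mSpec R" "\<sigma> \<in> G"
    show "F J p (coset p \<sigma>) = reflect x p (coset p \<sigma>)"
      using sum[OF ps] unfolding reflect_at[OF ps] RT_plus_zero_iff by auto
  qed
  have x: "x \<in> carrier target" "reflect x \<in> carrier target" using F_closed[OF I(1)] F_closed[OF J] I(2) J_refl by simp_all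
  moreover have "x p c \<in> val_set K S (pL p) \<and> iota (x p c) \<in> val_set K S (pL p)"
    if p: "p \<in> mSpec R" and c: "c \<in> coset p ` G" for p c
  proof -
    obtain \<sigma> where s: "\<sigma> \<in> G" "c = coset p \<sigma>" using c by blast
    obtain a where a: "x p c = RT a False" using sum[OF p s(1)] s(2) unfolding RT_plus_zero_iff by blast
    have "x p c \<in> V_tilde K S (pL p)" "reflect x p c \<in> V_tilde K S (pL p)"
      using target_value[OF x(1) p c] target_value[OF x(2) p c] by auto
    then show ?thesis using reflect_at[OF p s(1), of x] a s(2) val_set_V_tilde(2) by simp
  qed
  ultimately show "x \<in> carrier (monoid_direct_sum (mSpec R) (\<lambda>p. S_0ref (T p) (val_set K S (pL p))))"
    using val_set_V_tilde(1) by (subst ref_sum_iff) auto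
next
  fix x assume "x \<in> carrier (monoid_direct_sum (mSpec R) (\<lambda>p. S_0ref (T p) (val_set K S (pL p))))"
  then have x: "x \<in> carrier target" "reflect x \<in> carrier target"
    "\<forall>p\<in>mSpec R. \<forall>c\<in>coset p ` G. x p c \<in> val_set K S (pL p) \<and> iota (x p c) \<in> val_set K S (pL p)"
    using ref_sum_iff[of "\<lambda>p. val_set K S (pL p)" x] val_set_V_tilde(1) by simp_all
  obtain I where I: "fractional_ideal S I" "F I = x" using F_surj[OF x(1)] by (elim exE conjE)
  obtain J where J: "fractional_ideal S J" "F J = reflect x" using F_surj[OF x(2)] by (elim exE conjE)
  have "F (ideal_prod LL I J) = F S"
  proof (rule target_eqI[OF F_PiE F_PiE])
    fix p \<sigma> assume ps: "p \<in> mSpec R" "\<sigma> \<in> G"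
    have "x p (coset p \<sigma>) \<in> val_set K S (pL p)" using x(3) ps by blast
    then obtain a where "x p (coset p \<sigma>) = RT a False" by (auto simp: val_set_def)
    then show "F (ideal_prod LL I J) p (coset p \<sigma>) = F S p (coset p \<sigma>)"
      unfolding F_mult[OF I(1) J(1)] target_mult[OF ps] I(2) J(2) reflect_at[OF ps] F_one[OF ps]
      by (simp add: zero_rtilde_def)
  qed
  then have "ideal_prod LL I J = S" by (intro F_inj ideal_prod_fractional I J S_fractional)
  then have "I \<in> invertible_ideals S"
    using I(1) J(1) by (auto simp: invertible_ideals_def fi_carrier fi_mult)
  then show "x \<in> F ` invertible_ideals S" using I(2) by blast
qed

end

theorem corollary2p11:
  fixes \<oo> K \<OO> :: "'l::field set" and pL :: "'l set \<Rightarrow> 'l set"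
  assumes "dedekind_domain \<oo>" and "\<not> field (ring_on \<oo>)"
    and "K = fraction_field \<oo>"
    and "\<OO> = integral_closure \<oo>"
    and "galois_extension K"
    and "\<And>\<pp>. \<pp> \<in> mSpec \<oo> \<Longrightarrow> pL \<pp> \<in> mSpec \<OO> \<and> pL \<pp> \<inter> \<oo> = \<pp>"
  shows
    "(F_tilde \<oo> K \<OO> pL \<in>
        iso (fractional_ideals \<OO>)
            (monoid_direct_sum (mSpec \<oo>)
               (\<lambda>\<pp>. S_0b (coset_space K (pL \<pp>)) (V_tilde K \<OO> (pL \<pp>)))) \<and>
      (\<forall>\<sigma> \<in> carrier (Gal K). \<forall>I \<in> carrier (fractional_ideals \<OO>).
         F_tilde \<oo> K \<OO> pL (\<sigma> ` I) = galois_action \<oo> K pL \<sigma> (F_tilde \<oo> K \<OO> pL I))) \<and>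
     F_tilde \<oo> K \<OO> pL ` Reg (fractional_ideals \<OO>) =
       carrier (monoid_direct_sum (mSpec \<oo>)
         (\<lambda>\<pp>. S_0ref (coset_space K (pL \<pp>)) (V_tilde K \<OO> (pL \<pp>)))) \<and>
     F_tilde \<oo> K \<OO> pL ` invertible_ideals \<OO> =
       carrier (monoid_direct_sum (mSpec \<oo>)
         (\<lambda>\<pp>. S_0ref (coset_space K (pL \<pp>)) (val_set K \<OO> (pL \<pp>))))"
proof -
  interpret dedekind \<oo> by (rule dedekindI[OF assms(1,2)])
  interpret galois_primes \<oo> pL
  proof unfold_locales
    show "algebraic_extension (fraction_field \<oo>)" "galois_extension (fraction_field \<oo>)"
      using assms(3,5) by (auto simp: galois_extension_def)
    show "pL p \<in> mSpec (integral_closure \<oo>) \<and> pL p \<inter> \<oo> = p" if "p \<in> mSpec \<oo>" for p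
      using assms(6)[OF that] assms(4) by simp
  qed
  show ?thesis
    unfolding assms(3,4)
    using F_iso F_equivariant F_Reg F_invertible by (simp add: fi_carrier)
qed

end
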